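(* Let $k$ be a field of characteristic $\neq 2$ and let $g(u)\in k[u]$ be a nonzero polynomial of even degree. Then every curve with only 1 place at infinity on the Pell surface $$S_g:=\bigl(x^2-g(u)y^2=1\bigr)\subset\mathbb{A}^3_{xyu}$$ is an affine line.
   Context: Let $D$ be an (irreducible, reduced) affine curve over $k$ with normalization $D^n$, and let $D^n\subset\bar D$ be its smooth compactification. The places at infinity of $D$ are the geometric points of $\bar D\setminus D^n$; $D$ has only 1 place at infinity if there is exactly one such geometric point. A closed curve $B\subset S_g$ is an affine line if $B\cong\mathbb{A}^1$.
   Formalization: The smooth compactification need not exist over an imperfect field; "only 1 place at infinity" here includes that the regular compactification of the curve is smooth over k (automatic for perfect k), since otherwise the claim fails; "affine line" means isomorphic to the affine line over k. *)

theory Defs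
  imports "HOL-Algebra.Algebraic_Closure_Type"
begin

text \<open>
  The coordinate ring \<open>k[x,y,u]\<close> of affine 3-space is the iterated polynomial ring
  \<open>k[u][y][x]\<close>: \<open>x\<close> is the outermost and \<open>u\<close> the innermost variable.
\<close>

type_synonym 'k poly3 = "'k poly poly poly"

definition const3 :: "'k::field \<Rightarrow> 'k poly3" where
  "const3 c = [:[:[:c:]:]:]"

definition var_x :: "'k::field poly3" where
  "var_x = [:0, 1:]"

definition var_y :: "'k::field poly3" where
  "var_y = [:[:0, 1:]:]"

definition poly_in_u :: "'k::field poly \<Rightarrow> 'k poly3" where
  "poly_in_u g = [:[:g:]:]"

definition pell_poly :: "'k::field poly \<Rightarrow> 'k poly3" where
  "pell_poly g = var_x ^ 2 - poly_in_u g * var_y ^ 2 - 1"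

text \<open>
  An integral (irreducible and reduced) closed subscheme of affine 3-space over \<open>k\<close> is given by
  its prime ideal \<open>D\<close> in \<open>k[x,y,u]\<close>. It is a curve iff \<open>k[x,y,u]/D\<close> has Krull dimension 1, and it
  lies on \<open>S\<^sub>g\<close> iff \<open>D\<close> contains the equation of \<open>S\<^sub>g\<close>.
\<close>

definition integral_curve :: "'k::field poly3 set \<Rightarrow> bool" where
  "integral_curve D \<longleftrightarrow>
     primeideal D ring_of_type_algebra \<and>
     \<not> maximalideal D ring_of_type_algebra \<and>
     (\<forall>Q. primeideal Q ring_of_type_algebra \<and> D \<subset> Q \<longrightarrow> maximalideal Q ring_of_type_algebra)"

definition curve_on_pell_surface :: "'k::field poly \<Rightarrow> 'k poly3 set \<Rightarrow> bool" where
  "curve_on_pell_surface g D \<longleftrightarrow> integral_curve D \<and> pell_poly g \<in> D"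

definition coordinate_ring :: "'k::field poly3 set \<Rightarrow> 'k poly3 set ring" where
  "coordinate_ring D = (ring_of_type_algebra :: 'k poly3 ring) Quot D"

text \<open>
  \<open>D\<close> is isomorphic, as a \<open>k\<close>-scheme, to the affine line over \<open>k\<close> iff its coordinate ring is
  isomorphic to \<open>k[t]\<close> as a \<open>k\<close>-algebra.
\<close>

definition affine_line :: "'k::field poly3 set \<Rightarrow> bool" where
  "affine_line D \<longleftrightarrow>
     (\<exists>h \<in> ring_iso (coordinate_ring D) (ring_of_type_algebra :: 'k poly ring).
        \<forall>c. h (D +>\<^bsub>ring_of_type_algebra\<^esub> const3 c) = [:c:])"

text \<open>
  A model of the function field of \<open>D\<close>: a field \<open>'F\<close> together with the homomorphism
  \<open>\<phi> : k[x,y,u] \<rightarrow> 'F\<close> that induces an embedding of \<open>k[x,y,u]/D\<close> whose field of fractions is \<open>'F\<close>.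
  Any two models are isomorphic over \<open>k[x,y,u]\<close>.
\<close>

definition is_function_field :: "'k::field poly3 set \<Rightarrow> ('k poly3 \<Rightarrow> 'F::field) \<Rightarrow> bool" where
  "is_function_field D \<phi> \<longleftrightarrow>
     \<phi> \<in> ring_hom ring_of_type_algebra ring_of_type_algebra \<and>
     {p. \<phi> p = 0} = D \<and>
     (\<forall>z. \<exists>p q. \<phi> q \<noteq> 0 \<and> z = \<phi> p / \<phi> q)"

text \<open>The coordinate ring of the normalization, i.e. the integral closure of \<open>k[D]\<close> in \<open>k(D)\<close>.\<close>

definition normalization_ring :: "('k::field poly3 \<Rightarrow> 'F::field) \<Rightarrow> 'F set" where
  "normalization_ring \<phi> =
     {z. \<exists>f :: 'F poly. Polynomial.lead_coeff f = 1 \<and> (\<forall>i. Polynomial.coeff f i \<in> range \<phi>) \<and>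
           poly f z = 0}"

text \<open>
  The regular compactification of the normalization is the complete regular curve with function
  field \<open>k(D)\<close>; its closed points correspond, via their local rings, to the valuation rings of
  \<open>k(D)\<close> that contain \<open>k\<close> and are different from \<open>k(D)\<close> (over a function field of one variable these
  are automatically discrete). Such a point lies on the normalization iff its local ring contains the
  coordinate ring of the normalization.
\<close>

definition points_compactification :: "('k::field poly3 \<Rightarrow> 'F::field) \<Rightarrow> 'F set set" where
  "points_compactification \<phi> =
     {V. subring V ring_of_type_algebra \<and> range (\<phi> \<circ> const3) \<subseteq> V \<and> V \<noteq> UNIV \<and>
         (\<forall>z. z \<in> V \<or> inverse z \<in> V)}"

definition points_normalization :: "('k::field poly3 \<Rightarrow> 'F::field) \<Rightarrow> 'F set set" where
  "points_normalization \<phi> = {V \<in> points_compactification \<phi>. normalization_ring \<phi> \<subseteq> V}"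

text \<open>
  A geometric point over a closed point with local ring \<open>V\<close> is a \<open>k\<close>-embedding of the residue field of
  \<open>V\<close> into the algebraic closure of \<open>k\<close>, i.e. a \<open>k\<close>-algebra homomorphism \<open>\<theta>\<close> on \<open>V\<close> whose kernel
  consists of the non-units of \<open>V\<close>.
\<close>

definition geometric_points_over ::
    "('k::field poly3 \<Rightarrow> 'F::field) \<Rightarrow> 'F set set \<Rightarrow> ('F set \<times> ('F \<Rightarrow> 'k alg_closure)) set" where
  "geometric_points_over \<phi> S =
     {(V, \<theta>). V \<in> S \<and> \<theta> \<in> extensional V \<and>
        \<theta> \<in> ring_hom (ring_of_type_algebra\<lparr>carrier := V\<rparr>) ring_of_type_algebra \<and>
        (\<forall>c. \<theta> (\<phi> (const3 c)) = to_ac c) \<and>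
        (\<forall>z\<in>V. \<theta> z = 0 \<longleftrightarrow> z = 0 \<or> inverse z \<notin> V)}"

text \<open>
  The tangent space at the geometric point \<open>(V, \<theta>)\<close>: the \<open>k\<close>-derivations from \<open>V\<close> to the algebraic
  closure of \<open>k\<close>, the latter being a \<open>V\<close>-module via \<open>\<theta>\<close>. It is the dual of the fibre at \<open>\<theta>\<close> of the sheaf
  of differentials over \<open>k\<close>, so the compactification is smooth over \<open>k\<close> iff all these spaces have
  dimension 1.
\<close>

definition tangent_space ::
    "('k::field poly3 \<Rightarrow> 'F::field) \<Rightarrow> 'F set \<Rightarrow> ('F \<Rightarrow> 'k alg_closure) \<Rightarrow> ('F \<Rightarrow> 'k alg_closure) set"
  where
  "tangent_space \<phi> V \<theta> =
     {\<delta>. (\<forall>c. \<delta> (\<phi> (const3 c)) = 0) \<and>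
         (\<forall>a\<in>V. \<forall>b\<in>V. \<delta> (a + b) = \<delta> a + \<delta> b) \<and>
         (\<forall>a\<in>V. \<forall>b\<in>V. \<delta> (a * b) = \<theta> a * \<delta> b + \<theta> b * \<delta> a)}"

definition smooth_compactification :: "('k::field poly3 \<Rightarrow> 'F::field) \<Rightarrow> bool" where
  "smooth_compactification \<phi> \<longleftrightarrow>
     (\<forall>(V, \<theta>) \<in> geometric_points_over \<phi> (points_compactification \<phi>).
        \<exists>\<delta> \<in> tangent_space \<phi> V \<theta>. (\<exists>a\<in>V. \<delta> a \<noteq> 0) \<and>
          (\<forall>\<delta>' \<in> tangent_space \<phi> V \<theta>. \<exists>c. \<forall>a\<in>V. \<delta>' a = c * \<delta> a))"

definition places_at_infinity ::
    "('k::field poly3 \<Rightarrow> 'F::field) \<Rightarrow> ('F set \<times> ('F \<Rightarrow> 'k alg_closure)) set" where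
  "places_at_infinity \<phi> =
     geometric_points_over \<phi> (points_compactification \<phi> - points_normalization \<phi>)"

text \<open>
  Having only one place at infinity refers to a smooth compactification. Its existence, which is
  automatic over perfect fields, is part of the definition: over an imperfect field the curve
  \<open>Spec k(a\<^sup>1\<^sup>/\<^sup>p)[u]\<close>, with \<open>a\<close> in \<open>k\<close> not a \<open>p\<close>-th power, has a regular compactification with exactly one
  geometric point at infinity, but that compactification is not smooth over \<open>k\<close>, and the curve is
  not isomorphic to the affine line over \<open>k\<close>.
\<close>

definition only_one_place_at_infinity :: "('k::field poly3 \<Rightarrow> 'F::field) \<Rightarrow> bool" where
  "only_one_place_at_infinity \<phi> \<longleftrightarrow>
     smooth_compactification \<phi> \<and> (\<exists>!P. P \<in> places_at_infinity \<phi>)"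

end

theory Submission
  imports Defs
begin

text \<open>
  A residue map into the algebraic closure defined on a subring of the function field extends to a
  valuation ring (place extension theorem), so uniqueness of the place \<open>V\<^sub>0\<close> at infinity has
  strong consequences: a regular function without pole at \<open>V\<^sub>0\<close> is algebraic over \<open>k\<close>, and
  conjugates of algebraic elements coincide. If the coordinate ring is \<open>k[c, t]\<close> with \<open>c\<close>
  algebraic and \<open>t\<close> transcendental, then \<open>c\<close> is purely inseparable over \<open>k\<close>; were \<open>c\<close> not in \<open>k\<close>, its
  minimal polynomial would have derivative \<open>0\<close>, and differentiation with respect to \<open>c\<close> and to \<open>1/t\<close>
  would give two independent tangent vectors at \<open>V\<^sub>0\<close>, against smoothness. Hence the curve is a line.

  It remains to bring the coordinate ring into this form. If \<open>u\<close> is algebraic, or \<open>x\<close> has no pole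
  at \<open>V\<^sub>0\<close>, one parametrizes the conic \<open>x\<^sup>2 - g y\<^sup>2 = 1\<close> by a slope. Otherwise the leading coefficient
  of \<open>g\<close> is a square in \<open>k\<close>, so \<open>\<surd>g\<close> is a Laurent series in \<open>1/u\<close>, and \<open>x/y\<close> is so close to it
  that for a convergent \<open>p/q\<close> of \<open>\<surd>g\<close> with \<open>q\<close> not larger than \<open>y\<close> the regular function
  \<open>p y - q x\<close> vanishes at \<open>V\<^sub>0\<close>, hence is \<open>0\<close>. As \<open>p\<close> and \<open>q\<close> are coprime, \<open>x = p c\<close> and
  \<open>y = q c\<close> with \<open>c\<close> regular; by \<open>c\<^sup>2 (p\<^sup>2 - g q\<^sup>2) = 1\<close> it is a unit, hence algebraic, and the
  coordinate ring is \<open>k[c, u]\<close>.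
\<close>

section \<open>Evaluation of polynomials along ring homomorphisms\<close>

definition rhom :: "('a::comm_ring_1 \<Rightarrow> 'b::comm_ring_1) \<Rightarrow> bool" where
  "rhom f \<longleftrightarrow> f 1 = 1 \<and> (\<forall>x y. f (x + y) = f x + f y) \<and> (\<forall>x y. f (x * y) = f x * f y)"

lemma rhom_add: "rhom f \<Longrightarrow> f (x + y) = f x + f y"
  and rhom_mult: "rhom f \<Longrightarrow> f (x * y) = f x * f y"
  and rhom_one: "rhom f \<Longrightarrow> f 1 = 1"
  by (auto simp: rhom_def)

lemma rhom_zero: "rhom f \<Longrightarrow> f 0 = 0"
  using rhom_add[of f 0 0] by simp

lemma rhom_minus: "rhom f \<Longrightarrow> f (- x) = - f x"
  using rhom_add[of f x "- x"] rhom_zero[of f] by (simp add: eq_neg_iff_add_eq_0 add.commute)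

lemma rhom_diff: "rhom f \<Longrightarrow> f (x - y) = f x - f y"
  using rhom_add[of f x "- y"] rhom_minus[of f y] by simp

lemma rhom_power: "rhom f \<Longrightarrow> f (x ^ n) = f x ^ n"
  by (induction n) (auto simp: rhom_one rhom_mult)

lemmas rhom_simps = rhom_add rhom_mult rhom_one rhom_zero rhom_minus rhom_diff rhom_power

lemma rhom_comp: "rhom f \<Longrightarrow> rhom g \<Longrightarrow> rhom (\<lambda>x. g (f x))"
  by (auto simp: rhom_def)

lemma rhom_eq_0_iff:
  fixes f :: "'a::field \<Rightarrow> 'b::field"
  assumes "rhom f"
  shows "f x = 0 \<longleftrightarrow> x = 0"
proof
  assume *: "f x = 0"
  show "x = 0"
  proof (rule ccontr)
    assume "x \<noteq> 0"
    hence "f x * f (inverse x) = 1"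
      by (simp flip: rhom_mult[OF assms] add: rhom_one[OF assms])
    thus False using * by simp
  qed
qed (simp add: rhom_zero[OF assms])

lemma rhom_inverse:
  fixes f :: "'a::field \<Rightarrow> 'b::field"
  assumes "rhom f"
  shows "f (inverse x) = inverse (f x)"
proof (cases "x = 0")
  case False
  hence "f x * f (inverse x) = 1"
    by (simp flip: rhom_mult[OF assms] add: rhom_one[OF assms])
  thus ?thesis by (metis inverse_unique)
qed (simp add: rhom_zero[OF assms])

text \<open>The coefficient map is a parameter so that evaluations nest:
  \<open>ev (ev f a) b\<close> evaluates polynomials over a polynomial ring, the form in which
  \<open>k[c, t]\<close> and \<open>k[x, y, u]\<close> appear below.\<close>

definition ev :: "('a::comm_ring_1 \<Rightarrow> 'b::comm_ring_1) \<Rightarrow> 'b \<Rightarrow> 'a poly \<Rightarrow> 'b" where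
  "ev f z p = poly (map_poly f p) z"

lemma ev_pCons: "f 0 = 0 \<Longrightarrow> ev f z (pCons a p) = f a + z * ev f z p"
  by (simp add: ev_def map_poly_pCons)

lemma ev_0: "ev f z 0 = 0"
  by (simp add: ev_def)

lemma rhom_ev:
  assumes "rhom f"
  shows "rhom (ev f z)"
proof -
  note [simp] = rhom_simps[OF assms] ev_0 ev_pCons[of f, OF rhom_zero[OF assms]]
  have add: "ev f z (p + q) = ev f z p + ev f z q" for p q
    by (induction p q rule: poly_induct2) (auto simp: algebra_simps)
  have smult: "ev f z (smult a p) = f a * ev f z p" for a p
    by (induction p) (auto simp: algebra_simps)
  have mult: "ev f z (p * q) = ev f z p * ev f z q" for p q
    by (induction p) (auto simp: add smult algebra_simps)
  show ?thesis
    by (auto simp: rhom_def add mult one_pCons)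
qed

lemma ev_const: "f 0 = 0 \<Longrightarrow> ev f z [:a:] = f a"
  by (simp add: ev_pCons ev_0)

lemma ev_X: "rhom f \<Longrightarrow> ev f z [:0, 1:] = z"
  by (simp add: ev_pCons rhom_zero rhom_one ev_0)

lemma ev_monom: "rhom f \<Longrightarrow> ev f z (monom a n) = f a * z ^ n"
  by (simp add: ev_def map_poly_monom rhom_zero poly_monom)

lemma ev_smult: "rhom f \<Longrightarrow> ev f z (smult a p) = f a * ev f z p"
  using rhom_mult[OF rhom_ev, of f z "[:a:]" p] by (simp add: ev_const rhom_zero)

section \<open>Places\<close>

text \<open>\<open>V\<close> may be the whole field. The disjunct \<open>z = 0\<close> in the kernel
  condition accounts for \<open>inverse 0 = 0\<close>, which lies in \<open>V\<close>.\<close>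

locale place =
  fixes V :: "'F::field set" and \<theta> :: "'F \<Rightarrow> 'o::field"
  assumes one: "1 \<in> V"
    and add: "a \<in> V \<Longrightarrow> b \<in> V \<Longrightarrow> a + b \<in> V"
    and minus: "a \<in> V \<Longrightarrow> - a \<in> V"
    and mult: "a \<in> V \<Longrightarrow> b \<in> V \<Longrightarrow> a * b \<in> V"
    and total: "z \<in> V \<or> inverse z \<in> V"
    and \<theta>_one: "\<theta> 1 = 1"
    and \<theta>_add: "a \<in> V \<Longrightarrow> b \<in> V \<Longrightarrow> \<theta> (a + b) = \<theta> a + \<theta> b"
    and \<theta>_mult: "a \<in> V \<Longrightarrow> b \<in> V \<Longrightarrow> \<theta> (a * b) = \<theta> a * \<theta> b"
    and \<theta>_eq_0_iff: "z \<in> V \<Longrightarrow> \<theta> z = 0 \<longleftrightarrow> z = 0 \<or> inverse z \<notin> V"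
begin

lemma zero: "0 \<in> V"
  using add[OF one minus[OF one]] by simp

lemma diff: "a \<in> V \<Longrightarrow> b \<in> V \<Longrightarrow> a - b \<in> V"
  using add[of a "- b"] minus by simp

lemma power: "a \<in> V \<Longrightarrow> a ^ n \<in> V"
  by (induction n) (auto simp: one mult)

lemma sum: "(\<And>i. i \<in> A \<Longrightarrow> f i \<in> V) \<Longrightarrow> sum f A \<in> V"
  by (induction A rule: infinite_finite_induct) (auto simp: zero add)

lemma \<theta>_zero: "\<theta> 0 = 0"
  using \<theta>_eq_0_iff[OF zero] by simp

lemma \<theta>_minus: "a \<in> V \<Longrightarrow> \<theta> (- a) = - \<theta> a"
  using \<theta>_add[of a "- a"] minus[of a] \<theta>_zero by (simp add: eq_neg_iff_add_eq_0 add.commute)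

lemma \<theta>_diff: "a \<in> V \<Longrightarrow> b \<in> V \<Longrightarrow> \<theta> (a - b) = \<theta> a - \<theta> b"
  using \<theta>_add[of a "- b"] \<theta>_minus[of b] minus by simp

lemma \<theta>_power: "a \<in> V \<Longrightarrow> \<theta> (a ^ n) = \<theta> a ^ n"
  by (induction n) (auto simp: \<theta>_one \<theta>_mult power)

lemma \<theta>_sum: "(\<And>i. i \<in> A \<Longrightarrow> f i \<in> V) \<Longrightarrow> \<theta> (sum f A) = (\<Sum>i\<in>A. \<theta> (f i))"
  by (induction A rule: infinite_finite_induct) (auto simp: \<theta>_zero \<theta>_add sum)

lemma inverse: "z \<in> V \<Longrightarrow> \<theta> z \<noteq> 0 \<Longrightarrow> inverse z \<in> V"
  using \<theta>_eq_0_iff by blast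

lemma \<theta>_inverse: "z \<in> V \<Longrightarrow> \<theta> z \<noteq> 0 \<Longrightarrow> \<theta> (inverse z) = inverse (\<theta> z)"
proof -
  assume z: "z \<in> V" "\<theta> z \<noteq> 0"
  have "z \<noteq> 0" using z \<theta>_zero by auto
  hence "\<theta> z * \<theta> (inverse z) = 1"
    using \<theta>_mult[OF z(1) inverse[OF z]] \<theta>_one by simp
  thus ?thesis by (metis inverse_unique)
qed

lemma pole: "z \<notin> V \<Longrightarrow> inverse z \<in> V \<and> \<theta> (inverse z) = 0"
  using total[of z] \<theta>_eq_0_iff[of "inverse z"] by auto

lemma divide: "z \<in> V \<Longrightarrow> w \<in> V \<Longrightarrow> \<theta> w \<noteq> 0 \<Longrightarrow> z / w \<in> V"
  by (simp add: field_class.field_divide_inverse mult inverse)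

lemma \<theta>_divide: "z \<in> V \<Longrightarrow> w \<in> V \<Longrightarrow> \<theta> w \<noteq> 0 \<Longrightarrow> \<theta> (z / w) = \<theta> z / \<theta> w"
  by (simp add: field_class.field_divide_inverse \<theta>_mult inverse \<theta>_inverse)

text \<open>If \<open>z\<close> were a pole, \<open>w = inverse z\<close> would have value 0.
  Multiplying the equation by \<open>w ^ n\<close> and taking values leaves only the leading term,
  so 1 = 0.\<close>

lemma integrally_closed:
  assumes lc: "Polynomial.lead_coeff f = 1" and f: "\<And>i. Polynomial.coeff f i \<in> V" and z: "poly f z = 0"
  shows "z \<in> V"
proof (rule ccontr)
  assume nz: "z \<notin> V"
  define w where "w = inverse z"
  have w: "w \<in> V" "\<theta> w = 0" using pole[OF nz] by (auto simp: w_def)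
  have z0: "z \<noteq> 0" using nz zero by auto
  define n where "n = Polynomial.degree f"
  have "0 = poly f z * w ^ n" using z by simp
  also have "poly f z * w ^ n = (\<Sum>i\<le>n. Polynomial.coeff f i * w ^ (n - i))"
  proof -
    have "z ^ i * w ^ n = w ^ (n - i)" if "i \<le> n" for i
    proof -
      have "w ^ n = w ^ i * w ^ (n - i)" using that by (simp flip: power_add)
      thus ?thesis using z0 by (simp add: w_def field_simps)
    qed
    thus ?thesis
      by (simp add: poly_altdef n_def sum_distrib_right mult.assoc)
  qed
  also have "{..n} = insert n {..<n}" by auto
  also have "(\<Sum>i\<in>insert n {..<n}. Polynomial.coeff f i * w ^ (n - i)) = 1 + (\<Sum>i<n. Polynomial.coeff f i * w ^ (n - i))"
    using lc by (simp add: n_def)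
  finally have "0 = \<theta> (1 + (\<Sum>i<n. Polynomial.coeff f i * w ^ (n - i)))" by (simp add: \<theta>_zero)
  also have "\<dots> = 1 + (\<Sum>i<n. \<theta> (Polynomial.coeff f i * w ^ (n - i)))"
    by (simp add: \<theta>_add \<theta>_one one sum mult f power w \<theta>_sum)
  also have "(\<Sum>i<n. \<theta> (Polynomial.coeff f i * w ^ (n - i))) = 0"
    by (intro sum.neutral) (auto simp: \<theta>_mult f w \<theta>_power power)
  finally show False by simp
qed

end

text \<open>
  The graph of a residue map is a subring \<open>G\<close> of \<open>F \<times> \<Omega>\<close> that is single valued; places are the
  maximal such subrings.
\<close>

definition prodring :: "('F::comm_ring_1 \<times> 'o::comm_ring_1) set \<Rightarrow> bool" where
  "prodring G \<longleftrightarrow> (1, 1) \<in> G \<and>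
     (\<forall>(a, b)\<in>G. (- a, - b) \<in> G \<and> (\<forall>(c, d)\<in>G. (a + c, b + d) \<in> G \<and> (a * c, b * d) \<in> G))"

text \<open>Differences of pairs stay in a subring, so uniqueness of the value at 0 gives uniqueness
  at every element.\<close>

definition single_valued_at_0 :: "('F::comm_ring_1 \<times> 'o::comm_ring_1) set \<Rightarrow> bool" where
  "single_valued_at_0 G \<longleftrightarrow> (\<forall>b. (0, b) \<in> G \<longrightarrow> b = 0)"

context
  fixes G :: "('F::field \<times> 'o::field) set"
  assumes G: "prodring G"
begin

lemma prodring_one: "(1, 1) \<in> G"
  and prodring_minus: "(a, b) \<in> G \<Longrightarrow> (- a, - b) \<in> G"
  and prodring_add: "(a, b) \<in> G \<Longrightarrow> (c, d) \<in> G \<Longrightarrow> (a + c, b + d) \<in> G"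
  and prodring_mult: "(a, b) \<in> G \<Longrightarrow> (c, d) \<in> G \<Longrightarrow> (a * c, b * d) \<in> G"
  using G by (auto simp: prodring_def)

lemma prodring_zero: "(0, 0) \<in> G"
  using prodring_add[OF prodring_one prodring_minus[OF prodring_one]] by simp

lemma prodring_diff: "(a, b) \<in> G \<Longrightarrow> (c, d) \<in> G \<Longrightarrow> (a - c, b - d) \<in> G"
  using prodring_add[OF _ prodring_minus, of a b c d] by simp

lemma prodring_power: "(a, b) \<in> G \<Longrightarrow> (a ^ n, b ^ n) \<in> G"
  by (induction n) (auto simp: prodring_one prodring_mult)

lemma prodring_sum: "(\<And>i. i \<in> A \<Longrightarrow> (f i, g i) \<in> G) \<Longrightarrow> (sum f A, sum g A) \<in> G"
  by (induction A rule: infinite_finite_induct) (auto simp: prodring_zero prodring_add)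

text \<open>This is the polynomial ring over \<open>G\<close>, each polynomial being split into its
  part over the field and its residue polynomial.\<close>

definition graph_polys :: "('F poly \<times> 'o poly) set" where
  "graph_polys = {(f, f'). \<forall>i. (Polynomial.coeff f i, Polynomial.coeff f' i) \<in> G}"

lemma graph_polys_coeff: "(f, f') \<in> graph_polys \<Longrightarrow> (Polynomial.coeff f i, Polynomial.coeff f' i) \<in> G"
  by (simp add: graph_polys_def)

lemma graph_polys_const: "(a, b) \<in> G \<Longrightarrow> ([:a:], [:b:]) \<in> graph_polys"
  by (auto simp: graph_polys_def coeff_pCons prodring_zero split: nat.splits)

lemma graph_polys_X: "([:0, 1:], [:0, 1:]) \<in> graph_polys"
  by (auto simp: graph_polys_def coeff_pCons prodring_zero prodring_one split: nat.splits)

lemma graph_polys_monom: "(a, b) \<in> G \<Longrightarrow> (monom a n, monom b n) \<in> graph_polys"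
  by (auto simp: graph_polys_def prodring_zero)

lemma graph_polys_minus: "(f, f') \<in> graph_polys \<Longrightarrow> (- f, - f') \<in> graph_polys"
  by (simp add: graph_polys_def prodring_minus)

lemma graph_polys_add: "(f, f') \<in> graph_polys \<Longrightarrow> (h, h') \<in> graph_polys \<Longrightarrow> (f + h, f' + h') \<in> graph_polys"
  by (simp add: graph_polys_def prodring_add)

lemma graph_polys_diff: "(f, f') \<in> graph_polys \<Longrightarrow> (h, h') \<in> graph_polys \<Longrightarrow> (f - h, f' - h') \<in> graph_polys"
  by (simp add: graph_polys_def prodring_diff)

lemma graph_polys_mult: "(f, f') \<in> graph_polys \<Longrightarrow> (h, h') \<in> graph_polys \<Longrightarrow> (f * h, f' * h') \<in> graph_polys"
  by (simp add: graph_polys_def coeff_mult prodring_sum prodring_mult)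

lemma graph_polys_one: "(1, 1) \<in> graph_polys"
  using graph_polys_const[OF prodring_one] by (simp add: one_pCons)

lemma prodring_adjoin: "prodring ((\<lambda>(f, f'). (poly f t, poly f' \<tau>)) ` graph_polys)" (is "prodring ?H")
proof -
  have *: "(poly f t, poly f' \<tau>) \<in> ?H" if "(f, f') \<in> graph_polys" for f f'
    using that by force
  show ?thesis
    unfolding prodring_def
  proof (intro conjI ballI, goal_cases)
    case 1 show ?case using *[OF graph_polys_one] by simp
  next
    case (2 z)
    then obtain f f' where z: "(f, f') \<in> graph_polys" "z = (poly f t, poly f' \<tau>)" by auto
    have 1: "(- poly f t, - poly f' \<tau>) \<in> ?H"
      using *[of "- f" "- f'"] graph_polys_minus[OF z(1)] by simp
    have 2: "(poly f t + poly h t, poly f' \<tau> + poly h' \<tau>) \<in> ?H \<and> (poly f t * poly h t, poly f' \<tau> * poly h' \<tau>) \<in> ?H"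
      if "(h, h') \<in> graph_polys" for h h'
      using *[OF graph_polys_add[OF z(1) that]] *[OF graph_polys_mult[OF z(1) that]] by simp
    show ?case unfolding z(2) prod.case
    proof (intro conjI ballI)
      fix w assume "w \<in> ?H"
      then obtain h h' where w: "(h, h') \<in> graph_polys" "w = (poly h t, poly h' \<tau>)" by auto
      show "case w of (c, d) \<Rightarrow> (poly f t + c, poly f' \<tau> + d) \<in> ?H \<and> (poly f t * c, poly f' \<tau> * d) \<in> ?H"
        unfolding w(2) prod.case by (rule 2[OF w(1)])
    qed (rule 1)
  qed
qed

end

section \<open>Maximal residue graphs and the place extension theorem\<close>

locale maximal_graph =
  fixes G :: "('F::field \<times> 'o::alg_closed_field) set"
  assumes G: "prodring G" and sv: "single_valued_at_0 G"
    and maximal: "\<And>H. prodring H \<Longrightarrow> single_valued_at_0 H \<Longrightarrow> G \<subseteq> H \<Longrightarrow> H = G"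
begin

lemma sv0: "(0, b) \<in> G \<Longrightarrow> b = 0"
  using sv by (auto simp: single_valued_at_0_def)

text \<open>Localizing \<open>G\<close> at the powers of \<open>(a, b)\<close> keeps it single
  valued, as \<open>a\<close> is nonzero; by maximality nothing new arises.\<close>

lemma unit:
  assumes ab: "(a, b) \<in> G" and b: "b \<noteq> 0"
  shows "(inverse a, inverse b) \<in> G"
proof -
  have a: "a \<noteq> 0" using sv0[of b] ab b by auto
  define H where "H = {(c / a ^ n, d / b ^ n) | c d n. (c, d) \<in> G}"
  have HI: "(c / a ^ n, d / b ^ n) \<in> H" if "(c, d) \<in> G" for c d n
    using that by (auto simp: H_def)
  have sub: "G \<subseteq> H" using HI[of _ _ 0] by auto
  have "prodring H"
    unfolding prodring_def
  proof (intro conjI ballI, goal_cases)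
    case 1 show ?case using sub prodring_one[OF G] by auto
  next
    case (2 z)
    then obtain c d n where z: "z = (c / a ^ n, d / b ^ n)" and cd: "(c, d) \<in> G" by (auto simp: H_def)
    have "(- (c / a ^ n), - (d / b ^ n)) \<in> H" using HI[OF prodring_minus[OF G cd], of n] by simp
    moreover have "(c / a ^ n + p, d / b ^ n + q) \<in> H \<and> (c / a ^ n * p, d / b ^ n * q) \<in> H"
      if pq: "(p, q) \<in> H" for p q
    proof -
      from pq obtain e f m where p: "p = e / a ^ m" "q = f / b ^ m" and ef: "(e, f) \<in> G"
        by (auto simp: H_def)
      have "(c * a ^ m + e * a ^ n, d * b ^ m + f * b ^ n) \<in> G"
        by (intro prodring_add[OF G] prodring_mult[OF G] prodring_power[OF G] cd ef ab)
      from HI[OF this, of "n + m"] have "(c / a ^ n + p, d / b ^ n + q) \<in> H"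
        using a b by (simp add: p add_frac_eq power_add)
      moreover have "(c * e, d * f) \<in> G" by (intro prodring_mult[OF G] cd ef)
      from HI[OF this, of "n + m"] have "(c / a ^ n * p, d / b ^ n * q) \<in> H"
        using a b by (simp add: p power_add)
      ultimately show ?thesis by simp
    qed
    ultimately show ?case by (auto simp: z)
  qed
  moreover have "single_valued_at_0 H"
    unfolding single_valued_at_0_def
  proof safe
    fix q assume "(0, q) \<in> H"
    then obtain c d n where "0 = c / a ^ n" "q = d / b ^ n" "(c, d) \<in> G" by (auto simp: H_def)
    thus "q = 0" using a sv0[of d] by simp
  qed
  ultimately have "H = G" using maximal sub by blast
  moreover have "(inverse a, inverse b) \<in> H"
    using HI[OF prodring_one[OF G], of 1] by (simp add: field_class.field_divide_inverse)
  ultimately show ?thesis by simp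
qed

text \<open>The hypothesis says exactly that the subring generated by \<open>G\<close> and
  \<open>(t, \<tau>)\<close> is single valued at 0.\<close>

lemma adjoin:
  assumes "\<And>f f'. (f, f') \<in> graph_polys G \<Longrightarrow> poly f t = 0 \<Longrightarrow> poly f' \<tau> = 0"
  shows "(t, \<tau>) \<in> G"
proof -
  let ?H = "(\<lambda>(f, f'). (poly f t, poly f' \<tau>)) ` graph_polys G"
  have HI: "(poly f t, poly f' \<tau>) \<in> ?H" if "(f, f') \<in> graph_polys G" for f f'
    using that by force
  have "prodring ?H" by (rule prodring_adjoin[OF G])
  moreover have "single_valued_at_0 ?H"
    using assms by (force simp: single_valued_at_0_def)
  moreover have "G \<subseteq> ?H"
  proof safe
    fix a b assume "(a, b) \<in> G"
    from HI[OF graph_polys_const[OF G this]] show "(a, b) \<in> ?H" by simp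
  qed
  ultimately have "?H = G" using maximal by blast
  thus ?thesis using HI[OF graph_polys_X[OF G]] by simp
qed

text \<open>
  The residue polynomials of all relations of \<open>t\<close> form an ideal; a root of its generator is a possible value at \<open>t\<close>.
\<close>

lemma value_or_unit_relation:
  "(\<exists>\<tau>. (t, \<tau>) \<in> G) \<or> (\<exists>f. (f, 1) \<in> graph_polys G \<and> poly f t = 0)"
proof (cases "\<exists>f f'. (f, f') \<in> graph_polys G \<and> poly f t = 0 \<and> f' \<noteq> 0")
  case False
  have "(t, 0) \<in> G"
  proof (rule adjoin)
    fix f f' assume "(f, f') \<in> graph_polys G" "poly f t = 0"
    hence "f' = 0" using False by blast
    thus "poly f' 0 = 0" by simp
  qed
  thus ?thesis by blast
next
  case True
  define d where "d = (LEAST d. \<exists>f f'. (f, f') \<in> graph_polys G \<and> poly f t = 0 \<and> f' \<noteq> 0 \<and> Polynomial.degree f' = d)"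
  have "\<exists>f f'. (f, f') \<in> graph_polys G \<and> poly f t = 0 \<and> f' \<noteq> 0 \<and> Polynomial.degree f' = d"
    unfolding d_def by (rule LeastI_ex) (use True in blast)
  then obtain g g' where g: "(g, g') \<in> graph_polys G" "poly g t = 0" "g' \<noteq> 0" "Polynomial.degree g' = d" by auto
  have min: "d \<le> Polynomial.degree f'" if "(f, f') \<in> graph_polys G" "poly f t = 0" "f' \<noteq> 0" for f f'
    unfolding d_def by (rule Least_le) (use that in auto)
  define l l' where "l = Polynomial.coeff g d" and "l' = Polynomial.coeff g' d"
  have l: "(l, l') \<in> G" "l' \<noteq> 0" using graph_polys_coeff[OF G g(1)] g(3,4) by (auto simp: l_def l'_def)
  note li = unit[OF l]
  show ?thesis
  proof (cases "d = 0")
    \<comment> \<open>Here the ideal of residue polynomials is the whole ring; normalizing the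
      constant \<open>g'\<close> gives a relation with residue 1.\<close>
    case True
    have "([:inverse l:] * g, [:inverse l':] * g') \<in> graph_polys G"
      by (intro graph_polys_diff[OF G] graph_polys_mult[OF G] graph_polys_const[OF G] li g)
    moreover have "[:inverse l':] * g' = 1"
    proof -
      have "Polynomial.degree g' = 0" using True g(4) by simp
      then obtain c where c: "g' = [:c:]" by (elim degree_eq_zeroE)
      hence "l' = c" by (simp add: l'_def True)
      thus ?thesis using l(2) by (simp add: c one_pCons)
    qed
    ultimately have "([:inverse l:] * g, 1) \<in> graph_polys G" by simp
    moreover have "poly ([:inverse l:] * g) t = 0" using g(2) by simp
    ultimately show ?thesis by blast
  next
    case False
    then obtain \<tau> where \<tau>: "poly g' \<tau> = 0"
      using alg_closed_imp_poly_has_root[of g'] g(4) by auto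
    have "poly f' \<tau> = 0" if "(f, f') \<in> graph_polys G" "poly f t = 0" for f f'
      using that
    proof (induction "Polynomial.degree f'" arbitrary: f f' rule: less_induct)
      case (less f' f)
      show ?case
      proof (cases "f' = 0")
        case nz: False
        define e where "e = Polynomial.degree f'"
        have de: "d \<le> e" using min less.prems nz by (auto simp: e_def)
        \<comment> \<open>A division step by \<open>g'\<close> is lifted to the field: since the
          leading pair \<open>(l, l')\<close> is invertible in \<open>G\<close>, the same step
          applies to \<open>f\<close> and \<open>g\<close> and preserves the vanishing at
          \<open>t\<close>.\<close>
        define a a' where "a = Polynomial.coeff f e * inverse l" and "a' = Polynomial.coeff f' e * inverse l'"
        have aa: "(a, a') \<in> G" unfolding a_def a'_def
          by (intro prodring_mult[OF G] li graph_polys_coeff[OF G] less.prems)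
        have h: "(f - monom a (e - d) * g, f' - monom a' (e - d) * g') \<in> graph_polys G"
          by (intro graph_polys_diff[OF G] graph_polys_mult[OF G] graph_polys_monom[OF G] less.prems g aa)
        have pz: "poly (f - monom a (e - d) * g) t = 0" using less.prems g by simp
        have "a' \<noteq> 0" using nz l(2) by (simp add: a'_def e_def)
        have "poly (f' - monom a' (e - d) * g') \<tau> = 0"
        proof (cases "f' - monom a' (e - d) * g' = 0")
          case nz2: False
          have "Polynomial.degree (f' - monom a' (e - d) * g') < e"
          proof (rule degree_lessI, safe)
            fix k assume k: "k \<ge> e"
            show "Polynomial.coeff (f' - monom a' (e - d) * g') k = 0"
            proof (cases "k = e")
              case True
              have "Polynomial.coeff (monom a' (e - d) * g') e = a' * l'"
                using de by (simp add: coeff_monom_mult l'_def)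
              thus ?thesis using True l(2) by (simp add: a'_def)
            next
              case False
              hence "Polynomial.coeff f' k = 0" using k by (intro coeff_eq_0) (auto simp: e_def)
              moreover have "Polynomial.coeff (monom a' (e - d) * g') k = 0"
                using k False de by (simp add: coeff_monom_mult coeff_eq_0 g(4))
              ultimately show ?thesis by simp
            qed
          qed (use nz2 in auto)
          thus ?thesis unfolding e_def using h pz unfolding e_def by (rule less.hyps)
        qed auto
        thus ?thesis using \<tau> by simp
      qed auto
    qed
    thus ?thesis using adjoin by blast
  qed
qed

text \<open>In both relations the constant coefficient has residue 1 and all others have residue 0.
  Reversing the shorter one gives a relation whose leading coefficient is a unit, and subtracting a
  multiple of it shortens the longer one: descent on the total degree.\<close>

lemma no_two_unit_relations:
  assumes "t \<noteq> 0" "(f, 1) \<in> graph_polys G" "poly f t = 0" "(h, 1) \<in> graph_polys G" "poly h (inverse t) = 0"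
  shows False
  using assms
proof (induction "Polynomial.degree f + Polynomial.degree h" arbitrary: f h t rule: less_induct)
  case less
  \<comment> \<open>One direction suffices, since exchanging \<open>t\<close> and
    \<open>inverse t\<close> exchanges the two relations.\<close>
  have main: False
    if IH: "\<And>f'. Polynomial.degree f' < Polynomial.degree f \<Longrightarrow> (f', 1) \<in> graph_polys G \<Longrightarrow> poly f' t = 0 \<Longrightarrow> False"
      and t: "t \<noteq> 0"
      and f: "(f, 1) \<in> graph_polys G" "poly f t = 0" and h: "(h, 1) \<in> graph_polys G" "poly h (inverse t) = 0"
      and le: "Polynomial.degree h \<le> Polynomial.degree f" for f h t
  proof -
    define n k where "n = Polynomial.degree f" and "k = Polynomial.degree h"
    have nk: "k \<le> n" using le by (simp add: n_def k_def)
    have cf: "(Polynomial.coeff f i, if i = 0 then 1 else 0) \<in> G" for i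
      using graph_polys_coeff[OF G f(1), of i] by (cases i) (simp_all add: one_pCons)
    have ch: "(Polynomial.coeff h i, if i = 0 then 1 else 0) \<in> G" for i
      using graph_polys_coeff[OF G h(1), of i] by (cases i) (simp_all add: one_pCons)
    have n0: "n \<noteq> 0"
    proof
      assume "n = 0"
      then obtain c where "f = [:c:]" by (auto simp: n_def elim: degree_eq_zeroE)
      with f(2) have "f = 0" by simp
      thus False using cf[of 0] sv0[of 1] by simp
    qed
    define e where "e = Polynomial.coeff h 0"
    have e: "(e, 1) \<in> G" using ch[of 0] by (simp add: e_def)
    hence e0: "e \<noteq> 0" using sv0[of 1] by auto
    define E where "E = reflect_poly h"
    have dE: "Polynomial.degree E = k" using e0 by (simp add: E_def k_def e_def)
    have cE: "Polynomial.coeff E k = e" by (simp add: E_def k_def coeff_reflect_poly e_def)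
    have EG: "(E, monom 1 k) \<in> graph_polys G"
    proof -
      have "(Polynomial.coeff E i, Polynomial.coeff (monom 1 k) i) \<in> G" for i
        using ch[of "k - i"] prodring_zero[OF G] by (auto simp: E_def coeff_reflect_poly k_def split: if_splits)
      thus ?thesis by (simp add: graph_polys_def[OF G])
    qed
    have Et: "poly E t = 0"
      using poly_reflect_poly_nz[of t h] t h(2) by (simp add: E_def)
    define a where "a = Polynomial.coeff f n * inverse e"
    \<comment> \<open>As \<open>n\<close> is positive, the leading coefficient of \<open>f\<close>
      has residue 0. Hence so has \<open>a\<close>, and the subtraction below leaves the residue
      polynomial 1 unchanged.\<close>
    have a: "(a, 0) \<in> G" using prodring_mult[OF G cf[of n] unit[OF e]] n0 by (simp add: a_def)
    define f' where "f' = f - monom a (n - k) * E"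
    have "(f', 1 - monom 0 (n - k) * monom 1 k) \<in> graph_polys G" unfolding f'_def
      by (intro graph_polys_diff[OF G] graph_polys_mult[OF G] graph_polys_monom[OF G] f EG a)
    hence f'G: "(f', 1) \<in> graph_polys G" by simp
    have "Polynomial.degree f' < n"
    proof (rule degree_lessI, safe)
      fix i assume i: "i \<ge> n"
      show "Polynomial.coeff f' i = 0"
      proof (cases "i = n")
        case True
        have "Polynomial.coeff (monom a (n - k) * E) n = a * e"
          using nk cE by (simp add: coeff_monom_mult)
        thus ?thesis using True e0 by (simp add: a_def f'_def)
      next
        case False
        have "Polynomial.coeff f i = 0" using False i by (intro coeff_eq_0) (auto simp: n_def)
        moreover have "Polynomial.coeff (monom a (n - k) * E) i = 0"
          using i False nk by (simp add: coeff_monom_mult coeff_eq_0 dE)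
        ultimately show ?thesis by (simp add: f'_def)
      qed
    qed (use n0 in auto)
    moreover have "poly f' t = 0" using f(2) Et by (simp add: f'_def)
    ultimately show False using IH f'G by (auto simp: n_def)
  qed
  show ?case
  proof (cases "Polynomial.degree h \<le> Polynomial.degree f")
    case True
    show ?thesis
    proof (rule main[of f t h])
      fix f' assume "Polynomial.degree f' < Polynomial.degree f" "(f', 1) \<in> graph_polys G" "poly f' t = 0"
      thus False by (intro less.hyps[OF _ less.prems(1) _ _ less.prems(4,5)]) simp_all
    qed (fact less.prems True)+
  next
    case False
    show ?thesis
    proof (rule main[of h "inverse t" f])
      fix f' assume "Polynomial.degree f' < Polynomial.degree h" "(f', 1) \<in> graph_polys G" "poly f' (inverse t) = 0"
      thus False by (intro less.hyps[OF _ less.prems(1) less.prems(2,3)]) simp_all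
    next
      show "inverse t \<noteq> 0" using less.prems(1) by simp
      show "poly f (inverse (inverse t)) = 0" using less.prems(3) by simp
      show "Polynomial.degree f \<le> Polynomial.degree h" using False by simp
    qed (fact less.prems)+
  qed
qed

lemma valued: "(\<exists>\<tau>. (t, \<tau>) \<in> G) \<or> (\<exists>\<tau>. (inverse t, \<tau>) \<in> G)"
proof (cases "t = 0")
  case True
  thus ?thesis using prodring_zero[OF G] by blast
next
  case False
  show ?thesis
  proof (rule ccontr)
    assume *: "\<not> ?thesis"
    obtain f where f: "(f, 1) \<in> graph_polys G" "poly f t = 0"
      using value_or_unit_relation[of t] * by blast
    obtain h where h: "(h, 1) \<in> graph_polys G" "poly h (inverse t) = 0"
      using value_or_unit_relation[of "inverse t"] * by blast
    show False by (rule no_two_unit_relations[OF False f h])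
  qed
qed

lemma place_of_graph: "\<exists>V \<theta>. place V \<theta> \<and> G = (\<lambda>z. (z, \<theta> z)) ` V"
proof -
  have unique: "b = c" if "(a, b) \<in> G" "(a, c) \<in> G" for a b c
    using sv0[of "b - c"] prodring_diff[OF G that] by simp
  define V where "V = fst ` G"
  define \<theta> where "\<theta> a = (THE b. (a, b) \<in> G)" for a
  have \<theta>: "\<theta> a = b" if "(a, b) \<in> G" for a b
    unfolding \<theta>_def using that unique by blast
  have V: "(a, \<theta> a) \<in> G" if "a \<in> V" for a
  proof -
    from that obtain b where b: "(a, b) \<in> G" unfolding V_def by force
    thus ?thesis using \<theta>[OF b] by simp
  qed
  have VI: "a \<in> V" if "(a, b) \<in> G" for a b using that by (force simp: V_def)
  have "place V \<theta>"
  proof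
    show "1 \<in> V" "\<theta> 1 = 1" using VI[OF prodring_one[OF G]] \<theta>[OF prodring_one[OF G]] by auto
    show "z \<in> V \<or> inverse z \<in> V" for z using valued[of z] VI by blast
    fix a b assume ab: "a \<in> V" "b \<in> V"
    show "a + b \<in> V" "\<theta> (a + b) = \<theta> a + \<theta> b" "a * b \<in> V" "\<theta> (a * b) = \<theta> a * \<theta> b"
      using prodring_add[OF G V[OF ab(1)] V[OF ab(2)], THEN VI] prodring_add[OF G V[OF ab(1)] V[OF ab(2)], THEN \<theta>]
        prodring_mult[OF G V[OF ab(1)] V[OF ab(2)], THEN VI] prodring_mult[OF G V[OF ab(1)] V[OF ab(2)], THEN \<theta>] by auto
  next
    fix a assume a: "a \<in> V"
    show "- a \<in> V" using prodring_minus[OF G V[OF a]] VI by blast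
    show "\<theta> a = 0 \<longleftrightarrow> a = 0 \<or> inverse a \<notin> V"
    proof
      assume *: "\<theta> a = 0"
      show "a = 0 \<or> inverse a \<notin> V"
      proof (rule ccontr)
        assume "\<not> (a = 0 \<or> inverse a \<notin> V)"
        hence "(a * inverse a, \<theta> a * \<theta> (inverse a)) \<in> G" "a \<noteq> 0"
          using prodring_mult[OF G V[OF a] V[of "inverse a"]] by auto
        hence "(1, 0) \<in> G" using * by simp
        thus False using unique[OF prodring_one[OF G], of 0] by simp
      qed
    next
      assume *: "a = 0 \<or> inverse a \<notin> V"
      show "\<theta> a = 0"
      proof (rule ccontr)
        assume "\<theta> a \<noteq> 0"
        with unit[OF V[OF a]] VI have "inverse a \<in> V" by blast
        with * have "a = 0" by simp
        thus False using \<open>\<theta> a \<noteq> 0\<close> \<theta>[OF prodring_zero[OF G]] by simp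
      qed
    qed
  qed
  moreover have "G = (\<lambda>z. (z, \<theta> z)) ` V"
  proof safe
    fix a b assume ab: "(a, b) \<in> G"
    show "(a, b) \<in> (\<lambda>z. (z, \<theta> z)) ` V" using \<theta>[OF ab] VI[OF ab] by auto
  qed (rule V)
  ultimately show ?thesis by blast
qed

end

text \<open>The pairs \<open>(\<alpha> p, \<beta> p)\<close> form a subring that is single valued by
  the kernel condition. Zorn's lemma enlarges it to a maximal one, which is the graph of a
  place.\<close>

theorem place_extension:
  fixes \<alpha> :: "'p::comm_ring_1 \<Rightarrow> 'F::field" and \<beta> :: "'p \<Rightarrow> 'o::alg_closed_field"
  assumes \<alpha>: "rhom \<alpha>" and \<beta>: "rhom \<beta>" and ker: "\<And>p. \<alpha> p = 0 \<Longrightarrow> \<beta> p = 0"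
  obtains V \<theta> where "place V \<theta>" "\<And>p. \<alpha> p \<in> V" "\<And>p. \<theta> (\<alpha> p) = \<beta> p"
proof -
  define G0 where "G0 = range (\<lambda>p. (\<alpha> p, \<beta> p))"
  define \<G> where "\<G> = {G. prodring G \<and> single_valued_at_0 G \<and> G0 \<subseteq> G}"
  have G0I: "(\<alpha> p, \<beta> p) \<in> G0" for p by (auto simp: G0_def)
  have "prodring G0"
    unfolding prodring_def
  proof (intro conjI ballI, goal_cases)
    case 1 show ?case using G0I[of 1] by (simp add: rhom_one \<alpha> \<beta>)
  next
    case (2 z)
    then obtain p where z: "z = (\<alpha> p, \<beta> p)" by (auto simp: G0_def)
    have "(- \<alpha> p, - \<beta> p) \<in> G0" using G0I[of "- p"] by (simp add: rhom_minus \<alpha> \<beta>)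
    moreover have "(\<alpha> p + \<alpha> q, \<beta> p + \<beta> q) \<in> G0" "(\<alpha> p * \<alpha> q, \<beta> p * \<beta> q) \<in> G0" for q
      using G0I[of "p + q"] G0I[of "p * q"] by (simp_all add: rhom_add rhom_mult \<alpha> \<beta>)
    ultimately show ?case by (auto simp: z G0_def)
  qed
  moreover have "single_valued_at_0 G0"
    using ker by (auto simp: single_valued_at_0_def G0_def)
  ultimately have ne: "G0 \<in> \<G>" by (simp add: \<G>_def)
  have "\<exists>M\<in>\<G>. \<forall>H\<in>\<G>. M \<subseteq> H \<longrightarrow> H = M"
  proof (rule subset_Zorn_nonempty)
    show "\<G> \<noteq> {}" using ne by auto
  next
    fix C assume C: "C \<noteq> {}" "subset.chain \<G> C"
    have CG: "prodring G" "single_valued_at_0 G" "G0 \<subseteq> G" if "G \<in> C" for G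
      using C that by (auto simp: subset.chain_def \<G>_def)
    have two: "\<exists>G\<in>C. a \<in> G \<and> b \<in> G" if "a \<in> \<Union>C" "b \<in> \<Union>C" for a b
    proof -
      from that(1) obtain A where "A \<in> C" "a \<in> A" by blast
      moreover from that(2) obtain B where "B \<in> C" "b \<in> B" by blast
      moreover from calculation have "A \<subseteq> B \<or> B \<subseteq> A"
        using C(2) unfolding subset_chain_def by blast
      ultimately show ?thesis by blast
    qed
    have "prodring (\<Union>C)"
      unfolding prodring_def
    proof (intro conjI ballI, goal_cases)
      case 1 show ?case using C(1) CG(1) prodring_one by blast
    next
      case (2 z)
      obtain a b where z: "z = (a, b)" by force
      have "(- a, - b) \<in> \<Union>C" using 2 z CG(1) prodring_minus by blast
      moreover have "(a + c, b + d) \<in> \<Union>C \<and> (a * c, b * d) \<in> \<Union>C" if cd: "(c, d) \<in> \<Union>C" for c d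
      proof -
        obtain G where "G \<in> C" "(a, b) \<in> G" "(c, d) \<in> G" using two 2 z cd by blast
        thus ?thesis using CG(1) prodring_add prodring_mult by blast
      qed
      ultimately show ?case using z by auto
    qed
    moreover have "single_valued_at_0 (\<Union>C)"
      using CG(2) by (auto simp: single_valued_at_0_def)
    moreover have "G0 \<subseteq> \<Union>C" using C(1) CG(3) by blast
    ultimately show "\<Union>C \<in> \<G>" by (simp add: \<G>_def)
  qed
  then obtain M where M: "M \<in> \<G>" "\<And>H. H \<in> \<G> \<Longrightarrow> M \<subseteq> H \<Longrightarrow> H = M" by blast
  interpret maximal_graph M
  proof
    show "prodring M" "single_valued_at_0 M" using M(1) by (auto simp: \<G>_def)
    show "H = M" if "prodring H" "single_valued_at_0 H" "M \<subseteq> H" for H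
      using M that by (auto simp: \<G>_def)
  qed
  obtain V \<theta> where V: "place V \<theta>" and Meq: "M = (\<lambda>z. (z, \<theta> z)) ` V"
    using place_of_graph by blast
  have "(\<alpha> p, \<beta> p) \<in> (\<lambda>z. (z, \<theta> z)) ` V" for p
    using M(1) G0I[of p] unfolding \<G>_def Meq by blast
  hence "\<alpha> p \<in> V \<and> \<theta> (\<alpha> p) = \<beta> p" for p
    by (metis (no_types, lifting) Pair_inject imageE)
  thus thesis using that[OF V] by blast
qed

section \<open>Algebraic elements and places\<close>

lemma to_ac_rhom: "rhom to_ac"
  by (simp add: rhom_def)

lemma rhom_coeff_0: "rhom (\<lambda>p. Polynomial.coeff p 0)"
  by (simp add: rhom_def coeff_mult)

locale field_extension =
  fixes \<iota> :: "'k::field \<Rightarrow> 'F::field"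
  assumes \<iota>: "rhom \<iota>"
begin

definition kplace :: "'F set \<Rightarrow> ('F \<Rightarrow> 'k alg_closure) \<Rightarrow> bool" where
  "kplace V \<theta> \<longleftrightarrow> place V \<theta> \<and> (\<forall>c. \<iota> c \<in> V \<and> \<theta> (\<iota> c) = to_ac c)"

definition algebraic :: "'F \<Rightarrow> bool" where
  "algebraic z \<longleftrightarrow> (\<exists>f. f \<noteq> 0 \<and> ev \<iota> z f = 0)"

lemma kplace_place: "kplace V \<theta> \<Longrightarrow> place V \<theta>"
  by (simp add: kplace_def)

lemma kplace_ev:
  assumes "kplace V \<theta>" "z \<in> V"
  shows "ev \<iota> z f \<in> V" "\<theta> (ev \<iota> z f) = ev to_ac (\<theta> z) f"
proof -
  interpret place V \<theta> using assms(1) by (rule kplace_place)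
  have "ev \<iota> z f \<in> V \<and> \<theta> (ev \<iota> z f) = ev to_ac (\<theta> z) f"
  proof (induction f)
    case (pCons a p)
    have "\<iota> a \<in> V" "\<theta> (\<iota> a) = to_ac a" using assms(1) by (auto simp: kplace_def)
    thus ?case using pCons.IH assms(2)
      by (simp add: ev_pCons rhom_zero[OF \<iota>] add mult \<theta>_add \<theta>_mult)
  qed (simp add: ev_0 zero \<theta>_zero)
  thus "ev \<iota> z f \<in> V" "\<theta> (ev \<iota> z f) = ev to_ac (\<theta> z) f" by auto
qed

lemma degree_map_poly_\<iota>: "Polynomial.degree (map_poly \<iota> f) = Polynomial.degree f"
  by (intro degree_map_poly) (simp add: rhom_eq_0_iff[OF \<iota>])

text \<open>An algebraic element is integral over the constants, and \<open>V\<close> is integrally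
  closed.\<close>

lemma algebraic_in_place:
  assumes "algebraic z" "kplace V \<theta>"
  shows "z \<in> V"
proof -
  interpret place V \<theta> using assms(2) by (rule kplace_place)
  obtain f where f: "f \<noteq> 0" "ev \<iota> z f = 0" using assms(1) by (auto simp: algebraic_def)
  define h where "h = smult (inverse (Polynomial.lead_coeff f)) f"
  have "Polynomial.lead_coeff h = 1" using f(1) by (simp add: h_def)
  moreover have "ev \<iota> z h = 0" using f(2) by (simp add: h_def ev_smult[OF \<iota>])
  ultimately show ?thesis
    using assms(2) integrally_closed[of "map_poly \<iota> h" z]
    by (simp add: degree_map_poly_\<iota> coeff_map_poly rhom_zero[OF \<iota>] rhom_one[OF \<iota>] ev_def kplace_def)
qed

lemma algebraic_inverse_imp:
  assumes "algebraic (inverse z)"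
  shows "algebraic z"
proof (cases "z = 0")
  case True
  thus ?thesis using ev_X[OF \<iota>, of 0] unfolding algebraic_def by (metis pCons_eq_0_iff one_neq_zero)
next
  case False
  obtain f where f: "f \<noteq> 0" "ev \<iota> (inverse z) f = 0" using assms by (auto simp: algebraic_def)
  have "map_poly \<iota> (reflect_poly f) = reflect_poly (map_poly \<iota> f)"
    by (intro poly_eqI)
      (simp add: coeff_map_poly coeff_reflect_poly rhom_zero[OF \<iota>] degree_map_poly_\<iota>)
  hence "ev \<iota> z (reflect_poly f) = 0"
    using f(2) poly_reflect_poly_nz[OF False, of "map_poly \<iota> f"] by (simp add: ev_def)
  moreover have "reflect_poly f \<noteq> 0" using f(1) by simp
  ultimately show ?thesis unfolding algebraic_def by blast
qed

text \<open>For transcendental \<open>z\<close> the ring generated by \<open>inverse z\<close> over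
  k is a polynomial ring, so sending \<open>inverse z\<close> to 0 is a well-defined residue map; an
  extension of it to a place has a pole at \<open>z\<close>.\<close>

lemma transcendental_pole:
  assumes "\<not> algebraic z"
  obtains V \<theta> where "kplace V \<theta>" "z \<notin> V"
proof -
  have z: "z \<noteq> 0"
    using assms ev_X[OF \<iota>, of 0] unfolding algebraic_def by (metis pCons_eq_0_iff one_neq_zero)
  have "\<not> algebraic (inverse z)" using assms algebraic_inverse_imp by blast
  hence ker: "f = 0" if "ev \<iota> (inverse z) f = 0" for f using that by (auto simp: algebraic_def)
  obtain V \<theta> where V: "place V \<theta>" "\<And>f. ev \<iota> (inverse z) f \<in> V"
      "\<And>f. \<theta> (ev \<iota> (inverse z) f) = to_ac (Polynomial.coeff f 0)"
  proof (rule place_extension)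
    show "rhom (ev \<iota> (inverse z))" by (rule rhom_ev[OF \<iota>])
    show "rhom (\<lambda>f. to_ac (Polynomial.coeff f 0))" by (rule rhom_comp[OF rhom_coeff_0 to_ac_rhom])
    show "to_ac (Polynomial.coeff f 0) = 0" if "ev \<iota> (inverse z) f = 0" for f
      using ker[OF that] by simp
  qed (rule that)
  have "kplace V \<theta>"
    using V(1) V(2)[of "[:_:]"] V(3)[of "[:_:]"] by (simp add: kplace_def ev_const rhom_zero[OF \<iota>])
  moreover have "z \<notin> V"
    using V(2,3)[of "[:0, 1:]"] place.\<theta>_eq_0_iff[OF V(1), of "inverse z"] z by (simp add: ev_X[OF \<iota>])
  ultimately show thesis by (rule that)
qed

text \<open>This turns closure properties of the rings \<open>V\<close> into closure properties of
  the algebraic elements.\<close>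

lemma algebraic_iff: "algebraic z \<longleftrightarrow> (\<forall>V \<theta>. kplace V \<theta> \<longrightarrow> z \<in> V)"
  using algebraic_in_place transcendental_pole by metis

lemma algebraic_const: "algebraic (\<iota> c)"
  by (simp add: algebraic_iff kplace_def)

lemma algebraic_0: "algebraic 0"
  using algebraic_const[of 0] by (simp add: rhom_zero[OF \<iota>])

lemma algebraic_1: "algebraic 1"
  using algebraic_const[of 1] by (simp add: rhom_one[OF \<iota>])

lemma algebraic_add: "algebraic a \<Longrightarrow> algebraic b \<Longrightarrow> algebraic (a + b)"
  and algebraic_mult: "algebraic a \<Longrightarrow> algebraic b \<Longrightarrow> algebraic (a * b)"
  and algebraic_minus: "algebraic a \<Longrightarrow> algebraic (- a)"
  unfolding algebraic_iff by (blast intro: place.add place.mult place.minus kplace_place)+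

lemma algebraic_diff: "algebraic a \<Longrightarrow> algebraic b \<Longrightarrow> algebraic (a - b)"
  using algebraic_add[OF _ algebraic_minus, of a b] by simp

lemma algebraic_inverse: "algebraic a \<Longrightarrow> algebraic (inverse a)"
  using algebraic_inverse_imp[of "inverse a"] by simp

lemma algebraic_divide: "algebraic a \<Longrightarrow> algebraic b \<Longrightarrow> algebraic (a / b)"
  by (simp add: field_class.field_divide_inverse algebraic_mult algebraic_inverse)

lemma algebraic_power: "algebraic a \<Longrightarrow> algebraic (a ^ n)"
  by (induction n) (auto simp: algebraic_1 algebraic_mult)

lemma algebraic_ev: "algebraic c \<Longrightarrow> algebraic (ev \<iota> c f)"
  by (induction f)
    (simp_all add: ev_0 ev_pCons rhom_zero[OF \<iota>] algebraic_0 algebraic_add algebraic_mult algebraic_const)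

text \<open>The inverse is algebraic as well and thus lies in \<open>V\<close>, so \<open>z\<close>
  is a unit there.\<close>

lemma kplace_algebraic_nonzero:
  assumes "kplace V \<theta>" "algebraic z" "z \<noteq> 0"
  shows "\<theta> z \<noteq> 0"
  using place.\<theta>_eq_0_iff[OF kplace_place[OF assms(1)]] algebraic_in_place[OF assms(2,1)]
    algebraic_in_place[OF algebraic_inverse[OF assms(2)] assms(1)] assms(3) by auto

text \<open>\<open>t\<close> stays transcendental over k(c): a nontrivial relation, made monic,
  would make \<open>t\<close> integral over algebraic elements and so keep it from having a
  pole.\<close>

lemma ev_ev_eq_0:
  assumes c: "algebraic c" and t: "\<not> algebraic t" and A: "ev (ev \<iota> c) t A = 0"
  shows "ev \<iota> c (Polynomial.coeff A i) = 0"
proof -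
  obtain V \<theta> where V: "kplace V \<theta>" "t \<notin> V" using transcendental_pole[OF t] .
  interpret place V \<theta> using V(1) by (rule kplace_place)
  define B where "B = map_poly (ev \<iota> c) A"
  have cB: "algebraic (Polynomial.coeff B i)" for i
    by (simp add: B_def coeff_map_poly ev_0 algebraic_ev[OF c])
  have "B = 0"
  proof (rule ccontr)
    assume B: "B \<noteq> 0"
    define D where "D = smult (inverse (Polynomial.lead_coeff B)) B"
    have "Polynomial.lead_coeff D = 1" using B by (simp add: D_def)
    moreover have "algebraic (Polynomial.coeff D i)" for i
      unfolding D_def coeff_smult by (intro algebraic_mult algebraic_inverse cB)
    hence "Polynomial.coeff D i \<in> V" for i by (rule algebraic_in_place[OF _ V(1)])
    moreover have "poly D t = 0" using A by (simp add: D_def B_def ev_def)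
    ultimately show False using V(2) integrally_closed by blast
  qed
  hence "Polynomial.coeff B i = 0" by simp
  thus ?thesis by (simp add: B_def coeff_map_poly ev_0)
qed

text \<open>The condition on \<open>\<gamma>\<close> makes the assignment of \<open>\<gamma>\<close>
  to \<open>c\<close> well defined on k[c], and \<open>t\<close> is free over k[c], so its value
  \<open>\<tau>\<close> is arbitrary. The resulting residue map extends to a place.\<close>

lemma place_with_values:
  assumes c: "algebraic c" and t: "\<not> algebraic t"
    and \<gamma>: "\<And>f. ev \<iota> c f = 0 \<Longrightarrow> ev to_ac \<gamma> f = 0"
  obtains V \<theta> where "kplace V \<theta>" "c \<in> V" "t \<in> V" "\<theta> c = \<gamma>" "\<theta> t = \<tau>"
proof -
  note h = rhom_ev[OF \<iota>] rhom_ev[OF to_ac_rhom]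
  have z: "ev \<iota> z 0 = 0" "ev to_ac z' 0 = 0" for z z' by (simp_all add: ev_0)
  obtain V \<theta> where V: "place V \<theta>" "\<And>A. ev (ev \<iota> c) t A \<in> V"
      "\<And>A. \<theta> (ev (ev \<iota> c) t A) = ev (ev to_ac \<gamma>) \<tau> A"
  proof (rule place_extension)
    show "rhom (ev (ev \<iota> c) t)" "rhom (ev (ev to_ac \<gamma>) \<tau>)" by (intro rhom_ev \<iota> to_ac_rhom)+
    fix A assume "ev (ev \<iota> c) t A = 0"
    hence "map_poly (ev to_ac \<gamma>) A = 0"
      by (intro poly_eqI) (simp add: coeff_map_poly ev_0 \<gamma> ev_ev_eq_0[OF c t])
    thus "ev (ev to_ac \<gamma>) \<tau> A = 0" by (simp add: ev_def)
  qed (rule that)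
  have "kplace V \<theta>"
    using V(1) V(2)[of "[:[:_:]:]"] V(3)[of "[:[:_:]:]"]
    by (simp add: kplace_def ev_const z rhom_zero[OF \<iota>])
  moreover have "t \<in> V" "\<theta> t = \<tau>"
    using V(2,3)[of "[:0, 1:]"] by (simp_all add: ev_X[OF h(1)] ev_X[OF h(2)])
  moreover have "c \<in> V" "\<theta> c = \<gamma>"
    using V(2,3)[of "[:[:0, 1:]:]"] by (simp_all add: ev_const z ev_X[OF \<iota>] ev_X[OF to_ac_rhom])
  ultimately show thesis using that by blast
qed

lemma kplace_root:
  assumes "kplace V \<theta>" "algebraic c" "ev \<iota> c f = 0"
  shows "ev to_ac (\<theta> c) f = 0"
  using kplace_ev(2)[OF assms(1) algebraic_in_place[OF assms(2,1)], of f] assms(3)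
    place.\<theta>_zero[OF kplace_place[OF assms(1)]] by simp

end

text \<open>As \<open>b\<close> is not in k, its minimal polynomial is X^2 - a, so \<open>b\<close>
  may be sent to \<open>- b\<close>. This extends to a place of the algebraic closure, and since
  every element is algebraic, that place has no poles.\<close>

lemma square_root_conjugation:
  fixes b :: "'k::field alg_closure"
  assumes b: "b ^ 2 = to_ac a" and nb: "b \<notin> range to_ac"
  obtains \<sigma> :: "'k alg_closure \<Rightarrow> 'k alg_closure"
  where "rhom \<sigma>" "\<And>c. \<sigma> (to_ac c) = to_ac c" "\<sigma> b = - b"
proof -
  interpret field_extension "to_ac :: 'k \<Rightarrow> _" by unfold_locales (rule to_ac_rhom)
  note [simp] = ev_pCons[of to_ac, OF to_ac_0] ev_0
  have ker: "ev to_ac (- b) f = 0" if f0: "ev to_ac b f = 0" for f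
  proof -
    define m where "m = [:- a, 0, 1:]"
    define r where "r = f mod m"
    have f: "f = f div m * m + r" by (simp add: r_def)
    have m: "ev to_ac b m = 0" "ev to_ac (- b) m = 0"
      using b by (simp_all add: m_def power2_eq_square)
    have "Polynomial.degree r \<le> 1"
      using degree_mod_less[of m f] by (auto simp: m_def r_def)
    then obtain r0 r1 where r: "r = [:r0, r1:]"
      by (metis One_nat_def degree1_coeffs degree0_coeffs le_Suc_eq le_zero_eq pCons_0_0)
    have "ev to_ac b r = 0"
      using f0 by (subst (asm) f) (simp add: rhom_add[OF rhom_ev] rhom_mult[OF rhom_ev] to_ac_rhom m)
    hence e: "to_ac r0 + b * to_ac r1 = 0" by (simp add: r)
    have "r1 = 0"
    proof (rule ccontr)
      assume r1: "r1 \<noteq> 0"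
      hence "b = to_ac (- r0 / r1)" using e by (simp add: field_simps eq_neg_iff_add_eq_0)
      thus False using nb by blast
    qed
    with e have "r = 0" by (simp add: r)
    thus ?thesis
      by (subst f) (simp add: rhom_add[OF rhom_ev] rhom_mult[OF rhom_ev] to_ac_rhom m)
  qed
  obtain V \<theta> where V: "place V \<theta>" "\<And>f. ev to_ac b f \<in> V" "\<And>f. \<theta> (ev to_ac b f) = ev to_ac (- b) f"
  proof (rule place_extension)
    show "rhom (ev to_ac b)" "rhom (ev to_ac (- b))" by (intro rhom_ev to_ac_rhom)+
  qed (use ker that in auto)
  have kp: "kplace V \<theta>"
    using V(1) V(2)[of "[:_:]"] V(3)[of "[:_:]"] by (simp add: kplace_def)
  have "z \<in> V" for z
  proof (rule algebraic_in_place[OF _ kp])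
    obtain p where "p \<noteq> 0" "poly (map_poly to_ac p) z = 0" by (rule alg_closure_algebraic)
    thus "algebraic z" by (auto simp: algebraic_def ev_def)
  qed
  hence "rhom \<theta>"
    using V(1) by (simp add: rhom_def place.\<theta>_one place.\<theta>_add place.\<theta>_mult)
  moreover have "\<theta> (to_ac c) = to_ac c" for c using kp by (simp add: kplace_def)
  moreover have "\<theta> b = - b" using V(3)[of "[:0, 1:]"] by simp
  ultimately show thesis by (rule that)
qed

section \<open>Curves with one place at infinity\<close>

text \<open>Well-definedness of the quotient rule: the second hypothesis is the derivative of the
  first, so the derivative of a fraction does not depend on its representation.\<close>

lemma quotient_rule_unique:
  fixes a :: "'a::field"
  assumes 1: "a * b1 = a1 * b" and 2: "a * b1' + b1 * a' = a1 * b' + b * a1'" and "b \<noteq> 0" "b1 \<noteq> 0"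
  shows "(a' * b - a * b') / b ^ 2 = (a1' * b1 - a1 * b1') / b1 ^ 2"
proof -
  have "(a' * b - a * b') * b1 ^ 2 = b * b1 * (b1 * a') - b' * b1 * (a * b1)"
    by (simp add: power2_eq_square algebra_simps)
  also have "b1 * a' = a1 * b' + b * a1' - a * b1'" using 2 by (simp add: algebra_simps)
  also have "b * b1 * (a1 * b' + b * a1' - a * b1') - b' * b1 * (a * b1)
      = b * b1 * (a1 * b') + b * b1 * (b * a1') - b * b1' * (a * b1) - b' * b1 * (a * b1)"
    by (simp add: algebra_simps)
  also have "\<dots> = (a1' * b1 - a1 * b1') * b ^ 2"
    unfolding 1 by (simp add: power2_eq_square algebra_simps)
  finally show ?thesis using assms(3,4) by (simp add: frac_eq_eq)
qed

lemma quotient_rule_add: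
  fixes a :: "'a::field"
  assumes "b \<noteq> 0" "d \<noteq> 0"
  shows "((a * d' + d * a' + (c * b' + b * c')) * (b * d) - (a * d + c * b) * (b * d' + d * b')) / (b * d) ^ 2
    = (a' * b - a * b') / b ^ 2 + (c' * d - c * d') / d ^ 2"
proof -
  have "(a * d' + d * a' + (c * b' + b * c')) * (b * d) - (a * d + c * b) * (b * d' + d * b')
      = (a' * b - a * b') * d ^ 2 + (c' * d - c * d') * b ^ 2"
    by (simp add: power2_eq_square algebra_simps)
  thus ?thesis using assms by (simp add: add_frac_eq power_mult_distrib)
qed

lemma quotient_rule_mult:
  fixes a :: "'a::field"
  assumes "b \<noteq> 0" "d \<noteq> 0"
  shows "((a * c' + c * a') * (b * d) - a * c * (b * d' + d * b')) / (b * d) ^ 2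
    = a / b * ((c' * d - c * d') / d ^ 2) + c / d * ((a' * b - a * b') / b ^ 2)"
proof -
  have "(a * c' + c * a') * (b * d) - a * c * (b * d' + d * b')
      = (a * b) * (c' * d - c * d') + (c * d) * (a' * b - a * b')"
    by (simp add: algebra_simps)
  hence "((a * c' + c * a') * (b * d) - a * c * (b * d' + d * b')) / (b * d) ^ 2
      = (a * b) * (c' * d - c * d') / (b * d) ^ 2 + (c * d) * (a' * b - a * b') / (b * d) ^ 2"
    by (simp only: add_divide_distrib)
  moreover have "(a * b) * (c' * d - c * d') / (b * d) ^ 2 = a / b * ((c' * d - c * d') / d ^ 2)"
    "(c * d) * (a' * b - a * b') / (b * d) ^ 2 = c / d * ((a' * b - a * b') / b ^ 2)"
    using assms by (simp_all add: power2_eq_square)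
  ultimately show ?thesis by (simp only:)
qed
text \<open>The derivation passes to the image of \<open>\<psi>\<close> because it preserves the
  kernel. The quotient rule extends it to \<open>V\<close>, where denominators can be chosen with
  nonzero value.\<close>

lemma local_derivation:
  fixes \<psi> :: "'p::comm_ring_1 \<Rightarrow> 'F::field" and \<theta> :: "'F \<Rightarrow> 'o::field"
  assumes pl: "place V \<theta>" and \<psi>: "rhom \<psi>" and V: "\<And>A. \<psi> A \<in> V"
    and frac: "\<And>z. z \<in> V \<Longrightarrow> \<exists>A B. \<theta> (\<psi> B) \<noteq> 0 \<and> z = \<psi> A / \<psi> B"
    and der_add: "\<And>A B. der (A + B) = der A + der B" and der_mult: "\<And>A B. der (A * B) = A * der B + B * der A"
    and ker: "\<And>A. \<psi> A = 0 \<Longrightarrow> \<psi> (der A) = 0"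
  obtains \<delta> where "\<And>a b. a \<in> V \<Longrightarrow> b \<in> V \<Longrightarrow> \<delta> (a + b) = \<delta> a + \<delta> b"
    "\<And>a b. a \<in> V \<Longrightarrow> b \<in> V \<Longrightarrow> \<delta> (a * b) = \<theta> a * \<delta> b + \<theta> b * \<delta> a"
    "\<And>A. \<delta> (\<psi> A) = \<theta> (\<psi> (der A))"
proof -
  interpret place V \<theta> by (rule pl)
  define e where "e A = \<theta> (\<psi> A)" for A
  define e' where "e' A = \<theta> (\<psi> (der A))" for A
  have e: "e (A + B) = e A + e B" "e (A * B) = e A * e B" "e 1 = 1" for A B
    by (simp_all add: e_def rhom_simps[OF \<psi>] V \<theta>_add \<theta>_mult \<theta>_one)
  have e'_add: "e' (A + B) = e' A + e' B" for A B
    by (simp add: e'_def der_add rhom_add[OF \<psi>] V \<theta>_add)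
  have e'_mult: "e' (A * B) = e A * e' B + e B * e' A" for A B
    by (simp add: e_def e'_def der_mult rhom_add[OF \<psi>] rhom_mult[OF \<psi>] V \<theta>_add \<theta>_mult mult)
  have "e' 1 + e' 1 = e' 1 + 0" using e'_mult[of 1 1] unfolding e by (simp only: mult_1_left mult_1_right add_0_right)
  hence "e' 1 = 0" by (rule add_left_imp_eq)
  have nz: "\<psi> B \<noteq> 0" if "e B \<noteq> 0" for B
    using that \<theta>_zero by (auto simp: e_def)
  define q where "q A B = (e' A * e B - e A * e' B) / e B ^ 2" for A B
  have ze: "e A = 0 \<and> e' A = 0" if "\<psi> A = 0" for A
    using ker[OF that] that by (simp add: e_def e'_def \<theta>_zero)
  have q: "q A B = q A1 B1" if B: "e B \<noteq> 0" "e B1 \<noteq> 0" and eq: "\<psi> A / \<psi> B = \<psi> A1 / \<psi> B1" for A B A1 B1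
  proof -
    \<comment> \<open>Equality of the fractions puts \<open>Z\<close> into the kernel; the two
      equations for the quotient rule are the vanishing of its value and of its derivative.\<close>
    define Z where "Z = A * B1 - A1 * B"
    have "\<psi> Z = 0"
      using eq nz[OF B(1)] nz[OF B(2)] by (simp add: Z_def rhom_simps[OF \<psi>] field_simps)
    hence Z: "e Z = 0" "e' Z = 0" using ze by auto
    have e_diff: "e (C - E) = e C - e E" "e' (C - E) = e' C - e' E" for C E
      using e(1)[of "C - E" E] e'_add[of "C - E" E] by simp_all
    have 1: "e A * e B1 = e A1 * e B"
      and 2: "e A * e' B1 + e B1 * e' A = e A1 * e' B + e B * e' A1"
      using Z by (simp_all add: Z_def e e_diff e'_mult)
    show ?thesis unfolding q_def by (rule quotient_rule_unique[OF 1 2 B])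
  qed
  define \<delta> where "\<delta> z = (THE d. \<exists>A B. e B \<noteq> 0 \<and> z = \<psi> A / \<psi> B \<and> d = q A B)" for z
  have \<delta>: "\<delta> (\<psi> A / \<psi> B) = q A B" if "e B \<noteq> 0" for A B
    unfolding \<delta>_def
  proof (rule the_equality)
    show "\<exists>A' B'. e B' \<noteq> 0 \<and> \<psi> A / \<psi> B = \<psi> A' / \<psi> B' \<and> q A B = q A' B'" using that by blast
  next
    fix d assume "\<exists>A' B'. e B' \<noteq> 0 \<and> \<psi> A / \<psi> B = \<psi> A' / \<psi> B' \<and> d = q A' B'"
    then obtain A' B' where AB: "e B' \<noteq> 0" "\<psi> A / \<psi> B = \<psi> A' / \<psi> B'" and d: "d = q A' B'" by blast
    show "d = q A B" unfolding d by (rule q[OF \<open>e B \<noteq> 0\<close> AB, symmetric])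
  qed
  have V': "\<exists>A B. e B \<noteq> 0 \<and> z = \<psi> A / \<psi> B" if "z \<in> V" for z
    using frac[OF that] by (simp add: e_def)
  show thesis
  proof (rule that)
    fix a b assume "a \<in> V" "b \<in> V"
    from V'[OF \<open>a \<in> V\<close>] obtain A B where a: "e B \<noteq> 0" "a = \<psi> A / \<psi> B" by blast
    from V'[OF \<open>b \<in> V\<close>] obtain C D where b: "e D \<noteq> 0" "b = \<psi> C / \<psi> D" by blast
    note n = nz[OF a(1)] nz[OF b(1)]
    have BD: "e (B * D) \<noteq> 0" using a b by (simp add: e)
    have "a + b = \<psi> (A * D + C * B) / \<psi> (B * D)"
      using n by (simp add: a b rhom_simps[OF \<psi>] field_simps)
    hence "\<delta> (a + b) = q (A * D + C * B) (B * D)" by (simp only: \<delta>[OF BD])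
    also have "\<dots> = q A B + q C D"
      unfolding q_def e e'_add e'_mult by (rule quotient_rule_add[OF a(1) b(1)])
    finally show "\<delta> (a + b) = \<delta> a + \<delta> b" by (simp only: a(2) b(2) \<delta>[OF a(1)] \<delta>[OF b(1)])
    have \<theta>ab: "\<theta> a = e A / e B" "\<theta> b = e C / e D"
      using a b by (simp_all add: e_def \<theta>_divide V)
    have "a * b = \<psi> (A * C) / \<psi> (B * D)"
      by (simp add: a b rhom_simps[OF \<psi>])
    hence "\<delta> (a * b) = q (A * C) (B * D)" by (simp only: \<delta>[OF BD])
    also have "\<dots> = \<theta> a * q C D + \<theta> b * q A B"
      unfolding q_def e e'_mult \<theta>ab by (rule quotient_rule_mult[OF a(1) b(1)])
    finally show "\<delta> (a * b) = \<theta> a * \<delta> b + \<theta> b * \<delta> a"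
      by (simp only: a(2) b(2) \<delta>[OF a(1)] \<delta>[OF b(1)])
  next
    fix A
    show "\<delta> (\<psi> A) = \<theta> (\<psi> (der A))"
    proof -
      have "\<delta> (\<psi> A / \<psi> 1) = q A 1" by (rule \<delta>) (simp add: e)
      also have "\<dots> = e' A" by (simp add: q_def e \<open>e' 1 = 0\<close>)
      finally show ?thesis by (simp add: rhom_one[OF \<psi>] e'_def)
    qed
  qed
qed

lemma rhom_const3: "rhom const3"
  by (simp add: rhom_def const3_def one_pCons)

lemma place_subring:
  assumes "place V \<theta>"
  shows "subring V ring_of_type_algebra"
proof -
  interpret place V \<theta> by (rule assms)
  interpret R: ring "ring_of_type_algebra :: 'a ring" by (rule ring_from_type_algebra)
  have m: "\<ominus>\<^bsub>ring_of_type_algebra\<^esub> h = - h" for h :: 'a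
    by (rule R.minus_equality) (simp_all add: ring_of_type_algebra_def)
  show ?thesis
  proof (rule R.subringI)
    show "\<ominus>\<^bsub>ring_of_type_algebra\<^esub> h \<in> V" if "h \<in> V" for h
      unfolding m using that by (rule minus)
  qed (simp_all add: ring_of_type_algebra_def one add mult)
qed

lemma place_of_geometric_point:
  fixes \<phi> :: "'k::field poly3 \<Rightarrow> 'F::field"
  assumes P: "(V, \<theta>) \<in> geometric_points_over \<phi> S" and S: "S \<subseteq> points_compactification \<phi>"
  shows "place V \<theta>"
proof -
  interpret R: ring "ring_of_type_algebra :: 'F ring" by (rule ring_from_type_algebra)
  have m: "\<ominus>\<^bsub>ring_of_type_algebra\<^esub> h = - h" for h :: 'F
    by (rule R.minus_equality) (simp_all add: ring_of_type_algebra_def)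
  have "V \<in> points_compactification \<phi>" using P S unfolding geometric_points_over_def by blast
  hence V: "subring V ring_of_type_algebra" "\<And>z. z \<in> V \<or> inverse z \<in> V"
    unfolding points_compactification_def by blast+
  have \<theta>: "\<theta> \<in> ring_hom (ring_of_type_algebra\<lparr>carrier := V\<rparr>) ring_of_type_algebra"
    "\<And>z. z \<in> V \<Longrightarrow> \<theta> z = 0 \<longleftrightarrow> z = 0 \<or> inverse z \<notin> V"
    using P unfolding geometric_points_over_def by blast+
  note V' = subringE(3,5,6,7)[OF V(1), unfolded m, unfolded ring_of_type_algebra_def, simplified]
  have \<theta>': "\<theta> 1 = 1" "\<And>a b. a \<in> V \<Longrightarrow> b \<in> V \<Longrightarrow> \<theta> (a + b) = \<theta> a + \<theta> b"
      "\<And>a b. a \<in> V \<Longrightarrow> b \<in> V \<Longrightarrow> \<theta> (a * b) = \<theta> a * \<theta> b"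
    using \<theta>(1) by (simp_all add: ring_hom_def ring_of_type_algebra_def)
  show ?thesis
    by unfold_locales (fact V' V(2) \<theta>' \<theta>(2))+
qed

section \<open>Functions at the unique place at infinity\<close>

locale one_place_curve =
  fixes D :: "'k::field poly3 set" and \<phi> :: "'k poly3 \<Rightarrow> 'F::field"
  assumes function_field: "is_function_field D \<phi>"
    and one_place: "only_one_place_at_infinity \<phi>"
begin

lemma rhom_\<phi>: "rhom \<phi>"
proof -
  have "\<phi> \<in> ring_hom ring_of_type_algebra ring_of_type_algebra"
    using function_field unfolding is_function_field_def by blast
  thus ?thesis by (simp add: ring_hom_def ring_of_type_algebra_def rhom_def)
qed

lemma D_eq: "D = {p. \<phi> p = 0}"
  using function_field unfolding is_function_field_def by blast

lemma fractions: "\<exists>p q. \<phi> q \<noteq> 0 \<and> z = \<phi> p / \<phi> q"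
  using function_field unfolding is_function_field_def by blast

definition \<iota> :: "'k \<Rightarrow> 'F" where "\<iota> c = \<phi> (const3 c)"

sublocale field_extension \<iota>
  by unfold_locales (unfold \<iota>_def, rule rhom_comp[OF rhom_const3 rhom_\<phi>])

text \<open>Valuation rings are integrally closed, so a place lies at infinity iff some regular
  function on the curve itself has a pole there.\<close>

lemma normalization_subset_iff:
  assumes "place V \<theta>"
  shows "normalization_ring \<phi> \<subseteq> V \<longleftrightarrow> range \<phi> \<subseteq> V"
proof
  assume *: "normalization_ring \<phi> \<subseteq> V"
  have "\<phi> p \<in> normalization_ring \<phi>" for p
  proof -
    have "- \<phi> p = \<phi> (- p)" "1 = \<phi> 1" "0 = \<phi> 0" by (simp_all add: rhom_simps[OF rhom_\<phi>])
    hence "- \<phi> p \<in> range \<phi>" "1 \<in> range \<phi>" "0 \<in> range \<phi>" by (metis rangeI)+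
    hence "Polynomial.coeff [:- \<phi> p, 1:] i \<in> range \<phi>" for i
      by (simp add: coeff_pCons split: nat.splits)
    moreover have "Polynomial.lead_coeff [:- \<phi> p, 1:] = 1" "poly [:- \<phi> p, 1:] (\<phi> p) = 0" by auto
    ultimately show ?thesis unfolding normalization_ring_def by blast
  qed
  thus "range \<phi> \<subseteq> V" using * by blast
next
  assume "range \<phi> \<subseteq> V"
  thus "normalization_ring \<phi> \<subseteq> V"
    using place.integrally_closed[OF assms] unfolding normalization_ring_def by blast
qed

text \<open>The residue map is restricted to \<open>V\<close> because geometric points carry
  \<open>extensional\<close> maps, which makes their equality meaningful.\<close>

lemma place_at_infinity:
  assumes V: "kplace V \<theta>" and p: "\<phi> p \<notin> V"
  shows "(V, restrict \<theta> V) \<in> places_at_infinity \<phi>"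
proof -
  interpret place V \<theta> using V by (rule kplace_place)
  have "range (\<phi> \<circ> const3) \<subseteq> V" using V unfolding kplace_def \<iota>_def by auto
  hence "V \<in> points_compactification \<phi>"
    using place_subring[OF kplace_place[OF V]] total p unfolding points_compactification_def by blast
  moreover have "V \<notin> points_normalization \<phi>"
    using p normalization_subset_iff[OF kplace_place[OF V]] unfolding points_normalization_def by blast
  moreover have "restrict \<theta> V \<in> ring_hom (ring_of_type_algebra\<lparr>carrier := V\<rparr>) ring_of_type_algebra"
    by (simp add: ring_hom_def ring_of_type_algebra_def one add mult \<theta>_one \<theta>_add \<theta>_mult)
  moreover have "restrict \<theta> V (\<phi> (const3 c)) = to_ac c" for c
    using V by (simp add: kplace_def \<iota>_def)
  moreover have "\<forall>z\<in>V. restrict \<theta> V z = 0 \<longleftrightarrow> z = 0 \<or> inverse z \<notin> V"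
    using \<theta>_eq_0_iff by simp
  moreover have "restrict \<theta> V \<in> extensional V" by simp
  ultimately show ?thesis
    unfolding places_at_infinity_def geometric_points_over_def by blast
qed

definition "infinite_place = (SOME P. P \<in> places_at_infinity \<phi>)"
definition "V\<^sub>0 = fst infinite_place"
definition "\<theta>\<^sub>0 = snd infinite_place"

lemma infinite_place: "(V\<^sub>0, \<theta>\<^sub>0) \<in> places_at_infinity \<phi>"
  using one_place unfolding V\<^sub>0_def \<theta>\<^sub>0_def infinite_place_def only_one_place_at_infinity_def
  by (metis prod.collapse someI)

lemma kplace_0: "kplace V\<^sub>0 \<theta>\<^sub>0"
proof -
  note P = infinite_place[unfolded places_at_infinity_def]
  have "place V\<^sub>0 \<theta>\<^sub>0" using P by (rule place_of_geometric_point) blast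
  moreover have "\<iota> c \<in> V\<^sub>0" "\<theta>\<^sub>0 (\<iota> c) = to_ac c" for c
  proof -
    have "V\<^sub>0 \<in> points_compactification \<phi>" using P unfolding geometric_points_over_def by blast
    hence "range (\<phi> \<circ> const3) \<subseteq> V\<^sub>0" unfolding points_compactification_def by blast
    thus "\<iota> c \<in> V\<^sub>0" by (auto simp: \<iota>_def)
    show "\<theta>\<^sub>0 (\<iota> c) = to_ac c" using P unfolding geometric_points_over_def \<iota>_def by blast
  qed
  ultimately show ?thesis by (simp add: kplace_def)
qed

sublocale P\<^sub>0: place V\<^sub>0 \<theta>\<^sub>0
  by (rule kplace_place[OF kplace_0])

lemma pole_at_infinity: "\<exists>p. \<phi> p \<notin> V\<^sub>0"
proof -
  have "\<not> normalization_ring \<phi> \<subseteq> V\<^sub>0"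
    using infinite_place
    unfolding places_at_infinity_def geometric_points_over_def points_normalization_def by blast
  hence "\<not> range \<phi> \<subseteq> V\<^sub>0"
    using normalization_subset_iff[OF P\<^sub>0.place_axioms] by blast
  thus ?thesis by blast
qed

text \<open>Values are compared on \<open>V\<close> only, since a place leaves them open
  elsewhere.\<close>

lemma place_unique:
  assumes V: "kplace V \<theta>" and p: "\<phi> p \<notin> V"
  shows "V = V\<^sub>0" and "\<And>z. z \<in> V \<Longrightarrow> \<theta> z = \<theta>\<^sub>0 z"
proof -
  have "(V, restrict \<theta> V) = (V\<^sub>0, \<theta>\<^sub>0)"
    using one_place place_at_infinity[OF V p] infinite_place
    unfolding only_one_place_at_infinity_def by blast
  hence 1: "V = V\<^sub>0" and 2: "restrict \<theta> V = \<theta>\<^sub>0" by blast+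
  show "V = V\<^sub>0" by (rule 1)
  show "\<theta> z = \<theta>\<^sub>0 z" if "z \<in> V" for z using fun_cong[OF 2, of z] that by simp
qed

text \<open>A transcendental function has a pole at some place, and a place where a regular function
  on the curve has a pole lies at infinity, hence equals \<open>V\<^sub>0\<close>.\<close>

lemma regular_at_infinity_imp_algebraic:
  assumes "\<phi> p \<in> V\<^sub>0"
  shows "algebraic (\<phi> p)"
proof (rule ccontr)
  assume "\<not> algebraic (\<phi> p)"
  then obtain V \<theta> where V: "kplace V \<theta>" "\<phi> p \<notin> V" by (rule transcendental_pole)
  show False using place_unique(1)[OF V] V(2) assms by simp
qed

lemma tangent_vector:
  obtains \<delta> where "\<And>\<delta>'. \<delta>' \<in> tangent_space \<phi> V\<^sub>0 \<theta>\<^sub>0 \<Longrightarrow> \<exists>c. \<forall>a\<in>V\<^sub>0. \<delta>' a = c * \<delta> a"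
proof -
  have P: "(V\<^sub>0, \<theta>\<^sub>0) \<in> geometric_points_over \<phi> (points_compactification \<phi>)"
    using infinite_place unfolding places_at_infinity_def geometric_points_over_def by blast
  have sm: "smooth_compactification \<phi>"
    using one_place by (simp add: only_one_place_at_infinity_def)
  show thesis
    using bspec[OF sm[unfolded smooth_compactification_def] P, unfolded prod.case] that by blast
qed

text \<open>As \<open>t\<close> is transcendental, the expression of \<open>\<phi> p\<close> as a
  polynomial in \<open>t\<close> is unique. This defines a surjection from k[x,y,u] to k[t] with
  kernel \<open>D\<close>, to which the isomorphism theorem applies.\<close>

lemma affine_line_if_polynomial:
  assumes t: "\<not> algebraic t" and range: "range \<phi> = range (ev \<iota> t)"
  shows "affine_line D"
proof -
  have inj: "f = h" if "ev \<iota> t f = ev \<iota> t h" for f h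
  proof -
    have "ev \<iota> t (f - h) = 0" using that by (simp add: rhom_diff[OF rhom_ev[OF \<iota>]])
    hence "f - h = 0" using t unfolding algebraic_def by blast
    thus ?thesis by simp
  qed
  define \<eta> where "\<eta> p = (THE f. ev \<iota> t f = \<phi> p)" for p
  have \<eta>I: "\<eta> p = f" if "ev \<iota> t f = \<phi> p" for p f
    unfolding \<eta>_def
  proof (rule the_equality)
    show "h = f" if "ev \<iota> t h = \<phi> p" for h by (rule inj) (simp add: that \<open>ev \<iota> t f = \<phi> p\<close>)
  qed (rule that)
  have \<eta>: "ev \<iota> t (\<eta> p) = \<phi> p" for p
  proof -
    have "\<phi> p \<in> range (ev \<iota> t)" using range by blast
    then obtain f where "ev \<iota> t f = \<phi> p" by (metis imageE)
    thus ?thesis using \<eta>I by simp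
  qed
  note h = rhom_simps[OF rhom_ev[OF \<iota>]] rhom_simps[OF rhom_\<phi>]
  have rh: "rhom \<eta>"
    unfolding rhom_def by (intro conjI allI \<eta>I) (simp_all only: h \<eta>)
  interpret ring_hom_ring "ring_of_type_algebra :: 'k poly3 ring" "ring_of_type_algebra :: 'k poly ring" \<eta>
  proof (rule ring_hom_ringI2[OF ring_from_type_algebra ring_from_type_algebra])
    show "\<eta> \<in> ring_hom ring_of_type_algebra ring_of_type_algebra"
      by (simp add: ring_hom_def ring_of_type_algebra_def rhom_add[OF rh] rhom_mult[OF rh] rhom_one[OF rh])
  qed
  have ker: "a_kernel (ring_of_type_algebra :: 'k poly3 ring) (ring_of_type_algebra :: 'k poly ring) \<eta> = D"
  proof -
    have "\<eta> p = 0 \<longleftrightarrow> \<phi> p = 0" for p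
      using \<eta>[of p] \<eta>I[of 0 p] by (auto simp: ev_0)
    thus ?thesis unfolding a_kernel_def' D_eq by (simp add: ring_of_type_algebra_def)
  qed
  have surj: "\<eta> ` carrier ring_of_type_algebra = carrier ring_of_type_algebra"
  proof -
    have "f \<in> range \<eta>" for f
    proof -
      have "ev \<iota> t f \<in> range \<phi>" using range by blast
      then obtain p where "ev \<iota> t f = \<phi> p" by (rule rangeE)
      hence "\<eta> p = f" by (rule \<eta>I)
      thus ?thesis by blast
    qed
    hence "range \<eta> = UNIV" by blast
    thus ?thesis by (simp add: ring_of_type_algebra_def)
  qed
  note iso = FactRing_iso_set[OF surj, unfolded ker]
  have "the_elem (\<eta> ` (D +>\<^bsub>ring_of_type_algebra\<^esub> const3 c)) = [:c:]" for c
  proof -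
    have "the_elem (\<eta> ` (D +>\<^bsub>ring_of_type_algebra\<^esub> const3 c)) = \<eta> (const3 c)"
      by (rule the_elem_simp[unfolded ker]) (simp add: ring_of_type_algebra_def)
    also have "\<dots> = [:c:]"
      by (rule \<eta>I, subst ev_const) (rule rhom_zero[OF \<iota>], rule \<iota>_def)
    finally show ?thesis .
  qed
  thus ?thesis unfolding affine_line_def coordinate_ring_def by (intro bexI[OF _ iso] allI)
qed

end

section \<open>Tangent vectors and coordinate rings with two generators\<close>

lemma pderiv_sum: "pderiv (sum f A) = (\<Sum>i\<in>A. pderiv (f i))"
  by (induction A rule: infinite_finite_induct) (simp_all add: pderiv_add)

text \<open>On an iterated polynomial ring \<open>map_poly pderiv\<close> is the partial derivative
  in the inner variable, and \<open>pderiv\<close> the one in the outer variable. Both are needed as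
  derivations.\<close>

lemma coeffwise_derivation_mult:
  fixes A :: "'a::field poly poly"
  shows "map_poly pderiv (A * B) = A * map_poly pderiv B + B * map_poly pderiv A"
proof (rule poly_eqI)
  fix n
  have "Polynomial.coeff (map_poly pderiv (A * B)) n
      = (\<Sum>i\<le>n. Polynomial.coeff A i * pderiv (Polynomial.coeff B (n - i))
          + Polynomial.coeff B (n - i) * pderiv (Polynomial.coeff A i))"
    by (simp add: coeff_map_poly coeff_mult pderiv_sum pderiv_mult)
  also have "\<dots> = Polynomial.coeff (A * map_poly pderiv B) n
      + (\<Sum>i\<le>n. Polynomial.coeff (map_poly pderiv A) i * Polynomial.coeff B (n - i))"
    by (simp add: sum.distrib coeff_mult coeff_map_poly mult.commute)
  also have "(\<Sum>i\<le>n. Polynomial.coeff (map_poly pderiv A) i * Polynomial.coeff B (n - i))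
      = Polynomial.coeff (map_poly pderiv A * B) n"
    by (simp only: coeff_mult)
  also have "map_poly pderiv A * B = B * map_poly pderiv A" by (rule mult.commute)
  finally show "Polynomial.coeff (map_poly pderiv (A * B)) n
      = Polynomial.coeff (A * map_poly pderiv B + B * map_poly pderiv A) n" by simp
qed

context field_extension
begin

lemma minimal_polynomial:
  assumes "algebraic c"
  obtains m where "m \<noteq> 0" "\<And>f. ev \<iota> c f = 0 \<longleftrightarrow> m dvd f"
proof -
  define d where "d = (LEAST d. \<exists>f. f \<noteq> 0 \<and> ev \<iota> c f = 0 \<and> Polynomial.degree f = d)"
  have "\<exists>f. f \<noteq> 0 \<and> ev \<iota> c f = 0 \<and> Polynomial.degree f = d"
    unfolding d_def by (rule LeastI_ex) (use assms[unfolded algebraic_def] in blast)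
  then obtain m where m: "m \<noteq> 0" "ev \<iota> c m = 0" "Polynomial.degree m = d" by blast
  have min: "d \<le> Polynomial.degree f" if "f \<noteq> 0" "ev \<iota> c f = 0" for f
    unfolding d_def by (rule Least_le) (use that in blast)
  note h = rhom_simps[OF rhom_ev[OF \<iota>]]
  have "m dvd f" if f: "ev \<iota> c f = 0" for f
  proof -
    have "ev \<iota> c (f div m * m + f mod m) = 0" using f by simp
    hence "ev \<iota> c (f mod m) = 0" by (simp only: h m(2) mult_zero_right add_0_left)
    hence "f mod m = 0"
      using min[of "f mod m"] degree_mod_less[OF m(1), of f] m(3) by linarith
    thus ?thesis by (rule mod_0_imp_dvd)
  qed
  moreover have "ev \<iota> c f = 0" if "m dvd f" for f
  proof -
    from that obtain q where "f = m * q" by (rule dvdE)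
    thus ?thesis by (simp only: h m(2) mult_zero_left)
  qed
  ultimately have "ev \<iota> c f = 0 \<longleftrightarrow> m dvd f" for f by blast
  thus thesis by (rule that[OF m(1)])
qed

text \<open>Used to write functions as fractions of polynomials in \<open>inverse t\<close>, which
  is regular at infinity.\<close>

lemma clear_inverse:
  fixes t :: 'F
  assumes "t \<noteq> 0" and g: "rhom g"
  shows "\<exists>B n. ev g t A * inverse t ^ n = ev g (inverse t) B"
proof (induction A)
  case 0
  show ?case by (rule exI[of _ 0], rule exI[of _ 0]) (simp add: ev_0)
next
  case (pCons a A)
  then obtain B n where B: "ev g t A * inverse t ^ n = ev g (inverse t) B" by blast
  have "ev g t (pCons a A) * inverse t ^ Suc n = g a * inverse t ^ Suc n + ev g t A * (t * inverse t ^ Suc n)"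
    by (simp only: ev_pCons[of g, OF rhom_zero[OF g]]) (simp add: algebra_simps del: power_Suc)
  also have "t * inverse t ^ Suc n = inverse t ^ n"
    using assms(1) by (simp flip: mult.assoc)
  also have "g a * inverse t ^ Suc n + ev g t A * inverse t ^ n = g a * inverse t ^ Suc n + ev g (inverse t) B"
    by (simp only: B)
  also have "\<dots> = ev g (inverse t) (monom a (Suc n) + B)"
    by (simp only: rhom_add[OF rhom_ev[OF g]] ev_monom[OF g])
  finally show ?case by blast
qed

end

context one_place_curve
begin

lemma inverse_transcendental_at_infinity:
  assumes t: "\<not> algebraic (\<phi> p)"
  shows "inverse (\<phi> p) \<in> V\<^sub>0" "\<theta>\<^sub>0 (inverse (\<phi> p)) = 0"
proof -
  have "\<phi> p \<notin> V\<^sub>0" using regular_at_infinity_imp_algebraic t by blast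
  thus "inverse (\<phi> p) \<in> V\<^sub>0" "\<theta>\<^sub>0 (inverse (\<phi> p)) = 0" using P\<^sub>0.pole by blast+
qed

text \<open>A second conjugate of \<open>c\<close> would give a second place at infinity.\<close>

lemma conjugate_unique:
  assumes c: "algebraic c" and t: "\<not> algebraic (\<phi> p)"
    and \<gamma>: "\<And>f. ev \<iota> c f = 0 \<Longrightarrow> ev to_ac \<gamma> f = 0"
  shows "\<gamma> = \<theta>\<^sub>0 c"
proof -
  have nt: "\<not> algebraic (inverse (\<phi> p))" using t algebraic_inverse_imp by blast
  obtain V \<theta> where V: "kplace V \<theta>" "c \<in> V" "inverse (\<phi> p) \<in> V" "\<theta> c = \<gamma>" "\<theta> (inverse (\<phi> p)) = 0"
    using place_with_values[OF c nt \<gamma>] by blast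
  have "\<phi> p \<noteq> 0" using t algebraic_0 by metis
  hence "\<phi> p \<notin> V"
    using place.\<theta>_eq_0_iff[OF kplace_place[OF V(1)] V(3)] V(5) by simp
  from place_unique(2)[OF V(1) this V(2)] show ?thesis using V(4) by simp
qed

text \<open>If \<open>c\<close> were outside k, its minimal polynomial \<open>m\<close> would have
  only one root and derivative 0. Near infinity the curve would be given by k[C, W] modulo
  \<open>m\<close> at W = 0, with \<open>inverse t\<close> for W, and both partial derivatives would
  survive there.\<close>

lemma generator_in_base_field:
  assumes c: "algebraic c" and t: "\<not> algebraic t" and range: "range \<phi> = range (ev (ev \<iota> c) t)"
  shows "c \<in> range \<iota>"
proof (rule ccontr)
  assume nc: "c \<notin> range \<iota>"
  note g = rhom_ev[OF \<iota>, of c]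
  note h = rhom_simps[OF g]
  have "t \<in> range (ev (ev \<iota> c) t)" using ev_X[OF g, of t] by (metis rangeI)
  then obtain p where tp: "t = \<phi> p" using range by auto
  have t0: "t \<noteq> 0" using t algebraic_0 by metis
  define w where "w = inverse t"
  have w: "w \<in> V\<^sub>0" "\<theta>\<^sub>0 w = 0" "w \<noteq> 0" and tw: "inverse w = t"
    using inverse_transcendental_at_infinity[of p] t t0 by (simp_all add: w_def tp)
  have nw: "\<not> algebraic w" using t algebraic_inverse_imp unfolding w_def by blast
  have cV: "c \<in> V\<^sub>0" by (rule algebraic_in_place[OF c kplace_0])
  obtain m where m: "m \<noteq> 0" and m_iff: "\<And>f. ev \<iota> c f = 0 \<longleftrightarrow> m dvd f"
    using minimal_polynomial[OF c] by blast
  have root_iff: "ev to_ac (\<theta>\<^sub>0 c) f = 0 \<longleftrightarrow> m dvd f" for f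
  proof -
    have "\<theta>\<^sub>0 (ev \<iota> c f) = 0 \<longleftrightarrow> ev \<iota> c f = 0"
      using kplace_algebraic_nonzero[OF kplace_0 algebraic_ev[OF c], of f] P\<^sub>0.\<theta>_zero by metis
    thus ?thesis by (simp only: kplace_ev(2)[OF kplace_0 cV] m_iff)
  qed
  have m_root: "\<gamma> = \<theta>\<^sub>0 c" if "ev to_ac \<gamma> m = 0" for \<gamma>
  proof (rule conjugate_unique[OF c])
    show "\<not> algebraic (\<phi> p)" using t tp by simp
    fix f assume "ev \<iota> c f = 0"
    hence "m dvd f" by (simp only: m_iff)
    then obtain q where "f = m * q" by (rule dvdE)
    thus "ev to_ac \<gamma> f = 0" by (simp only: rhom_mult[OF rhom_ev[OF to_ac_rhom]] that mult_zero_left)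
  qed
  have pderiv_m: "pderiv m = 0"
  proof (rule ccontr)
    assume nz: "pderiv m \<noteq> 0"
    define M where "M = map_poly to_ac m"
    have dM: "Polynomial.degree M = Polynomial.degree m"
      unfolding M_def by (intro degree_map_poly) simp
    have "poly M (\<theta>\<^sub>0 c) = 0" using root_iff[of m] by (simp add: ev_def M_def)
    then obtain Q where Q: "M = [:- \<theta>\<^sub>0 c, 1:] * Q" unfolding poly_eq_0_iff_dvd by (rule dvdE)
    have "M \<noteq> 0" using m by (simp add: M_def map_poly_eq_0_iff)
    hence Q0: "Q \<noteq> 0" using Q by auto
    show False
    proof (cases "Polynomial.degree Q = 0")
      case True
      have "Polynomial.degree m = 1"
      proof -
        have "Polynomial.degree M = Polynomial.degree [:- \<theta>\<^sub>0 c, 1:] + Polynomial.degree Q"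
          unfolding Q by (rule degree_mult_eq) (use Q0 in simp_all)
        thus ?thesis using dM True by simp
      qed
      then obtain a b where ab: "m = [:a, b:]" "b \<noteq> 0"
        by (metis One_nat_def degree1_coeffs)
      have "ev \<iota> c m = 0" using m_iff by simp
      hence "\<iota> a + c * \<iota> b = 0" by (simp add: ab ev_pCons ev_0 rhom_zero[OF \<iota>])
      moreover have "\<iota> b \<noteq> 0" using ab(2) by (simp add: rhom_eq_0_iff[OF \<iota>])
      ultimately have "c = - \<iota> a * inverse (\<iota> b)"
        by (simp add: field_simps eq_neg_iff_add_eq_0)
      also have "\<dots> = \<iota> (- a * inverse b)"
        by (simp add: rhom_simps[OF \<iota>] rhom_inverse[OF \<iota>])
      finally show False using nc by blast
    next
      \<comment> \<open>A root of the cofactor \<open>Q\<close> is again a conjugate of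
        \<open>c\<close>, so \<open>\<theta>\<^sub>0 c\<close> is a double root. Then
        \<open>m\<close> divides its nonzero derivative, which has smaller degree.\<close>
      case False
      then obtain \<gamma> where \<gamma>: "poly Q \<gamma> = 0"
        using alg_closed_imp_poly_has_root[of Q] by blast
      hence "ev to_ac \<gamma> m = 0" by (simp add: ev_def M_def[symmetric] Q)
      hence "poly Q (\<theta>\<^sub>0 c) = 0" using m_root \<gamma> by blast
      moreover have "pderiv M = [:- \<theta>\<^sub>0 c, 1:] * pderiv Q + Q * pderiv [:- \<theta>\<^sub>0 c, 1:]"
        unfolding Q by (rule pderiv_mult)
      ultimately have "poly (pderiv M) (\<theta>\<^sub>0 c) = 0" by simp
      moreover have "pderiv M = map_poly to_ac (pderiv m)"
        by (rule poly_eqI) (simp add: M_def coeff_pderiv coeff_map_poly)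
      ultimately have "m dvd pderiv m" using root_iff by (simp add: ev_def)
      hence "Polynomial.degree m \<le> Polynomial.degree (pderiv m)" using nz by (rule dvd_imp_degree_le)
      moreover have "Polynomial.degree (pderiv m) < Polynomial.degree m"
      proof (rule degree_lessI)
        show "pderiv m \<noteq> 0 \<or> 0 < Polynomial.degree m" using nz by simp
        show "\<forall>k\<ge>Polynomial.degree m. Polynomial.coeff (pderiv m) k = 0"
          by (simp add: coeff_pderiv coeff_eq_0)
      qed
      ultimately show False by simp
    qed
  qed
  \<comment> \<open>Local description at infinity: \<open>\<psi>\<close> evaluates k[C][W] at
    \<open>c\<close> and \<open>w = inverse t\<close>.\<close>
  define \<psi> where "\<psi> = ev (ev \<iota> c) w"
  have \<psi>: "rhom \<psi>" unfolding \<psi>_def by (rule rhom_ev[OF g])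
  have \<psi>_pCons: "\<psi> (pCons a A) = ev \<iota> c a + w * \<psi> A" for a A
    by (simp add: \<psi>_def ev_pCons rhom_zero[OF g])
  have \<psi>_c: "\<psi> [:[:0, 1:]:] = c" and \<psi>_w: "\<psi> [:0, 1:] = w"
    by (simp_all add: \<psi>_def ev_const ev_X[OF g] ev_X[OF \<iota>] rhom_zero[OF g])
  have \<psi>_\<iota>: "\<psi> [:[:k:]:] = \<iota> k" for k
    by (simp add: \<psi>_def ev_const rhom_zero[OF g] rhom_zero[OF \<iota>])
  have \<psi>V: "\<psi> A \<in> V\<^sub>0" for A
    by (induction A)
      (simp_all add: \<psi>_pCons rhom_zero[OF \<psi>] P\<^sub>0.zero P\<^sub>0.add P\<^sub>0.mult w kplace_ev(1)[OF kplace_0 cV])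
  have ker: "m dvd Polynomial.coeff A i" if "\<psi> A = 0" for A i
    using ev_ev_eq_0[OF c nw, of A i] that by (simp add: \<psi>_def m_iff)
  have \<theta>g: "\<theta>\<^sub>0 (ev \<iota> c a) = 0 \<longleftrightarrow> ev \<iota> c a = 0" for a
    using kplace_algebraic_nonzero[OF kplace_0 algebraic_ev[OF c], of a] P\<^sub>0.\<theta>_zero by metis
  have \<theta>\<psi>: "\<theta>\<^sub>0 (\<psi> (pCons a A)) = \<theta>\<^sub>0 (ev \<iota> c a)" for a A
    by (simp add: \<psi>_pCons P\<^sub>0.\<theta>_add P\<^sub>0.\<theta>_mult P\<^sub>0.mult w \<psi>V kplace_ev(1)[OF kplace_0 cV])
  have quotients: "\<exists>A B. \<psi> B \<noteq> 0 \<and> z = \<psi> A / \<psi> B" for z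
  proof -
    obtain p q where pq: "\<phi> q \<noteq> 0" "z = \<phi> p / \<phi> q" using fractions by blast
    have "\<exists>B n. \<phi> r * w ^ n = \<psi> B" for r
    proof -
      have "\<phi> r \<in> range (ev (ev \<iota> c) t)" using range by blast
      then obtain A where "\<phi> r = ev (ev \<iota> c) t A" by (rule rangeE)
      thus ?thesis using clear_inverse[OF t0 g, of A] by (simp only: \<psi>_def w_def)
    qed
    note * = this
    obtain B n where "\<phi> p * w ^ n = \<psi> B" using *[of p] by blast
    moreover obtain B' n' where "\<phi> q * w ^ n' = \<psi> B'" using *[of q] by blast
    ultimately have B: "\<phi> p * w ^ n = \<psi> B" "\<phi> q * w ^ n' = \<psi> B'" .
    have X: "\<psi> (monom 1 k) = w ^ k" for k
      unfolding \<psi>_def ev_monom[OF g] by (simp add: h)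
    have "\<psi> (B' * monom 1 n) \<noteq> 0"
      using pq w(3) by (simp add: rhom_mult[OF \<psi>] X flip: B)
    moreover have "z = \<psi> (B * monom 1 n') / \<psi> (B' * monom 1 n)"
      using pq w(3) by (simp add: rhom_mult[OF \<psi>] X flip: B)
    ultimately show ?thesis by blast
  qed
  \<comment> \<open>Powers of \<open>w\<close> are cancelled by induction on the denominator. If its
    constant term vanishes, the induction hypothesis is applied to \<open>w * z\<close>; the
    numerator found there has value 0, so a factor \<open>w\<close> splits off it.\<close>
  have loc: "\<exists>A' B'. \<theta>\<^sub>0 (\<psi> B') \<noteq> 0 \<and> z = \<psi> A' / \<psi> B'"
    if "z \<in> V\<^sub>0" "\<psi> B \<noteq> 0" "z = \<psi> A / \<psi> B" for z A B
    using that
  proof (induction B arbitrary: z)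
    case 0
    thus ?case by (simp add: rhom_zero[OF \<psi>])
  next
    case (pCons b B)
    show ?case
    proof (cases "ev \<iota> c b = 0")
      case False
      hence "\<theta>\<^sub>0 (\<psi> (pCons b B)) \<noteq> 0" by (simp add: \<theta>\<psi> \<theta>g)
      thus ?thesis using pCons.prems(3) by blast
    next
      case True
      hence B: "\<psi> (pCons b B) = w * \<psi> B" by (simp add: \<psi>_pCons)
      have "\<psi> B \<noteq> 0" using pCons.prems(2) B by auto
      moreover have "w * z \<in> V\<^sub>0" using pCons.prems(1) w(1) by (rule P\<^sub>0.mult[rotated])
      moreover have "w * z = \<psi> A / \<psi> B" using pCons.prems(3) w(3) by (simp add: B)
      ultimately obtain A' B' where AB: "\<theta>\<^sub>0 (\<psi> B') \<noteq> 0" "w * z = \<psi> A' / \<psi> B'"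
        using pCons.IH by blast
      have nz: "\<psi> B' \<noteq> 0" using AB(1) P\<^sub>0.\<theta>_zero by metis
      obtain a A1 where A': "A' = pCons a A1" by (rule pCons_cases)
      have "\<psi> A' = w * (z * \<psi> B')" using AB(2) nz by (simp add: field_simps)
      hence "\<theta>\<^sub>0 (\<psi> A') = 0"
        by (simp add: P\<^sub>0.\<theta>_mult[OF w(1) P\<^sub>0.mult[OF pCons.prems(1) \<psi>V]] w(2))
      hence "ev \<iota> c a = 0" by (simp add: A' \<theta>\<psi> \<theta>g)
      hence "\<psi> A' = w * \<psi> A1" by (simp add: A' \<psi>_pCons)
      hence "w * z = w * (\<psi> A1 / \<psi> B')" using AB(2) by simp
      hence "z = \<psi> A1 / \<psi> B'" by (rule mult_left_cancel[OF w(3), THEN iffD1])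
      thus ?thesis using AB(1) by blast
    qed
  qed
  have frac: "\<exists>A B. \<theta>\<^sub>0 (\<psi> B) \<noteq> 0 \<and> z = \<psi> A / \<psi> B" if "z \<in> V\<^sub>0" for z
    using quotients[of z] loc[OF that] by blast
  have tangent: "\<delta> \<in> tangent_space \<phi> V\<^sub>0 \<theta>\<^sub>0"
    if "\<And>a b. a \<in> V\<^sub>0 \<Longrightarrow> b \<in> V\<^sub>0 \<Longrightarrow> \<delta> (a + b) = \<delta> a + \<delta> b"
      "\<And>a b. a \<in> V\<^sub>0 \<Longrightarrow> b \<in> V\<^sub>0 \<Longrightarrow> \<delta> (a * b) = \<theta>\<^sub>0 a * \<delta> b + \<theta>\<^sub>0 b * \<delta> a"
      "\<And>k. \<delta> (\<psi> [:[:k:]:]) = 0" for \<delta>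
    unfolding tangent_space_def mem_Collect_eq
    by (intro conjI allI ballI that) (use that(3) in \<open>simp only: \<psi>_\<iota>[unfolded \<iota>_def]\<close>)
  \<comment> \<open>Differentiation along \<open>c\<close>: it respects the kernel because
    \<open>pderiv m = 0\<close> makes \<open>m * pderiv q\<close> the derivative of
    \<open>m * q\<close>.\<close>
  obtain \<delta>1 where \<delta>1: "\<And>a b. a \<in> V\<^sub>0 \<Longrightarrow> b \<in> V\<^sub>0 \<Longrightarrow> \<delta>1 (a + b) = \<delta>1 a + \<delta>1 b"
      "\<And>a b. a \<in> V\<^sub>0 \<Longrightarrow> b \<in> V\<^sub>0 \<Longrightarrow> \<delta>1 (a * b) = \<theta>\<^sub>0 a * \<delta>1 b + \<theta>\<^sub>0 b * \<delta>1 a"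
      "\<And>A. \<delta>1 (\<psi> A) = \<theta>\<^sub>0 (\<psi> (map_poly pderiv A))"
  proof (rule local_derivation[OF P\<^sub>0.place_axioms \<psi> \<psi>V frac, of "map_poly pderiv"])
    show "map_poly pderiv (A + B) = map_poly pderiv A + map_poly pderiv B" for A B :: "'k poly poly"
      by (rule poly_eqI) (simp add: coeff_map_poly pderiv_add)
    show "map_poly pderiv (A * B) = A * map_poly pderiv B + B * map_poly pderiv A" for A B :: "'k poly poly"
      by (rule coeffwise_derivation_mult)
    fix A assume A: "\<psi> A = 0"
    have "ev \<iota> c (Polynomial.coeff (map_poly pderiv A) i) = 0" for i
    proof -
      obtain q where "Polynomial.coeff A i = m * q" using ker[OF A] by (rule dvdE)
      hence "Polynomial.coeff (map_poly pderiv A) i = m * pderiv q"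
        by (simp add: coeff_map_poly pderiv_mult pderiv_m)
      thus ?thesis by (simp add: m_iff)
    qed
    hence "map_poly (ev \<iota> c) (map_poly pderiv A) = 0"
      by (intro poly_eqI) (simp add: coeff_map_poly ev_0)
    thus "\<psi> (map_poly pderiv A) = 0" by (simp add: \<psi>_def ev_def[of "ev \<iota> c"])
  qed (assumption, rule that)
  \<comment> \<open>Differentiation along \<open>w\<close>: it shifts the coefficients and
    multiplies them by integers, so divisibility by \<open>m\<close> is kept.\<close>
  obtain \<delta>2 where \<delta>2: "\<And>a b. a \<in> V\<^sub>0 \<Longrightarrow> b \<in> V\<^sub>0 \<Longrightarrow> \<delta>2 (a + b) = \<delta>2 a + \<delta>2 b"
      "\<And>a b. a \<in> V\<^sub>0 \<Longrightarrow> b \<in> V\<^sub>0 \<Longrightarrow> \<delta>2 (a * b) = \<theta>\<^sub>0 a * \<delta>2 b + \<theta>\<^sub>0 b * \<delta>2 a"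
      "\<And>A. \<delta>2 (\<psi> A) = \<theta>\<^sub>0 (\<psi> (pderiv A))"
  proof (rule local_derivation[OF P\<^sub>0.place_axioms \<psi> \<psi>V frac, of pderiv])
    show "pderiv (A + B) = pderiv A + pderiv B" "pderiv (A * B) = A * pderiv B + B * pderiv A"
      for A B :: "'k poly poly" by (rule pderiv_add, rule pderiv_mult)
    fix A assume A: "\<psi> A = 0"
    have "ev \<iota> c (Polynomial.coeff (pderiv A) i) = 0" for i
      using ker[OF A, of "Suc i"] unfolding m_iff coeff_pderiv by (rule dvd_mult)
    hence "map_poly (ev \<iota> c) (pderiv A) = 0"
      by (intro poly_eqI) (simp add: coeff_map_poly ev_0)
    thus "\<psi> (pderiv A) = 0" by (simp add: \<psi>_def ev_def[of "ev \<iota> c"])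
  qed (assumption, rule that)
  have \<psi>01: "\<psi> 0 = 0" "\<psi> 1 = 1" using \<psi> by (rule rhom_zero, rule rhom_one)
  have [simp]: "map_poly pderiv [:f:] = [:pderiv f:]" for f :: "'k poly"
    by (simp add: map_poly_pCons)
  have d: "map_poly pderiv [:[:0, 1:]:] = (1 :: 'k poly poly)" "pderiv [:[:0, 1:]:] = (0 :: 'k poly poly)"
      "pderiv [:0, 1:] = (1 :: 'k poly poly)"
    by (simp_all add: pderiv_pCons one_pCons)
  have vals: "\<delta>1 c = 1" "\<delta>2 c = 0" "\<delta>2 w = 1"
    using \<delta>1(3)[of "[:[:0, 1:]:]"] \<delta>2(3)[of "[:[:0, 1:]:]"] \<delta>2(3)[of "[:0, 1:]"]
    by (simp_all only: \<psi>_c \<psi>_w d \<psi>01 P\<^sub>0.\<theta>_one P\<^sub>0.\<theta>_zero)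
  have T1: "\<delta>1 \<in> tangent_space \<phi> V\<^sub>0 \<theta>\<^sub>0"
    by (rule tangent[OF \<delta>1(1,2)]) (simp_all add: \<delta>1(3) pderiv_pCons \<psi>01 P\<^sub>0.\<theta>_zero)
  have T2: "\<delta>2 \<in> tangent_space \<phi> V\<^sub>0 \<theta>\<^sub>0"
    by (rule tangent[OF \<delta>2(1,2)]) (simp_all add: \<delta>2(3) pderiv_pCons \<psi>01 P\<^sub>0.\<theta>_zero)
  obtain \<delta> where \<delta>: "\<And>\<delta>'. \<delta>' \<in> tangent_space \<phi> V\<^sub>0 \<theta>\<^sub>0 \<Longrightarrow> \<exists>e. \<forall>a\<in>V\<^sub>0. \<delta>' a = e * \<delta> a"
    using tangent_vector by blast
  obtain e1 where e1: "\<forall>a\<in>V\<^sub>0. \<delta>1 a = e1 * \<delta> a" using \<delta>[OF T1] by blast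
  obtain e2 where e2: "\<forall>a\<in>V\<^sub>0. \<delta>2 a = e2 * \<delta> a" using \<delta>[OF T2] by blast
  \<comment> \<open>The first equation makes \<open>\<delta> c\<close> nonzero, the second then
    forces \<open>e2 = 0\<close>, against the third.\<close>
  have "e1 * \<delta> c = 1" "e2 * \<delta> c = 0" "e2 * \<delta> w = 1"
    using bspec[OF e1 cV] bspec[OF e2 cV] bspec[OF e2 w(1)] vals by simp_all
  thus False by auto
qed

text \<open>Once \<open>c\<close> is known to lie in k, polynomials in \<open>c\<close> and
  \<open>t\<close> are polynomials in \<open>t\<close> alone.\<close>

theorem affine_line_if_generated:
  assumes c: "algebraic c" and t: "\<not> algebraic t" and range: "range \<phi> = range (ev (ev \<iota> c) t)"
  shows "affine_line D"
proof (rule affine_line_if_polynomial[OF t])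
  obtain k where k: "c = \<iota> k" using generator_in_base_field[OF assms] by blast
  have 1: "ev (ev \<iota> c) t A = ev \<iota> t (map_poly (\<lambda>f. poly f k) A)" for A
  proof (induction A)
    case (pCons a A)
    have "ev \<iota> c a = \<iota> (poly a k)"
      by (induction a) (simp_all add: ev_0 ev_pCons rhom_simps[OF \<iota>] k)
    thus ?case
      using pCons.IH by (simp add: map_poly_pCons ev_pCons ev_0 rhom_zero[OF \<iota>])
  qed (simp add: ev_0)
  have 2: "ev \<iota> t f = ev (ev \<iota> c) t (map_poly (\<lambda>a. [:a:]) f)" for f
    by (induction f) (simp_all add: map_poly_pCons ev_pCons ev_0 rhom_zero[OF \<iota>] ev_const)
  show "range \<phi> = range (ev \<iota> t)"
  proof (rule Set.set_eqI)
    fix z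
    have "z \<in> range (ev (ev \<iota> c) t) \<longleftrightarrow> z \<in> range (ev \<iota> t)"
    proof
      assume "z \<in> range (ev (ev \<iota> c) t)"
      then obtain A where "z = ev (ev \<iota> c) t A" by (rule rangeE)
      thus "z \<in> range (ev \<iota> t)" unfolding 1 by blast
    next
      assume "z \<in> range (ev \<iota> t)"
      then obtain f where "z = ev \<iota> t f" by (rule rangeE)
      thus "z \<in> range (ev (ev \<iota> c) t)" unfolding 2 by blast
    qed
    thus "z \<in> range \<phi> \<longleftrightarrow> z \<in> range (ev \<iota> t)" by (simp only: range)
  qed
qed

end

section \<open>Polynomial approximation of square roots\<close>

text \<open>\<open>h\<close> is the polynomial part of the square root of \<open>G\<close>; its
  coefficients are found from the top down, each step dividing by \<open>2 * b\<close>.\<close>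

lemma poly_sqrt_approx:
  fixes G :: "'k::field poly"
  assumes two: "(2::'k) \<noteq> 0" and b: "b \<noteq> 0" and N: "N > 0"
    and G: "Polynomial.degree G = 2 * N" "Polynomial.coeff G (2 * N) = b ^ 2"
  obtains h where "Polynomial.degree h \<le> N" "Polynomial.coeff h N = b" "Polynomial.degree (h ^ 2 - G) < N"
proof -
  have "\<exists>h. Polynomial.degree h \<le> N \<and> Polynomial.coeff h N = b \<and>
      (\<forall>k\<ge>2 * N - j. Polynomial.coeff (h ^ 2 - G) k = 0)" if "j \<le> N" for j
    using that
  proof (induction j)
    case 0
    have "Polynomial.coeff (monom b N ^ 2 - G) k = 0" if "k \<ge> 2 * N" for k
      using that G by (cases "k = 2 * N") (simp_all add: monom_power coeff_eq_0 mult.commute)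
    thus ?case by (intro exI[of _ "monom b N"]) (simp add: degree_monom_le)
  next
    case (Suc j)
    then obtain h where h: "Polynomial.degree h \<le> N" "Polynomial.coeff h N = b"
        "\<forall>k\<ge>2 * N - j. Polynomial.coeff (h ^ 2 - G) k = 0" by auto
    define e where "e = Polynomial.coeff (h ^ 2 - G) (2 * N - Suc j)"
    define i where "i = N - Suc j"
    \<comment> \<open>In degree \<open>i + N\<close> the cross term of \<open>(h - d) ^ 2\<close>
      removes \<open>e\<close>, as \<open>h\<close> has leading coefficient \<open>b\<close>; the
      square of \<open>d\<close> lies in lower degrees.\<close>
    define d where "d = monom (e / (2 * b)) i"
    have iN: "i < N" "i + N = 2 * N - Suc j" "2 * i < 2 * N - Suc j" using Suc.prems by (auto simp: i_def)
    have exp: "(h - d) ^ 2 - G = (h ^ 2 - G) - (d * h + d * h) + d ^ 2"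
      by (simp add: power2_eq_square algebra_simps)
    have "Polynomial.coeff ((h - d) ^ 2 - G) k = 0" if k: "k \<ge> 2 * N - Suc j" for k
    proof -
      have dh: "Polynomial.coeff (d * h) k = e / (2 * b) * Polynomial.coeff h (k - i)"
        using k iN by (simp add: d_def coeff_monom_mult)
      have dd: "Polynomial.coeff (d ^ 2) k = 0"
        using k iN by (simp add: d_def monom_power)
      show ?thesis
      proof (cases "k = 2 * N - Suc j")
        case True
        hence "k - i = N" using iN by simp
        hence "2 * Polynomial.coeff (d * h) k = e" using two b h(2) by (simp add: dh)
        hence "Polynomial.coeff (d * h) k + Polynomial.coeff (d * h) k = e" by (simp only: mult_2)
        moreover have "Polynomial.coeff (h ^ 2 - G) k = e" by (simp only: True e_def)
        ultimately show ?thesis unfolding exp coeff_add coeff_diff by (simp only: dd diff_self add_0_right)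
      next
        case False
        hence "k - i > N" using iN k by simp
        hence "Polynomial.coeff (d * h) k = 0" using h(1) by (simp add: dh coeff_eq_0)
        moreover have "Polynomial.coeff (h ^ 2 - G) k = 0" using h(3) k False by auto
        ultimately show ?thesis unfolding exp coeff_add coeff_diff by (simp only: dd) simp
      qed
    qed
    moreover have "Polynomial.degree (h - d) \<le> N"
      using h(1) degree_monom_le[of "e / (2 * b)" i] iN(1) by (intro degree_diff_le) (auto simp: d_def)
    moreover have "Polynomial.coeff (h - d) N = b" using h(2) iN by (simp add: d_def)
    ultimately show ?case by blast
  qed
  from this[of N] obtain h where h: "Polynomial.degree h \<le> N" "Polynomial.coeff h N = b"
      "\<forall>k\<ge>N. Polynomial.coeff (h ^ 2 - G) k = 0" by auto
  have "Polynomial.degree (h ^ 2 - G) < N"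
    by (rule degree_lessI) (use N h(3) in simp_all)
  thus thesis using that h by blast
qed

text \<open>Thue's lemma for polynomials: stop the extended Euclidean algorithm for \<open>N\<close> and \<open>H\<close> half-way.\<close>

lemma thue_poly:
  fixes N H :: "'k::field poly"
  assumes N: "N \<noteq> 0" and m: "m < Polynomial.degree N"
  obtains p q a b where "a * p + b * q = 1" "Polynomial.degree q \<le> m"
    "q * H - p * N = 0 \<or> Polynomial.degree (q * H - p * N) + m < Polynomial.degree N"
proof -
  let ?d = "Polynomial.degree :: 'k poly \<Rightarrow> nat"
  \<comment> \<open>Invariant for consecutive remainders \<open>r'\<close> and \<open>r\<close> with
    their cofactors: the determinant is a unit, and the degrees of cofactors and remainders balance.
    When \<open>r\<close> first is 0 or has degree below that of \<open>N\<close> minus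
    \<open>m\<close>, \<open>r'\<close> still has at least that degree, which bounds
    \<open>q\<close> by \<open>m\<close>; the determinant is the Bezout relation.\<close>
  have *: "\<exists>p q a b. a * p + b * q = 1 \<and> ?d q \<le> m \<and> (q * H - p * N = 0 \<or> ?d (q * H - p * N) + m < ?d N)"
    if "r = q * H - p * N" "r' = q' * H - p' * N" "\<epsilon> * (p * q' - p' * q) = 1"
      "r' \<noteq> 0" "r \<noteq> 0 \<longrightarrow> ?d r < ?d r'" "?d q + ?d r' \<le> ?d N" "?d q' + ?d r' \<le> ?d N" "?d N \<le> ?d r' + m"
    for r r' q q' p p' \<epsilon>
    using that
  proof (induction "?d r'" arbitrary: r r' q q' p p' \<epsilon> rule: less_induct)
    case less
    show ?case
    proof (cases "r = 0 \<or> ?d r + m < ?d N")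
      case True
      have "(\<epsilon> * q') * p + (- \<epsilon> * p') * q = 1" using less.prems(3) by (simp add: algebra_simps)
      moreover have "?d q \<le> m" using less.prems by linarith
      moreover have "q * H - p * N = 0 \<or> ?d (q * H - p * N) + m < ?d N"
        using True unfolding less.prems(1) .
      ultimately show ?thesis by (intro exI conjI)
    next
      case False
      define k where "k = r' div r"
      have r: "r \<noteq> 0" "?d r < ?d r'" using False less.prems(5) by auto
      have kr: "k * r = r' - r' mod r" by (simp add: k_def minus_mod_eq_div_mult)
      have dmod: "r' mod r \<noteq> 0 \<longrightarrow> ?d (r' mod r) < ?d r" using degree_mod_less[OF r(1), of r'] by auto
      have dk: "?d k + ?d r \<le> ?d r'"
      proof (cases "k = 0")
        case False
        have "?d k + ?d r = ?d (k * r)" using False r(1) by (simp add: degree_mult_eq)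
        also have "\<dots> \<le> ?d r'" unfolding kr by (intro degree_diff_le) (use dmod r in force)+
        finally show ?thesis .
      qed (use r in simp)
      show ?thesis
      proof (rule less.hyps)
        show "?d r < ?d r'" by (rule r(2))
        show "r' mod r = (q' - k * q) * H - (p' - k * p) * N"
        proof -
          have "r' mod r = r' - k * r" by (simp add: kr)
          thus ?thesis unfolding less.prems(1,2) by (simp add: algebra_simps)
        qed
        show "r = q * H - p * N" by (rule less.prems(1))
        show "(- \<epsilon>) * ((p' - k * p) * q - p * (q' - k * q)) = 1"
          using less.prems(3) by (simp add: algebra_simps)
        show "r \<noteq> 0" "r' mod r \<noteq> 0 \<longrightarrow> ?d (r' mod r) < ?d r" by (rule r(1), rule dmod)
        have "?d (q' - k * q) \<le> max (?d q') (?d k + ?d q)"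
          using degree_mult_le[of k q] by (intro degree_diff_le) auto
        thus "?d (q' - k * q) + ?d r \<le> ?d N" using less.prems(6,7) dk r(2) by linarith
        show "?d q + ?d r \<le> ?d N" using less.prems(6) r(2) by linarith
        show "?d N \<le> ?d r + m" using False by linarith
      qed
    qed
  qed
  \<comment> \<open>The algorithm starts after the first division, with the remainders
    \<open>N\<close> and \<open>H mod N\<close>.\<close>
  have "H mod N = 1 * H - (H div N) * N" by (simp add: minus_div_mult_eq_mod)
  moreover have "N = 0 * H - (- 1) * N" "1 * ((H div N) * 0 - (- 1) * 1) = (1 :: 'k poly)" by simp_all
  moreover have "H mod N \<noteq> 0 \<longrightarrow> ?d (H mod N) < ?d N" using degree_mod_less[OF N, of H] by auto
  ultimately have "\<exists>p q a b. a * p + b * q = 1 \<and> ?d q \<le> m \<and> (q * H - p * N = 0 \<or> ?d (q * H - p * N) + m < ?d N)"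
    using N by (intro *[of "H mod N" 1 "H div N" N 0 "- 1" 1]) simp_all
  thus thesis using that by blast
qed

text \<open>\<open>h / K\<close> approximates the square root of \<open>G\<close> with error term
  \<open>r\<close>, and \<open>e\<close> is \<open>h * y + K * x\<close> up to normalization. The
  core is that \<open>h * y - K * x\<close> times \<open>h * y + K * x\<close> equals
  \<open>r * y ^ 2 - K ^ 2\<close>. The right side is grouped into factors whose behaviour at
  infinity can be read off one by one.\<close>

lemma approximation_identity:
  fixes u :: "'a::field"
  assumes nz: "u \<noteq> 0" "A \<noteq> 0" "B \<noteq> 0" "y \<noteq> 0" and pell: "x ^ 2 = 1 + G * y ^ 2"
    and K: "K = A * A * u" and s: "s = q * h - p * K" and r: "r = h ^ 2 - K ^ 2 * G"
    and e: "e = h / (B * u * K) + x / (y * (B * u))" "e \<noteq> 0"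
  shows "p * y - q * x
    = q / A * inverse e * (r / (B * K) * (y / (A * u) / u) - A / y / (B * u)) - s / A * (y / (A * u))"
proof -
  have K0: "K \<noteq> 0" using nz by (simp add: K)
  define F where "F = h * y + x * K"
  define E where "E = h * y - K * x"
  have eF: "e = F / (y * B * u * K)" using nz K0 by (simp add: e(1) F_def field_simps)
  hence F0: "F \<noteq> 0" using e(2) by auto
  have "E * F = h ^ 2 * y ^ 2 - K ^ 2 * x ^ 2"
    by (simp add: E_def F_def power2_eq_square algebra_simps)
  also have "\<dots> = r * y ^ 2 - K ^ 2" unfolding pell r by (simp add: algebra_simps)
  finally have EF: "r * y ^ 2 - K ^ 2 = E * F" by simp
  have "q / A * inverse e * (r / (B * K) * (y / (A * u) / u) - A / y / (B * u))
      = q / (K * F) * (r * y ^ 2 - K * (A * A * u))"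
    using nz K0 F0 by (simp add: eF field_simps power2_eq_square) (simp add: K algebra_simps)
  also have "K * (A * A * u) = K ^ 2" by (simp only: K[symmetric] power2_eq_square)
  also have "q / (K * F) * (r * y ^ 2 - K ^ 2) = q * E / K" unfolding EF using F0 by simp
  finally have 1: "q / A * inverse e * (r / (B * K) * (y / (A * u) / u) - A / y / (B * u)) = q * E / K" .
  have 2: "s / A * (y / (A * u)) = s * y / K" by (simp add: K mult.assoc)
  have "q * E - s * y = K * (p * y - q * x)" by (simp add: s E_def algebra_simps)
  thus ?thesis unfolding 1 2 using K0 by (simp add: diff_divide_distrib[symmetric])
qed

text \<open>The equation is monic of degree 2 in \<open>x\<close>, so a further factor
  \<open>x\<close> is absorbed by replacing \<open>x ^ 2\<close> with \<open>Y\<close>, which stands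
  for 1 + g y^2.\<close>

lemma reduce_mod_pell:
  "\<exists>\<alpha> \<beta> s. p = [:\<alpha>:] + [:\<beta>:] * var_x + s * pell_poly g"
proof (induction p)
  case 0
  show ?case by (rule exI[of _ 0], rule exI[of _ 0], rule exI[of _ 0]) simp
next
  case (pCons a p)
  then obtain \<alpha> \<beta> s where p: "p = [:\<alpha>:] + [:\<beta>:] * var_x + s * pell_poly g" by blast
  define Y :: "'a poly poly" where "Y = 1 + [:g:] * [:0, 1:] ^ 2"
  have Y: "var_x ^ 2 = pell_poly g + [:Y:]"
    by (simp add: pell_poly_def Y_def poly_in_u_def var_y_def power2_eq_square one_pCons)
  have "pCons a p = [:a:] + var_x * p" by (simp add: var_x_def)
  also have "\<dots> = [:a:] + [:\<alpha>:] * var_x + [:\<beta>:] * var_x ^ 2 + (var_x * s) * pell_poly g"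
    unfolding p by (simp add: power2_eq_square algebra_simps del: mult_pCons_left mult_pCons_right)
  also have "\<dots> = [:a + \<beta> * Y:] + [:\<alpha>:] * var_x + (var_x * s + [:\<beta>:]) * pell_poly g"
  proof -
    have "[:a + \<beta> * Y:] = [:a:] + [:\<beta>:] * [:Y:]" by simp
    thus ?thesis unfolding Y by (simp only: distrib_left distrib_right ac_simps)
  qed
  finally show ?case by blast
qed

section \<open>Curves on Pell surfaces\<close>

lemma rhom_poly_eq_ev:
  assumes "rhom f"
  shows "f p = ev (\<lambda>a. f [:a:]) (f [:0, 1:]) p"
proof (induction p)
  case 0
  show ?case by (simp add: ev_0 rhom_zero[OF assms])
next
  case (pCons a p)
  have "f (pCons a p) = f ([:a:] + [:0, 1:] * p)" by simp
  also have "\<dots> = f [:a:] + f [:0, 1:] * f p" by (simp only: rhom_add[OF assms] rhom_mult[OF assms])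
  finally show ?case using pCons.IH by (simp add: ev_pCons rhom_zero[OF assms])
qed

lemma rhom_const_poly: "rhom f \<Longrightarrow> rhom (\<lambda>a. f [:a:])"
  by (rule rhom_comp[of "\<lambda>a. [:a:]"]) (simp_all add: rhom_def one_pCons)

lemma ev_closed:
  assumes "\<And>a. f a \<in> S" "z \<in> S" "\<And>a b. a \<in> S \<Longrightarrow> b \<in> S \<Longrightarrow> a + b \<in> S"
    "\<And>a b. a \<in> S \<Longrightarrow> b \<in> S \<Longrightarrow> a * b \<in> S" and f: "rhom f"
  shows "ev f z p \<in> S"
proof (induction p)
  case 0
  show ?case using assms(1)[of 0] by (simp add: ev_0 rhom_zero[OF f])
next
  case (pCons a p)
  thus ?case unfolding ev_pCons[of f, OF rhom_zero[OF f]] by (intro assms(1-4))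
qed

lemma range_add: "rhom f \<Longrightarrow> a \<in> range f \<Longrightarrow> b \<in> range f \<Longrightarrow> a + b \<in> range f"
proof (elim rangeE)
  fix p q assume f: "rhom f" and "a = f p" "b = f q"
  thus "a + b \<in> range f" using rhom_add[OF f, of p q] by (intro range_eqI[of _ _ "p + q"]) simp
qed

lemma range_mult: "rhom f \<Longrightarrow> a \<in> range f \<Longrightarrow> b \<in> range f \<Longrightarrow> a * b \<in> range f"
proof (elim rangeE)
  fix p q assume f: "rhom f" and "a = f p" "b = f q"
  thus "a * b \<in> range f" using rhom_mult[OF f, of p q] by (intro range_eqI[of _ _ "p * q"]) simp
qed

lemma kernel_primeideal:
  fixes f :: "'a::comm_ring_1 \<Rightarrow> 'b::idom"
  assumes f: "rhom f"
  shows "primeideal {p. f p = 0} ring_of_type_algebra"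
proof -
  interpret R: cring "ring_of_type_algebra :: 'a ring" by (rule cring_from_type_algebra)
  have hom: "ring_hom_ring (ring_of_type_algebra :: 'a ring) (ring_of_type_algebra :: 'b ring) f"
    by (rule ring_hom_ringI2[OF ring_from_type_algebra ring_from_type_algebra])
      (simp add: ring_hom_def ring_of_type_algebra_def rhom_simps[OF f])
  have I: "ideal {p. f p = 0} (ring_of_type_algebra :: 'a ring)"
    using ring_hom_ring.kernel_is_ideal[OF hom] by (simp add: a_kernel_def' ring_of_type_algebra_def)
  show ?thesis
  proof (rule primeidealI[OF I R.cring_axioms])
    have "(1 :: 'a) \<notin> {p. f p = 0}" by (simp add: rhom_one[OF f])
    moreover have "carrier (ring_of_type_algebra :: 'a ring) = UNIV" by (simp add: ring_of_type_algebra_def)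
    ultimately show "carrier ring_of_type_algebra \<noteq> {p. f p = 0}" by blast
    fix a b :: 'a
    assume "a \<otimes>\<^bsub>ring_of_type_algebra\<^esub> b \<in> {p. f p = 0}"
    thus "a \<in> {p. f p = 0} \<or> b \<in> {p. f p = 0}" by (simp add: ring_of_type_algebra_def rhom_mult[OF f])
  qed
qed

text \<open>\<open>S\<close> is closed under polynomial expressions over k. A relation for
  \<open>z\<close> with nonzero constant term can be solved for \<open>inverse z\<close>; the
  induction strips factors \<open>z\<close> from the relation until this applies.\<close>

lemma (in field_extension) inverse_closed:
  assumes "algebraic z" "z \<noteq> 0" "z \<in> S" "\<And>a. \<iota> a \<in> S" "\<And>a b. a \<in> S \<Longrightarrow> b \<in> S \<Longrightarrow> a + b \<in> S"
    "\<And>a b. a \<in> S \<Longrightarrow> b \<in> S \<Longrightarrow> a * b \<in> S"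
  shows "inverse z \<in> S"
proof -
  obtain f where "f \<noteq> 0" "ev \<iota> z f = 0" using assms(1) unfolding algebraic_def by blast
  thus ?thesis
  proof (induction f)
    case (pCons a f)
    have e: "\<iota> a + z * ev \<iota> z f = 0" using pCons.prems(2) by (simp add: ev_pCons rhom_zero[OF \<iota>])
    show ?case
    proof (cases "a = 0")
      case True
      hence "ev \<iota> z f = 0" "f \<noteq> 0" using e assms(2) pCons.prems(1) by (simp_all add: rhom_zero[OF \<iota>])
      thus ?thesis by (intro pCons.IH)
    next
      case False
      hence "\<iota> a \<noteq> 0" by (simp add: rhom_eq_0_iff[OF \<iota>])
      moreover have "\<iota> a = - (z * ev \<iota> z f)" using e by (simp add: eq_neg_iff_add_eq_0)
      ultimately have "inverse z = - inverse (\<iota> a) * ev \<iota> z f"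
        using assms(2) by (simp add: field_simps)
      also have "- inverse (\<iota> a) = \<iota> (- inverse a)" by (simp add: rhom_minus[OF \<iota>] rhom_inverse[OF \<iota>])
      finally show ?thesis using ev_closed[OF assms(4,3,5,6) \<iota>] assms(4,6) by simp
    qed
  qed simp
qed

section \<open>Coordinates and generators on a Pell curve\<close>

locale pell_curve = one_place_curve D \<phi>
  for D :: "'k::field poly3 set" and \<phi> :: "'k poly3 \<Rightarrow> 'F::field" +
  fixes g :: "'k poly"
  assumes char: "CHAR('k) \<noteq> 2" and g_nonzero: "g \<noteq> 0" and g_even: "even (Polynomial.degree g)"
    and curve: "curve_on_pell_surface g D"
begin

definition "x = \<phi> var_x"
definition "y = \<phi> var_y"
definition "u = \<phi> (poly_in_u [:0, 1:])"

lemma two: "(2::'k) \<noteq> 0"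
proof
  assume 2: "(2::'k) = 0"
  have "of_nat 2 = (2::'k)" by (rule of_nat_numeral)
  hence "CHAR('k) dvd 2" unfolding of_nat_eq_0_iff_char_dvd[symmetric] 2 .
  hence "CHAR('k) = 1 \<or> CHAR('k) = 2"
    using two_is_prime_nat unfolding prime_nat_iff by blast
  thus False using char CHAR_not_1[where 'a = 'k] by simp
qed

lemma \<iota>_two: "\<iota> 2 = 2"
  using rhom_add[OF \<iota>, of 1 1] by (simp add: rhom_one[OF \<iota>])

lemma two_F: "(2::'F) \<noteq> 0"
  using two rhom_eq_0_iff[OF \<iota>, of 2] by (simp add: \<iota>_two)

lemma two_ac: "(2::'k alg_closure) \<noteq> 0"
  using two to_ac_eq_0_iff[of "2::'k"] by simp

lemma \<phi>_u: "\<phi> [:[:f:]:] = ev \<iota> u f"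
  using rhom_poly_eq_ev[OF rhom_const_poly[OF rhom_const_poly[OF rhom_\<phi>]], of f]
  by (simp add: \<iota>_def[abs_def] const3_def u_def poly_in_u_def)

lemma \<phi>_yu: "\<phi> [:A:] = ev (ev \<iota> u) y A"
  using rhom_poly_eq_ev[OF rhom_const_poly[OF rhom_\<phi>], of A]
  by (simp add: \<phi>_u y_def var_y_def)

lemma \<phi>_eq: "\<phi> p = ev (ev (ev \<iota> u) y) x p"
  using rhom_poly_eq_ev[OF rhom_\<phi>, of p] by (simp add: \<phi>_yu x_def var_x_def)

lemma rhom_u: "rhom (ev \<iota> u)"
  by (rule rhom_ev[OF \<iota>])

definition "G = ev \<iota> u g"

lemma pell: "x ^ 2 = 1 + G * y ^ 2"
proof -
  have "pell_poly g \<in> D" using curve by (simp add: curve_on_pell_surface_def)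
  hence "\<phi> (pell_poly g) = 0" by (simp add: D_eq)
  hence "x ^ 2 - G * y ^ 2 - 1 = 0"
    unfolding pell_poly_def poly_in_u_def by (simp only: rhom_simps[OF rhom_\<phi>] \<phi>_u G_def x_def y_def)
  thus ?thesis by (simp add: algebra_simps)
qed

lemma in_range: "x \<in> range \<phi>" "y \<in> range \<phi>" "u \<in> range \<phi>" "\<iota> k \<in> range \<phi>" "ev \<iota> u f \<in> range \<phi>"
proof -
  show "ev \<iota> u f \<in> range \<phi>" unfolding \<phi>_u[symmetric] by (rule rangeI)
qed (unfold x_def y_def u_def \<iota>_def, (rule rangeI)+)

lemma range_subset:
  assumes "\<And>a. \<iota> a \<in> S" "x \<in> S" "y \<in> S" "u \<in> S" "\<And>a b. a \<in> S \<Longrightarrow> b \<in> S \<Longrightarrow> a + b \<in> S"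
    "\<And>a b. a \<in> S \<Longrightarrow> b \<in> S \<Longrightarrow> a * b \<in> S"
  shows "range \<phi> \<subseteq> S"
proof -
  have "ev \<iota> u f \<in> S" for f by (rule ev_closed[OF assms(1,4,5,6) \<iota>])
  hence "ev (ev \<iota> u) y A \<in> S" for A by (rule ev_closed[OF _ assms(3,5,6) rhom_u])
  hence "ev (ev (ev \<iota> u) y) x p \<in> S" for p by (rule ev_closed[OF _ assms(2,5,6) rhom_ev[OF rhom_u]])
  hence "\<phi> p \<in> S" for p by (subst \<phi>_eq[of p])
  thus ?thesis by blast
qed

lemma affine_line_if:
  assumes "algebraic c" "\<not> algebraic t" "c \<in> range \<phi>" "t \<in> range \<phi>"
    "x \<in> range (ev (ev \<iota> c) t)" "y \<in> range (ev (ev \<iota> c) t)" "u \<in> range (ev (ev \<iota> c) t)"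
  shows "affine_line D"
proof (rule affine_line_if_generated[OF assms(1,2)], rule equalityI)
  have r: "rhom (ev (ev \<iota> c) t)" by (intro rhom_ev \<iota>)
  have "\<iota> a \<in> range (ev (ev \<iota> c) t)" for a
    by (rule range_eqI[of _ _ "[:[:a:]:]"]) (simp add: ev_const ev_0 rhom_zero[OF \<iota>])
  thus "range \<phi> \<subseteq> range (ev (ev \<iota> c) t)"
    by (rule range_subset[OF _ assms(5-7) range_add[OF r] range_mult[OF r]])
  have "ev \<iota> c f \<in> range \<phi>" for f
    by (rule ev_closed[OF in_range(4) assms(3) range_add[OF rhom_\<phi>] range_mult[OF rhom_\<phi>] \<iota>])
  hence "ev (ev \<iota> c) t A \<in> range \<phi>" for A
    by (rule ev_closed[OF _ assms(4) range_add[OF rhom_\<phi>] range_mult[OF rhom_\<phi>] rhom_ev[OF \<iota>]])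
  thus "range (ev (ev \<iota> c) t) \<subseteq> range \<phi>" by blast
qed

lemma generated_members:
  "c \<in> range (ev (ev \<iota> c) t)" "t \<in> range (ev (ev \<iota> c) t)" "\<iota> a \<in> range (ev (ev \<iota> c) t)"
  "ev \<iota> c f \<in> range (ev (ev \<iota> c) t)"
proof -
  note r = rhom_ev[OF \<iota>, of c]
  have e: "c = ev (ev \<iota> c) t [:[:0, 1:]:]" "t = ev (ev \<iota> c) t [:0, 1:]"
    "\<iota> a = ev (ev \<iota> c) t [:[:a:]:]" "ev \<iota> c f = ev (ev \<iota> c) t [:f:]"
    by (simp_all add: ev_const ev_0 rhom_zero[OF \<iota>] ev_X[OF r] ev_X[OF \<iota>])
  show "c \<in> range (ev (ev \<iota> c) t)" by (rule range_eqI) (rule e(1))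
  show "t \<in> range (ev (ev \<iota> c) t)" by (rule range_eqI) (rule e(2))
  show "\<iota> a \<in> range (ev (ev \<iota> c) t)" by (rule range_eqI) (rule e(3))
  show "ev \<iota> c f \<in> range (ev (ev \<iota> c) t)" by (rule range_eqI) (rule e(4))
qed

text \<open>Otherwise every regular function would be algebraic and so without pole at
  infinity.\<close>

lemma not_all_algebraic:
  assumes "algebraic x" "algebraic y" "algebraic u"
  shows False
proof -
  have "range \<phi> \<subseteq> Collect algebraic"
    by (rule range_subset) (simp_all add: assms algebraic_const algebraic_add algebraic_mult)
  hence "\<phi> p \<in> V\<^sub>0" for p using algebraic_in_place[OF _ kplace_0] by blast
  thus False using pole_at_infinity by blast
qed

lemma x_sq_eq_1: "x ^ 2 = 1 \<Longrightarrow> x = \<iota> 1 \<or> x = \<iota> (- 1)"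
  by (simp add: power2_eq_1_iff rhom_one[OF \<iota>] rhom_minus[OF \<iota>])

text \<open>
  The conic \<open>x\<^sup>2 - G y\<^sup>2 = 1\<close> is parametrized by \<open>s = y / (x + 1)\<close>, the slope from its point \<open>(-1, 0)\<close>.
\<close>

lemma conic_parameter:
  assumes "x + 1 \<noteq> 0"
  defines "s \<equiv> y / (x + 1)"
  shows "x * (1 - G * s ^ 2) = 1 + G * s ^ 2" "y = s * (x + 1)" "1 - G * s ^ 2 \<noteq> 0"
proof -
  show y: "y = s * (x + 1)" using assms(1) by (simp add: s_def)
  have "(x + 1) * (x - 1) = x ^ 2 - 1" by (simp add: algebra_simps power2_eq_square)
  also have "\<dots> = G * (s * (x + 1)) ^ 2" by (simp add: pell y[symmetric])
  also have "\<dots> = (x + 1) * (G * s ^ 2 * (x + 1))" by (simp add: power2_eq_square algebra_simps)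
  finally have "x - 1 = G * s ^ 2 * (x + 1)" using assms(1) by simp
  thus 1: "x * (1 - G * s ^ 2) = 1 + G * s ^ 2" by (simp add: algebra_simps)
  show "1 - G * s ^ 2 \<noteq> 0"
  proof
    assume *: "1 - G * s ^ 2 = 0"
    hence "1 + G * s ^ 2 = 0" using 1 by simp
    moreover have "1 + G * s ^ 2 = 2 - (1 - G * s ^ 2)" by simp
    ultimately show False using * two_F by simp
  qed
qed

text \<open>If \<open>G = 0\<close>, then \<open>x\<close> is 1 or -1 and \<open>y\<close> serves as
  coordinate. If \<open>G\<close> is nonzero, the conic has two points at infinity, where the slope
  takes opposite values, against uniqueness.\<close>

lemma affine_line_vertical:
  assumes u: "algebraic u"
  shows "affine_line D"
proof (cases "G = 0")
  case True
  hence x: "x = \<iota> 1 \<or> x = \<iota> (- 1)" using pell by (intro x_sq_eq_1) simp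
  hence ax: "algebraic x" using algebraic_const by auto
  have ny: "\<not> algebraic y" using not_all_algebraic ax u by blast
  show ?thesis
    by (rule affine_line_if[OF u ny in_range(3,2)]) (use x generated_members[where c = u and t = y] in auto)
next
  case False
  have aG: "algebraic G" unfolding G_def by (rule algebraic_ev[OF u])
  have x1: "x + 1 \<noteq> 0"
  proof
    assume "x + 1 = 0"
    hence x: "x = \<iota> (- 1)" by (simp add: rhom_minus[OF \<iota>] rhom_one[OF \<iota>] eq_neg_iff_add_eq_0)
    hence "G * y ^ 2 = 0" using pell by (simp add: rhom_minus[OF \<iota>] rhom_one[OF \<iota>])
    hence "y = 0" using False by simp
    hence "algebraic y" by (simp add: algebraic_0)
    moreover have "algebraic x" unfolding x by (rule algebraic_const)
    ultimately show False using not_all_algebraic u by blast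
  qed
  define s where "s = y / (x + 1)"
  note s = conic_parameter[OF x1, folded s_def]
  have ns: "\<not> algebraic s"
  proof
    assume as: "algebraic s"
    have "x = (1 + G * s ^ 2) / (1 - G * s ^ 2)" using s(1,3) by (simp add: eq_divide_eq)
    moreover have "algebraic ((1 + G * s ^ 2) / (1 - G * s ^ 2))"
      by (intro algebraic_divide algebraic_add algebraic_diff algebraic_mult algebraic_power algebraic_1 aG as)
    ultimately have ax: "algebraic x" by (simp only:)
    have "algebraic (s * (x + 1))" by (intro algebraic_mult algebraic_add algebraic_1 as ax)
    hence "algebraic y" by (simp only: s(2)[symmetric])
    thus False using not_all_algebraic ax u by blast
  qed
  define G0 where "G0 = ev to_ac (\<theta>\<^sub>0 u) g"
  have "\<theta>\<^sub>0 G = G0" unfolding G_def G0_def by (rule kplace_ev(2)[OF kplace_0 algebraic_in_place[OF u kplace_0]])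
  hence G0: "G0 \<noteq> 0" using kplace_algebraic_nonzero[OF kplace_0 aG False] by simp
  text \<open>Both roots of \<open>G\<^sub>0 \<tau>\<^sup>2 = 1\<close> are values of \<open>s\<close> at places where \<open>x\<close> has a pole.\<close>
  have at_pole: "\<theta>\<^sub>0 s = \<tau>" if \<tau>: "G0 * \<tau> ^ 2 = 1" for \<tau>
  proof -
    obtain V \<theta> where V: "kplace V \<theta>" "u \<in> V" "s \<in> V" "\<theta> u = \<theta>\<^sub>0 u" "\<theta> s = \<tau>"
      using place_with_values[OF u ns kplace_root[OF kplace_0 u]] by blast
    interpret place V \<theta> by (rule kplace_place[OF V(1)])
    have GV: "G \<in> V" "\<theta> G = G0"
      unfolding G_def G0_def using kplace_ev[OF V(1,2)] V(4) by simp_all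
    have P: "G * s ^ 2 \<in> V" "\<theta> (G * s ^ 2) = 1"
      using GV V(3,5) \<tau> by (simp_all add: mult power \<theta>_mult \<theta>_power)
    \<comment> \<open>At such a place \<open>1 - G * s ^ 2\<close> has value 0 but
      \<open>1 + G * s ^ 2\<close> has value 2, so the parametrization gives \<open>x\<close> a
      pole.\<close>
    have "x \<notin> V"
    proof
      assume xV: "x \<in> V"
      have "\<theta> (x * (1 - G * s ^ 2)) = \<theta> x * (1 - 1)"
        by (simp only: \<theta>_mult[OF xV diff[OF one P(1)]] \<theta>_diff[OF one P(1)] \<theta>_one P(2))
      moreover have "\<theta> (1 + G * s ^ 2) = 2" by (simp add: \<theta>_add[OF one P(1)] \<theta>_one P(2))
      ultimately show False using s(1) two_ac by simp
    qed
    hence "\<phi> var_x \<notin> V" unfolding x_def .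
    from place_unique(2)[OF V(1) this V(3)] show ?thesis using V(5) by simp
  qed
  have "Polynomial.degree [:- inverse G0, 0, 1:] \<noteq> 0" by simp
  then obtain \<tau> where "poly [:- inverse G0, 0, 1:] \<tau> = 0"
    using alg_closed_imp_poly_has_root[of "[:- inverse G0, 0, 1:]"] by auto
  hence "\<tau> ^ 2 = inverse G0" by (simp add: power2_eq_square)
  hence \<tau>: "G0 * \<tau> ^ 2 = 1" using G0 by simp
  have v: "\<theta>\<^sub>0 s = \<tau>" "\<theta>\<^sub>0 s = - \<tau>" by (rule at_pole, simp add: \<tau>)+
  have "- \<tau> = \<tau>" by (rule trans[OF v(2)[symmetric] v(1)])
  hence "\<tau> + \<tau> = - \<tau> + \<tau>" by (simp only:)
  hence "2 * \<tau> = 0" by (simp only: mult_2 add.left_inverse)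
  hence "\<tau> = 0" using two_ac by simp
  thus ?thesis using \<tau> by simp
qed

text \<open>For \<open>z\<close> the value of \<open>f\<close> at \<open>u\<close>, the polynomial
  f(U) - z is a relation for \<open>u\<close> over k[z]. As \<open>z\<close> is algebraic and
  \<open>u\<close> is not, all its coefficients vanish.\<close>

lemma algebraic_polynomial_const:
  assumes nu: "\<not> algebraic u" and a: "algebraic (ev \<iota> u f)"
  shows "Polynomial.degree f = 0"
proof (rule ccontr)
  assume d: "Polynomial.degree f \<noteq> 0"
  define z where "z = ev \<iota> u f"
  define A where "A = map_poly (\<lambda>a. [:a:]) f - [:[:0, 1:]:]"
  have e: "ev (ev \<iota> z) u (map_poly (\<lambda>a. [:a:]) h) = ev \<iota> u h" for h
    by (induction h) (simp_all add: map_poly_pCons ev_pCons ev_0 rhom_zero[OF \<iota>] ev_const)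
  have "ev (ev \<iota> z) u A = 0"
    unfolding A_def by (simp add: rhom_diff[OF rhom_ev[OF rhom_ev[OF \<iota>]]] e ev_const ev_0 ev_X[OF \<iota>])
      (simp add: z_def)
  hence "ev \<iota> z (Polynomial.coeff A (Polynomial.degree f)) = 0"
    using ev_ev_eq_0[of z u A] nu a by (simp add: z_def)
  \<comment> \<open>Subtracting \<open>z\<close> changes only the constant coefficient, and the
    degree of \<open>f\<close> is positive.\<close>
  moreover have "Polynomial.coeff A (Polynomial.degree f) = [:Polynomial.lead_coeff f:]"
    using d by (simp add: A_def coeff_map_poly coeff_pCons split: nat.splits)
  ultimately have "Polynomial.lead_coeff f = 0"
    by (simp add: ev_const rhom_zero[OF \<iota>] rhom_eq_0_iff[OF \<iota>])
  thus False using d by (simp add: leading_coeff_0_iff)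
qed

lemma ev_u_eq_0_iff: "\<not> algebraic u \<Longrightarrow> ev \<iota> u f = 0 \<longleftrightarrow> f = 0"
  using ev_0[of \<iota> u] unfolding algebraic_def by blast

text \<open>Here \<open>x\<close> is algebraic. Either \<open>x\<close> is 1 or -1 and
  \<open>y = 0\<close>, so that \<open>u\<close> is a coordinate, or \<open>G * y ^ 2\<close> is
  algebraic and nonzero, which forces \<open>g\<close> to be constant and \<open>y\<close> to be
  algebraic. In the latter case the slope \<open>s\<close> and \<open>u\<close> generate the
  coordinate ring.\<close>

lemma affine_line_horizontal:
  assumes nu: "\<not> algebraic u" and xV: "x \<in> V\<^sub>0"
  shows "affine_line D"
proof -
  have ax: "algebraic x" using regular_at_infinity_imp_algebraic[of var_x] xV by (simp add: x_def)
  have G0: "G \<noteq> 0" using ev_u_eq_0_iff[OF nu] g_nonzero by (simp add: G_def)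
  have c0: "G * y ^ 2 = x ^ 2 - 1" using pell by simp
  show ?thesis
  proof (cases "x ^ 2 = 1")
    case True
    hence y: "y = 0" using c0 G0 by simp
    have x: "x = \<iota> 1 \<or> x = \<iota> (- 1)" by (rule x_sq_eq_1[OF True])
    have "(0::'F) = \<iota> 0" by (simp add: rhom_zero[OF \<iota>])
    hence 0: "0 \<in> range \<phi>" using in_range(4)[of 0] by simp
    show ?thesis
    proof (rule affine_line_if[OF algebraic_0 nu 0 in_range(3)])
      note m = generated_members[where c = 0 and t = u]
      show "x \<in> range (ev (ev \<iota> 0) u)" using x m(3)[of 1] m(3)[of "- 1"] by metis
      show "y \<in> range (ev (ev \<iota> 0) u)" unfolding y by (rule m(1))
      show "u \<in> range (ev (ev \<iota> 0) u)" by (rule m(2))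
    qed
  next
    case False
    have y0: "y \<noteq> 0" using c0 False by auto
    have ac: "algebraic (x ^ 2 - 1)" by (intro algebraic_diff algebraic_power algebraic_1 ax)
    have G: "G = (x ^ 2 - 1) * inverse y ^ 2"
      using y0 by (simp add: c0[symmetric] power_inverse)
    \<comment> \<open>Either \<open>y\<close> is regular at infinity and so algebraic, or
      \<open>inverse y\<close> is regular there and with it \<open>G\<close>.\<close>
    have aG: "algebraic G"
    proof (cases "y \<in> V\<^sub>0")
      case True
      hence "algebraic y" using regular_at_infinity_imp_algebraic[of var_y] by (simp add: y_def)
      thus ?thesis unfolding G by (intro algebraic_mult algebraic_power algebraic_inverse ac)
    next
      case False
      hence "inverse y \<in> V\<^sub>0" using P\<^sub>0.total by blast
      hence "G \<in> V\<^sub>0" unfolding G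
        by (intro P\<^sub>0.mult P\<^sub>0.power algebraic_in_place[OF ac kplace_0])
      thus ?thesis using regular_at_infinity_imp_algebraic[of "[:[:g:]:]"] by (simp add: \<phi>_u G_def)
    qed
    obtain a where a: "g = [:a:]"
      using algebraic_polynomial_const[OF nu aG[unfolded G_def]] degree_eq_zeroE by blast
    have "ev \<iota> u g = \<iota> a" unfolding a by (rule ev_const[of \<iota>, OF rhom_zero[OF \<iota>]])
    hence Ga: "G = \<iota> a" by (simp only: G_def)
    \<comment> \<open>A pole of \<open>y\<close> would make \<open>G\<close> vanish at infinity,
      which a nonzero algebraic element cannot do.\<close>
    have ay: "algebraic y"
    proof (rule ccontr)
      assume "\<not> algebraic y"
      hence "y \<notin> V\<^sub>0" using regular_at_infinity_imp_algebraic[of var_y] by (auto simp: y_def)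
      note iy = P\<^sub>0.pole[OF this]
      have "\<theta>\<^sub>0 ((x ^ 2 - 1) * inverse y ^ 2) = 0"
        using iy algebraic_in_place[OF ac kplace_0] by (simp add: P\<^sub>0.\<theta>_mult P\<^sub>0.\<theta>_power P\<^sub>0.power)
      thus False using kplace_algebraic_nonzero[OF kplace_0 aG G0] unfolding G by blast
    qed
    have x1: "x + 1 \<noteq> 0"
    proof
      assume "x + 1 = 0"
      hence "x = - 1" by (simp add: eq_neg_iff_add_eq_0)
      thus False using False by simp
    qed
    define s where "s = y / (x + 1)"
    note s = conic_parameter[OF x1, folded s_def]
    have as: "algebraic s" unfolding s_def by (intro algebraic_divide algebraic_add algebraic_1 ax ay)
    have one: "1 = \<iota> 1" by (simp add: rhom_one[OF \<iota>])
    \<comment> \<open>The inverse of a nonzero algebraic element is a polynomial in it, so the slope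
      is a regular function.\<close>
    have "inverse (x + 1) \<in> range \<phi>"
    proof (rule inverse_closed[OF algebraic_add[OF ax algebraic_1] x1])
      show "x + 1 \<in> range \<phi>" by (subst one) (intro range_add[OF rhom_\<phi>] in_range)
    qed (rule in_range(4), erule (1) range_add[OF rhom_\<phi>], erule (1) range_mult[OF rhom_\<phi>])
    hence sr: "s \<in> range \<phi>"
      unfolding s_def field_class.field_divide_inverse by (intro range_mult[OF rhom_\<phi>] in_range)
    let ?R = "range (ev (ev \<iota> s) u)"
    note m = generated_members[where c = s and t = u]
    have r: "rhom (ev (ev \<iota> s) u)" by (intro rhom_ev \<iota>)
    note R = range_add[OF r] range_mult[OF r]
    have neg: "- \<iota> a = \<iota> (- a)" by (simp add: rhom_minus[OF \<iota>])
    have sq: "G * s ^ 2 \<in> ?R" unfolding Ga power2_eq_square by (intro R m)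
    have "- \<iota> a * s ^ 2 \<in> ?R" unfolding neg power2_eq_square by (intro R m)
    hence "\<iota> 1 + - \<iota> a * s ^ 2 \<in> ?R" by (rule R(1)[OF m(3)])
    hence d: "1 - G * s ^ 2 \<in> ?R" by (simp add: Ga rhom_one[OF \<iota>])
    have "inverse (1 - G * s ^ 2) \<in> ?R"
      by (rule inverse_closed[OF _ s(3) d m(3) R])
        (intro algebraic_diff algebraic_mult algebraic_power algebraic_1 as aG)
    hence "(\<iota> 1 + G * s ^ 2) * inverse (1 - G * s ^ 2) \<in> ?R" by (intro R m(3) sq)
    moreover have "x = (\<iota> 1 + G * s ^ 2) * inverse (1 - G * s ^ 2)"
      using s(1,3) by (simp add: rhom_one[OF \<iota>] eq_divide_eq flip: field_class.field_divide_inverse)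
    ultimately have xR: "x \<in> ?R" by (simp only:)
    have "s * (x + \<iota> 1) \<in> ?R" by (intro R m(1,3) xR)
    hence yR: "y \<in> ?R" using s(2) by (simp only: one[symmetric])
    show ?thesis by (rule affine_line_if[OF as nu sr in_range(3) xR yR m(2)])
  qed
qed

text \<open>
  If \<open>y\<close> and \<open>u\<close> were independent, \<open>D\<close> would be strictly contained in one of the prime ideals
  \<open>(y, x - 1)\<close> and \<open>(y, x + 1)\<close>, which are not maximal.
\<close>

lemma algebraic_dependence: "\<exists>A. A \<noteq> 0 \<and> \<phi> [:A:] = 0"
proof (rule ccontr)
  assume "\<not> ?thesis"
  hence indep: "A = 0" if "\<phi> [:A:] = 0" for A using that by blast
  \<comment> \<open>Evaluation at \<open>x = e\<close>, \<open>y = 0\<close>; for \<open>e\<close>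
    equal to 1 or -1 the kernel is the ideal of a line on the surface.\<close>
  define \<eta> :: "'k \<Rightarrow> 'k poly3 \<Rightarrow> 'k poly" where "\<eta> e p = poly (poly p [:[:e:]:]) 0" for e p
  have \<eta>: "rhom (\<eta> e)" for e by (simp add: rhom_def \<eta>_def)
  have ideal: "\<not> D \<subseteq> {p. \<eta> e p = 0}" for e
  proof
    assume sub: "D \<subseteq> {p. \<eta> e p = 0}"
    have "var_y \<in> {p. \<eta> e p = 0}" by (simp add: var_y_def \<eta>_def)
    moreover have "var_y \<notin> D"
      using indep[of "[:0, 1:]"] by (auto simp: D_eq var_y_def)
    ultimately have "D \<subset> {p. \<eta> e p = 0}" using sub by blast
    moreover have "primeideal {p. \<eta> e p = 0} ring_of_type_algebra" by (rule kernel_primeideal[OF \<eta>])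
    ultimately have max: "maximalideal {p. \<eta> e p = 0} ring_of_type_algebra"
      using curve unfolding curve_on_pell_surface_def integral_curve_def by blast
    \<comment> \<open>Adding \<open>u\<close> to the kernel gives a larger proper ideal, so the
      kernel is not maximal.\<close>
    define J where "J = {p. Polynomial.coeff (\<eta> e p) 0 = 0}"
    have "rhom (\<lambda>p. Polynomial.coeff (\<eta> e p) 0)" by (rule rhom_comp[OF \<eta> rhom_coeff_0])
    hence "ideal J ring_of_type_algebra" unfolding J_def
      using kernel_primeideal primeideal.axioms(1) by blast
    moreover have "{p. \<eta> e p = 0} \<subseteq> J" by (auto simp: J_def)
    moreover have "J \<subseteq> carrier ring_of_type_algebra" by (simp add: ring_of_type_algebra_def)
    ultimately have "J = {p. \<eta> e p = 0} \<or> J = carrier ring_of_type_algebra"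
      by (rule maximalideal.I_maximal[OF max])
    moreover have "1 \<notin> J" by (simp add: J_def rhom_one[OF \<eta>])
    hence "J \<noteq> carrier ring_of_type_algebra" by (auto simp: ring_of_type_algebra_def)
    moreover have "poly_in_u [:0, 1:] \<in> J" "poly_in_u [:0, 1:] \<notin> {p. \<eta> e p = 0}"
      by (simp_all add: J_def \<eta>_def poly_in_u_def)
    ultimately show False by blast
  qed
  \<comment> \<open>The norm \<open>\<alpha> ^ 2 - \<beta> ^ 2 * Y\<close> of \<open>d\<close> is
    free of \<open>x\<close> and vanishes on the curve, hence is 0 by independence. At
    \<open>y = 0\<close> it becomes the product of the values of \<open>d\<close> at
    \<open>x = 1\<close> and \<open>x = - 1\<close>.\<close>
  have prod: "\<eta> 1 d * \<eta> (- 1) d = 0" if "d \<in> D" for d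
  proof -
    obtain \<alpha> \<beta> s where d: "d = [:\<alpha>:] + [:\<beta>:] * var_x + s * pell_poly g"
      using reduce_mod_pell[of d g] by blast
    have pz: "\<phi> (pell_poly g) = 0"
      using curve D_eq unfolding curve_on_pell_surface_def by blast
    have "\<phi> d = 0" using that D_eq by blast
    hence 0: "\<phi> [:\<alpha>:] = - (\<phi> [:\<beta>:] * x)"
      unfolding d by (simp only: rhom_simps[OF rhom_\<phi>] pz x_def[symmetric] mult_zero_right add_0_right eq_neg_iff_add_eq_0)
    define Y where "Y = 1 + [:g:] * [:0, 1:] ^ 2"
    have Y: "[:Y:] = 1 + poly_in_u g * var_y ^ 2"
      by (simp add: Y_def poly_in_u_def var_y_def power2_eq_square one_pCons)
    have "\<phi> [:Y:] = x ^ 2"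
      unfolding Y pell by (simp only: rhom_simps[OF rhom_\<phi>] G_def \<phi>_u[symmetric] poly_in_u_def y_def)
    moreover have "[:\<alpha> ^ 2 - \<beta> ^ 2 * Y:] = [:\<alpha>:] ^ 2 - [:\<beta>:] ^ 2 * [:Y:]"
      by (simp add: power2_eq_square)
    ultimately have "\<phi> [:\<alpha> ^ 2 - \<beta> ^ 2 * Y:] = (\<phi> [:\<alpha>:]) ^ 2 - (\<phi> [:\<beta>:]) ^ 2 * x ^ 2"
      by (simp only: rhom_simps[OF rhom_\<phi>])
    also have "\<dots> = 0" unfolding 0 by (simp add: power_mult_distrib)
    finally have "\<alpha> ^ 2 - \<beta> ^ 2 * Y = 0" by (rule indep)
    hence "poly (\<alpha> ^ 2 - \<beta> ^ 2 * Y) 0 = 0" by simp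
    hence sq: "poly \<alpha> 0 ^ 2 - poly \<beta> 0 ^ 2 = 0" by (simp add: Y_def)
    have p0: "\<eta> e (pell_poly g) = 0" if "e ^ 2 = 1" for e
    proof -
      have "\<eta> e var_x = [:e:]" "\<eta> e var_y = 0" by (simp_all add: \<eta>_def var_x_def var_y_def)
      moreover have "[:e:] ^ 2 = 1" using that by (simp add: power2_eq_square one_pCons)
      ultimately show ?thesis
        unfolding pell_poly_def by (simp only: rhom_simps[OF \<eta>]) simp
    qed
    have "\<eta> e d = poly \<alpha> 0 + poly \<beta> 0 * [:e:]" if "e ^ 2 = 1" for e
    proof -
      have "\<eta> e [:\<alpha>:] = poly \<alpha> 0" "\<eta> e [:\<beta>:] = poly \<beta> 0" "\<eta> e var_x = [:e:]"
        by (simp_all add: \<eta>_def var_x_def)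
      thus ?thesis unfolding d by (simp only: rhom_simps[OF \<eta>] p0[OF that] mult_zero_right add_0_right)
    qed
    note e = this
    have "\<eta> 1 d = poly \<alpha> 0 + poly \<beta> 0" "\<eta> (- 1) d = poly \<alpha> 0 - poly \<beta> 0"
      using e[of 1] e[of "- 1"] by simp_all
    hence "\<eta> 1 d * \<eta> (- 1) d = (poly \<alpha> 0 + poly \<beta> 0) * (poly \<alpha> 0 - poly \<beta> 0)"
      by (simp only:)
    also have "\<dots> = poly \<alpha> 0 ^ 2 - poly \<beta> 0 ^ 2" by (simp add: power2_eq_square algebra_simps)
    finally have "\<eta> 1 d * \<eta> (- 1) d = poly \<alpha> 0 ^ 2 - poly \<beta> 0 ^ 2" .
    thus ?thesis using sq by simp
  qed
  \<comment> \<open>Prime avoidance: an element of \<open>D\<close> outside one kernel lies in the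
    other, so the sum of two such elements, one for each kernel, avoids both.\<close>
  obtain d1 where d1: "d1 \<in> D" "\<eta> 1 d1 \<noteq> 0" using ideal[of 1] by blast
  obtain d2 where d2: "d2 \<in> D" "\<eta> (- 1) d2 \<noteq> 0" using ideal[of "- 1"] by blast
  have z: "\<eta> (- 1) d1 = 0" "\<eta> 1 d2 = 0" using prod[OF d1(1)] prod[OF d2(1)] d1(2) d2(2) by simp_all
  have "\<phi> d1 = 0" "\<phi> d2 = 0" using d1(1) d2(1) D_eq by blast+
  hence "\<phi> (d1 + d2) = 0" by (simp add: rhom_add[OF rhom_\<phi>])
  hence "d1 + d2 \<in> D" using D_eq by blast
  from prod[OF this] show False using z d1(2) d2(2) by (simp add: rhom_add[OF \<eta>])
qed

section \<open>Growth at infinity when \<open>u\<close> is transcendental\<close>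

context
  assumes nu: "\<not> algebraic u"
begin

text \<open>Its value at infinity is 0; multiplication by powers of \<open>w\<close> measures growth
  in place of a valuation.\<close>

definition "w = inverse u"

lemma u_nonzero: "u \<noteq> 0"
  using nu algebraic_0 by metis

lemma w: "w \<in> V\<^sub>0" "\<theta>\<^sub>0 w = 0" "w \<noteq> 0" "u = inverse w"
  using inverse_transcendental_at_infinity[of "poly_in_u [:0, 1:]"] nu u_nonzero
  by (simp_all add: w_def u_def[symmetric])

lemma ev_u_leading:
  assumes "Polynomial.degree f \<le> N"
  shows "ev \<iota> u f * w ^ N \<in> V\<^sub>0 \<and> \<theta>\<^sub>0 (ev \<iota> u f * w ^ N) = to_ac (Polynomial.coeff f N)"
  using assms
proof (induction N arbitrary: f)
  case 0
  then obtain a where "f = [:a:]" by (auto elim: degree_eq_zeroE)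
  thus ?case using kplace_0 by (simp add: ev_const rhom_zero[OF \<iota>] kplace_def)
next
  case (Suc N)
  obtain a h where f: "f = pCons a h" by (rule pCons_cases)
  have "Polynomial.degree h \<le> N" using Suc.prems by (auto simp: f split: if_splits)
  note IH = Suc.IH[OF this]
  have \<iota>a: "\<iota> a \<in> V\<^sub>0" using kplace_0 by (simp add: kplace_def)
  have "ev \<iota> u f * w ^ Suc N = \<iota> a * w ^ Suc N + ev \<iota> u h * w ^ N"
    using w(3) by (simp add: f ev_pCons rhom_zero[OF \<iota>] w(4) distrib_right)
  thus ?case using IH \<iota>a w(1,2)
    by (simp add: P\<^sub>0.add P\<^sub>0.mult P\<^sub>0.power P\<^sub>0.\<theta>_add P\<^sub>0.\<theta>_mult P\<^sub>0.\<theta>_power f del: power_Suc)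
qed

text \<open>A polynomial in \<open>u\<close> that lies in \<open>V\<^sub>0\<close> is algebraic, and
  so is its inverse; otherwise the valuation property applies.\<close>

lemma inverse_ev_u: "inverse (ev \<iota> u f) \<in> V\<^sub>0"
proof (cases "ev \<iota> u f \<in> V\<^sub>0")
  case True
  hence "algebraic (ev \<iota> u f)" using regular_at_infinity_imp_algebraic[of "[:[:f:]:]"] by (simp add: \<phi>_u)
  thus ?thesis by (rule algebraic_in_place[OF algebraic_inverse kplace_0])
qed (use P\<^sub>0.total in blast)

text \<open>\<open>y\<close> is algebraic over k(u), so for suitable \<open>N\<close> the scaled
  function \<open>y * w ^ N\<close> is a root of a monic polynomial with coefficients in
  \<open>V\<^sub>0\<close>.\<close>

lemma y_bound: "\<exists>N. y * w ^ N \<in> V\<^sub>0"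
proof -
  obtain A where A: "A \<noteq> 0" "\<phi> [:A:] = 0" using algebraic_dependence by blast
  define Q where "Q = map_poly (ev \<iota> u) A"
  have cQ: "Polynomial.coeff Q i = ev \<iota> u (Polynomial.coeff A i)" for i
    by (simp add: Q_def coeff_map_poly ev_0)
  have Q0: "Q \<noteq> 0"
  proof
    assume Q: "Q = 0"
    have "A = 0"
    proof (rule poly_eqI)
      fix i
      have "ev \<iota> u (Polynomial.coeff A i) = 0" using cQ[of i] Q by simp
      thus "Polynomial.coeff A i = Polynomial.coeff 0 i" using ev_u_eq_0_iff[OF nu] by simp
    qed
    thus False using A(1) by simp
  qed
  have Qy: "poly Q y = 0" using A(2) by (simp add: \<phi>_yu Q_def ev_def[of "ev \<iota> u"])
  define d where "d = Polynomial.degree Q"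
  define l where "l = Polynomial.coeff Q d"
  have l0: "l \<noteq> 0" using Q0 by (simp add: l_def d_def)
  have il: "inverse l \<in> V\<^sub>0" unfolding l_def cQ by (rule inverse_ev_u)
  define N where "N = (\<Sum>i\<le>Polynomial.degree A. Polynomial.degree (Polynomial.coeff A i))"
  have dN: "Polynomial.degree (Polynomial.coeff A i) \<le> N" for i
  proof (cases "i \<le> Polynomial.degree A")
    case True
    thus ?thesis unfolding N_def by (intro member_le_sum) auto
  qed (simp add: coeff_eq_0)
  \<comment> \<open>For \<open>i < d\<close> the coefficient of \<open>f\<close> is that of
    \<open>Q\<close> times \<open>inverse l * w ^ (N * (d - i))\<close>. One factor
    \<open>w ^ N\<close> already cancels its growth, and the top coefficient becomes 1.\<close>
  define f where "f = smult (inverse l * w ^ (N * d)) (pcompose Q [:0, u ^ N:])"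
  have cf: "Polynomial.coeff f i = inverse l * w ^ (N * d) * (u ^ (N * i) * Polynomial.coeff Q i)" for i
    by (simp add: f_def coeff_pcompose_linear power_mult)
  have uw: "u ^ k * w ^ k = 1" for k
    using w(3) by (simp add: w(4) flip: power_mult_distrib)
  have top: "Polynomial.coeff f d = 1"
  proof -
    have "Polynomial.coeff f d = inverse l * l * (u ^ (N * d) * w ^ (N * d))"
      by (simp only: cf l_def mult_ac)
    thus ?thesis by (simp only: uw left_inverse[OF l0] mult_1_right)
  qed
  have "Polynomial.degree f \<le> d"
    by (rule degree_le) (simp add: cf coeff_eq_0 d_def)
  moreover have "d \<le> Polynomial.degree f" by (rule le_degree) (simp add: top)
  ultimately have lc: "Polynomial.lead_coeff f = 1" using top by simp
  have V: "Polynomial.coeff f i \<in> V\<^sub>0" for i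
  proof (cases "i < d")
    case True
    have "N * d = N * i + N + N * (d - Suc i)"
    proof -
      have "d = i + 1 + (d - Suc i)" using True by simp
      hence "N * d = N * (i + 1 + (d - Suc i))" by (rule arg_cong)
      thus ?thesis by (simp only: distrib_left mult_1_right)
    qed
    hence "w ^ (N * d) = w ^ (N * i) * w ^ N * w ^ (N * (d - Suc i))" by (simp only: power_add)
    hence "Polynomial.coeff f i = inverse l * (w ^ N * Polynomial.coeff Q i) * w ^ (N * (d - Suc i)) * (u ^ (N * i) * w ^ (N * i))"
      by (simp only: cf mult_ac)
    also have "\<dots> = inverse l * (ev \<iota> u (Polynomial.coeff A i) * w ^ N) * w ^ (N * (d - Suc i))"
      by (simp only: uw cQ mult_1_right mult.commute[of "w ^ N"])
    finally show ?thesis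
      using il ev_u_leading[OF dN[of i]] w(1) by (simp only: P\<^sub>0.mult P\<^sub>0.power)
  next
    case False
    show ?thesis
    proof (cases "i = d")
      case True thus ?thesis using top P\<^sub>0.one by simp
    next
      case ne: False
      hence "Polynomial.coeff f i = 0" using False by (simp add: cf coeff_eq_0 d_def)
      thus ?thesis using P\<^sub>0.zero by simp
    qed
  qed
  have "y * w ^ N * u ^ N = y * (u ^ N * w ^ N)" by (simp only: mult_ac)
  hence "y * w ^ N * u ^ N = y" by (simp only: uw mult_1_right)
  hence "poly [:0, u ^ N:] (y * w ^ N) = y"
    by (simp only: poly_pCons poly_0 mult_zero_right add_0_right add_0_left)
  hence "poly f (y * w ^ N) = 0" by (simp only: f_def poly_smult poly_pcompose Qy mult_zero_right)
  thus ?thesis using P\<^sub>0.integrally_closed[OF lc V] by blast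
qed

section \<open>The case of a pole of \<open>x\<close>: approximating the square root of
  \<open>g\<close>\<close>

context
  fixes n :: nat
  assumes xV: "x \<notin> V\<^sub>0" and n: "Polynomial.degree g = 2 * n"
begin

lemma y_nonzero: "y \<noteq> 0"
proof
  assume "y = 0"
  hence "x ^ 2 = 1" using pell by simp
  hence "x = \<iota> 1 \<or> x = \<iota> (- 1)" by (rule x_sq_eq_1)
  thus False using xV kplace_0 by (auto simp: kplace_def)
qed

text \<open>This is \<open>x / y\<close> divided by \<open>u ^ n\<close>. As \<open>x / y\<close> is
  close to a square root of \<open>g\<close>, the value at infinity is a square root of the leading
  coefficient.\<close>

definition "r = x * w ^ n / y"

lemma r_square: "r \<in> V\<^sub>0" "\<theta>\<^sub>0 r ^ 2 = to_ac (Polynomial.lead_coeff g)"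
proof -
  note ix = P\<^sub>0.pole[OF xV]
  have x0: "x \<noteq> 0" using xV P\<^sub>0.zero by auto
  \<comment> \<open>The Pell equation becomes \<open>e * x ^ 2 = G * y ^ 2\<close>, and
    \<open>e\<close> has value 1 because \<open>x\<close> has a pole.\<close>
  define e where "e = 1 - inverse x ^ 2"
  have e: "e \<in> V\<^sub>0" "\<theta>\<^sub>0 e = 1"
    using ix by (simp_all add: e_def P\<^sub>0.diff P\<^sub>0.one P\<^sub>0.power P\<^sub>0.\<theta>_diff P\<^sub>0.\<theta>_one P\<^sub>0.\<theta>_power)
  have e0: "e \<noteq> 0" using e(2) P\<^sub>0.\<theta>_zero by auto
  have "inverse x ^ 2 * x ^ 2 = 1" using x0 by (simp flip: power_mult_distrib)
  hence "e * x ^ 2 = x ^ 2 - 1" by (simp only: e_def left_diff_distrib mult_1_left)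
  hence ex: "e * x ^ 2 = G * y ^ 2" by (simp add: pell)
  have "e * r ^ 2 = e * x ^ 2 * w ^ (2 * n) / y ^ 2"
    by (simp add: r_def power_divide power_mult_distrib power_mult mult.commute[of 2])
  also have "\<dots> = G * w ^ (2 * n)" unfolding ex using y_nonzero by simp
  finally have "r ^ 2 = G * w ^ (2 * n) / e" using e0 by (simp add: eq_divide_eq mult.commute)
  moreover have "G * w ^ (2 * n) \<in> V\<^sub>0" "\<theta>\<^sub>0 (G * w ^ (2 * n)) = to_ac (Polynomial.lead_coeff g)"
    using ev_u_leading[of g "2 * n"] n by (simp_all add: G_def)
  ultimately have r2: "r ^ 2 \<in> V\<^sub>0" "\<theta>\<^sub>0 (r ^ 2) = to_ac (Polynomial.lead_coeff g)"
    using e by (simp_all add: P\<^sub>0.divide P\<^sub>0.\<theta>_divide)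
  show rV: "r \<in> V\<^sub>0"
  proof (rule ccontr)
    assume "r \<notin> V\<^sub>0"
    note ir = P\<^sub>0.pole[OF this]
    have "r \<noteq> 0" using \<open>r \<notin> V\<^sub>0\<close> P\<^sub>0.zero by auto
    hence "r ^ 2 * inverse r ^ 2 = 1" by (simp flip: power_mult_distrib)
    moreover have "\<theta>\<^sub>0 (r ^ 2 * inverse r ^ 2) = 0"
      using ir r2(1) by (simp add: P\<^sub>0.\<theta>_mult P\<^sub>0.power P\<^sub>0.\<theta>_power)
    ultimately show False using P\<^sub>0.\<theta>_one by simp
  qed
  show "\<theta>\<^sub>0 r ^ 2 = to_ac (Polynomial.lead_coeff g)"
    using r2(2) by (simp only: P\<^sub>0.\<theta>_power[OF rV])
qed

text \<open>Otherwise conjugating the residue map gives a second geometric point over \<open>V\<^sub>0\<close>.\<close>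

lemma r_rational:
  obtains b where "\<theta>\<^sub>0 r = to_ac b" "b ^ 2 = Polynomial.lead_coeff g" "b \<noteq> 0"
proof -
  have "\<theta>\<^sub>0 r \<in> range to_ac"
  proof (rule ccontr)
    assume nr: "\<theta>\<^sub>0 r \<notin> range to_ac"
    obtain \<sigma> where \<sigma>: "rhom \<sigma>" "\<And>c. \<sigma> (to_ac c) = to_ac c" "\<sigma> (\<theta>\<^sub>0 r) = - \<theta>\<^sub>0 r"
      using square_root_conjugation[OF r_square(2) nr] by blast
    have "place V\<^sub>0 (\<lambda>z. \<sigma> (\<theta>\<^sub>0 z))"
      by unfold_locales
        (simp_all add: P\<^sub>0.one P\<^sub>0.add P\<^sub>0.minus P\<^sub>0.mult P\<^sub>0.total P\<^sub>0.\<theta>_one P\<^sub>0.\<theta>_add P\<^sub>0.\<theta>_mult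
          rhom_simps[OF \<sigma>(1)] rhom_eq_0_iff[OF \<sigma>(1)] P\<^sub>0.\<theta>_eq_0_iff)
    hence k: "kplace V\<^sub>0 (\<lambda>z. \<sigma> (\<theta>\<^sub>0 z))" using kplace_0 \<sigma>(2) by (simp add: kplace_def)
    have "\<phi> var_x \<notin> V\<^sub>0" using xV unfolding x_def .
    from place_unique(2)[OF k this r_square(1)] have "- \<theta>\<^sub>0 r = \<theta>\<^sub>0 r" by (simp only: \<sigma>(3))
    hence "\<theta>\<^sub>0 r + \<theta>\<^sub>0 r = - \<theta>\<^sub>0 r + \<theta>\<^sub>0 r" by (simp only:)
    hence "2 * \<theta>\<^sub>0 r = 0" by (simp only: mult_2 add.left_inverse)
    hence "\<theta>\<^sub>0 r = 0" using two_ac by simp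
    hence "\<theta>\<^sub>0 r = to_ac 0" by simp
    thus False using nr by blast
  qed
  then obtain b where b: "\<theta>\<^sub>0 r = to_ac b" by blast
  have "to_ac (b ^ 2) = to_ac (Polynomial.lead_coeff g)"
    using r_square(2) by (simp only: b to_ac_power)
  hence b2: "b ^ 2 = Polynomial.lead_coeff g" by (simp only: to_ac_eq_iff)
  hence "b \<noteq> 0" using g_nonzero by auto
  thus thesis using that b b2 by blast
qed

text \<open>For constant \<open>g\<close>, equal to \<open>b ^ 2\<close>, the functions
  \<open>x - b * y\<close> and \<open>x + b * y\<close> are mutually inverse. One is regular at
  infinity, so both are algebraic and with them \<open>x\<close>, against its pole.\<close>

lemma degree_pos: "n \<noteq> 0"
proof
  assume "n = 0"
  then obtain a where a: "g = [:a:]" using n by (auto elim: degree_eq_zeroE)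
  obtain b where b: "b ^ 2 = Polynomial.lead_coeff g" using r_rational by blast
  have "ev \<iota> u g = \<iota> (b ^ 2)" unfolding b unfolding a by (simp add: ev_const rhom_zero[OF \<iota>])
  hence G: "G = \<iota> b ^ 2" by (simp only: G_def rhom_power[OF \<iota>])
  define p q where "p = x - \<iota> b * y" and "q = x + \<iota> b * y"
  have "p * q = x ^ 2 - G * y ^ 2" by (simp add: p_def q_def G power2_eq_square algebra_simps)
  hence pq: "p * q = 1" using pell by simp
  have "p = \<phi> (var_x - const3 b * var_y)" "q = \<phi> (var_x + const3 b * var_y)"
    by (simp_all only: p_def q_def rhom_simps[OF rhom_\<phi>] x_def y_def \<iota>_def)
  hence reg: "p \<in> V\<^sub>0 \<Longrightarrow> algebraic p" "q \<in> V\<^sub>0 \<Longrightarrow> algebraic q"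
    using regular_at_infinity_imp_algebraic by simp_all
  have "q = inverse p" using pq by (rule inverse_unique[symmetric])
  hence "algebraic p \<longleftrightarrow> algebraic q" using algebraic_inverse algebraic_inverse_imp by blast
  moreover have "p \<in> V\<^sub>0 \<or> q \<in> V\<^sub>0" unfolding \<open>q = inverse p\<close> by (rule P\<^sub>0.total)
  ultimately have "algebraic p" "algebraic q" using reg by blast+
  hence "algebraic ((p + q) / \<iota> 2)" by (intro algebraic_divide algebraic_add algebraic_const)
  moreover have "(p + q) / \<iota> 2 = x" using two_F by (simp add: p_def q_def \<iota>_two)
  ultimately show False using algebraic_in_place[OF _ kplace_0] xV by simp
qed

text \<open>
  Write \<open>|z|\<close> for the size at the place at infinity. Since \<open>x / y\<close> is close to \<open>\<surd>g\<close>, a rational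
  approximation \<open>p / q\<close> of \<open>\<surd>g\<close> whose denominator satisfies \<open>|q| \<le> |y|\<close> makes \<open>|p y - q x| < 1\<close>.
\<close>

lemma coprime_relation:
  obtains p q a b where "a * p + b * q = 1" "ev \<iota> u p * y = ev \<iota> u q * x"
proof -
  obtain n' where n': "n = Suc n'" using degree_pos by (cases n) auto
  obtain \<beta> where \<beta>: "\<theta>\<^sub>0 r = to_ac \<beta>" "\<beta> ^ 2 = Polynomial.lead_coeff g" "\<beta> \<noteq> 0"
    using r_rational by blast
  \<comment> \<open>The size of \<open>y\<close> is at least that of \<open>u ^ m\<close> and less
    than that of \<open>u ^ Suc m\<close>.\<close>
  define m where "m = (LEAST m. y * w ^ Suc m \<in> V\<^sub>0 \<and> \<theta>\<^sub>0 (y * w ^ Suc m) = 0)"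
  have "\<exists>m. y * w ^ Suc m \<in> V\<^sub>0 \<and> \<theta>\<^sub>0 (y * w ^ Suc m) = 0"
  proof -
    obtain N where N: "y * w ^ N \<in> V\<^sub>0" using y_bound by blast
    have "y * w ^ Suc N = y * w ^ N * w" by simp
    hence "y * w ^ Suc N \<in> V\<^sub>0 \<and> \<theta>\<^sub>0 (y * w ^ Suc N) = 0"
      using N w(1,2) by (simp only: P\<^sub>0.mult P\<^sub>0.\<theta>_mult mult_zero_right)
    thus ?thesis by blast
  qed
  hence Y1: "y * w ^ Suc m \<in> V\<^sub>0" "\<theta>\<^sub>0 (y * w ^ Suc m) = 0"
    unfolding m_def by (rule LeastI_ex[THEN conjunct1], rule LeastI_ex[THEN conjunct2])
  have Y2: "inverse (y * w ^ m) \<in> V\<^sub>0"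
  proof (cases m)
    \<comment> \<open>Minimality says nothing for \<open>m = 0\<close>, but if \<open>y\<close> is
      regular at infinity, it is algebraic and so is its inverse.\<close>
    case 0
    show ?thesis
    proof (cases "y \<in> V\<^sub>0")
      case True
      hence "algebraic y" using regular_at_infinity_imp_algebraic[of var_y] by (simp add: y_def)
      thus ?thesis using algebraic_in_place[OF algebraic_inverse kplace_0] 0 by simp
    next
      case False
      thus ?thesis using P\<^sub>0.total[of y] 0 by simp
    qed
  next
    case (Suc m')
    have "\<not> (y * w ^ Suc m' \<in> V\<^sub>0 \<and> \<theta>\<^sub>0 (y * w ^ Suc m') = 0)"
      using not_less_Least[of m' "\<lambda>m. y * w ^ Suc m \<in> V\<^sub>0 \<and> \<theta>\<^sub>0 (y * w ^ Suc m) = 0"] Suc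
      unfolding m_def[symmetric] by simp
    thus ?thesis unfolding Suc using P\<^sub>0.total P\<^sub>0.inverse by blast
  qed
  \<comment> \<open>\<open>T\<close> is the denominator in the approximation \<open>h / T\<close> of
    the square root of \<open>g\<close>. Its degree is chosen so that the bound \<open>m\<close> on
    \<open>q\<close> leaves a Thue remainder of degree at most \<open>m\<close> as well.\<close>
  define M where "M = Suc (2 * m)"
  define T where "T = monom (1::'k) M"
  have two_n: "n + M > 0" by (simp add: n')
  have T0: "T \<noteq> 0" and dT: "Polynomial.degree T = M" by (simp_all add: T_def degree_monom_eq)
  have lT: "Polynomial.lead_coeff T = 1" unfolding dT by (simp add: T_def)
  obtain h where h: "Polynomial.degree h \<le> n + M" "Polynomial.coeff h (n + M) = \<beta>"
      "Polynomial.degree (h ^ 2 - T ^ 2 * g) < n + M"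
  proof (rule poly_sqrt_approx[OF two \<beta>(3) two_n])
    have d: "Polynomial.degree (T ^ 2 * g) = 2 * (n + M)"
      using g_nonzero T0 by (simp add: degree_mult_eq degree_power_eq dT n)
    thus "Polynomial.degree (T ^ 2 * g) = 2 * (n + M)" .
    have "Polynomial.lead_coeff (T ^ 2 * g) = \<beta> ^ 2"
      by (simp only: lead_coeff_mult lead_coeff_power lT \<beta>(2)) simp
    thus "Polynomial.coeff (T ^ 2 * g) (2 * (n + M)) = \<beta> ^ 2" by (simp only: d)
  qed (rule that)
  have mT: "m < Polynomial.degree T" by (simp add: dT M_def)
  obtain p q a b where pq: "a * p + b * q = 1" "Polynomial.degree q \<le> m"
      and s: "q * h - p * T = 0 \<or> Polynomial.degree (q * h - p * T) + m < Polynomial.degree T"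
    by (rule thue_poly[OF T0 mT])
  define s where "s = q * h - p * T"
  have ds: "Polynomial.degree s \<le> m" using s by (auto simp: s_def[symmetric] dT M_def)
  define \<rho> where "\<rho> = h ^ 2 - T ^ 2 * g"
  have d\<rho>: "Polynomial.degree \<rho> \<le> n' + M" using h(3) by (simp add: \<rho>_def n')
  note e_simps = rhom_simps[OF rhom_u]
  define A B K where "A = u ^ m" and "B = u ^ n'" and "K = A * A * u"
  have A0: "A \<noteq> 0" "B \<noteq> 0" "K \<noteq> 0" using u_nonzero by (simp_all add: A_def B_def K_def)
  have uM: "u ^ M = K" 
  proof -
    have "M = m + m + 1" by (simp add: M_def)
    thus ?thesis by (simp only: K_def A_def power_add power_one_right)
  qed
  have un: "u ^ n = B * u" by (simp add: B_def n')
  have eT: "ev \<iota> u T = K" by (simp add: T_def ev_monom[OF \<iota>] rhom_one[OF \<iota>] uM)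
  have w_pow: "w ^ k = inverse (u ^ k)" for k by (simp add: w_def power_inverse)
  \<comment> \<open>\<open>e\<close> is the sum of \<open>h / T\<close> and \<open>x / y\<close>,
    scaled by \<open>w ^ n\<close>. The leading coefficient of \<open>h\<close> was taken to be the
    value of \<open>r\<close>, so both terms have value \<open>\<beta>\<close> and do not
    cancel.\<close>
  define e where "e = ev \<iota> u h / (B * u * K) + x / (y * (B * u))"
  have e1: "ev \<iota> u h / (B * u * K) = ev \<iota> u h * w ^ (n + M)"
    unfolding w_pow power_add uM un by (simp add: field_class.field_divide_inverse)
  have e2: "x / (y * (B * u)) = r"
    unfolding r_def w_pow un by (simp add: field_class.field_divide_inverse)
  have "e \<in> V\<^sub>0" "\<theta>\<^sub>0 e = to_ac \<beta> + to_ac \<beta>"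
    unfolding e_def e1 e2 using ev_u_leading[OF h(1)] r_square(1)
    by (simp_all add: P\<^sub>0.add P\<^sub>0.\<theta>_add h(2) \<beta>(1))
  moreover have "to_ac \<beta> + to_ac \<beta> \<noteq> 0"
    using two_ac \<beta>(3) unfolding mult_2[symmetric] by simp
  ultimately have ie: "inverse e \<in> V\<^sub>0" and e0: "e \<noteq> 0" using P\<^sub>0.inverse P\<^sub>0.\<theta>_zero by auto
  define P Q S R where "P = ev \<iota> u p" and "Q = ev \<iota> u q" and "S = ev \<iota> u s" and "R = ev \<iota> u \<rho>"
  have S: "S = Q * ev \<iota> u h - P * K" by (simp only: S_def P_def Q_def s_def e_simps eT)
  have R: "R = ev \<iota> u h ^ 2 - K ^ 2 * G" by (simp only: R_def \<rho>_def e_simps eT G_def)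
  \<comment> \<open>All factors on the right will turn out regular at infinity, and each summand
    contains one that vanishes there.\<close>
  have id: "P * y - Q * x = Q / A * inverse e * (R / (B * K) * (y / (A * u) / u) - A / y / (B * u)) - S / A * (y / (A * u))"
    by (rule approximation_identity[OF u_nonzero A0(1,2) y_nonzero pell K_def S R e_def e0])
  have QA: "Q / A \<in> V\<^sub>0" and SA: "S / A \<in> V\<^sub>0" and RB: "R / (B * K) \<in> V\<^sub>0"
    using ev_u_leading[OF pq(2)] ev_u_leading[OF ds] ev_u_leading[OF d\<rho>]
    unfolding w_pow power_add uM
    by (simp_all add: Q_def S_def R_def A_def[symmetric] B_def[symmetric] field_class.field_divide_inverse)
  have yA: "y / (A * u) = y * w ^ Suc m"
    unfolding w_pow by (simp add: A_def field_class.field_divide_inverse mult.commute)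
  have yAV: "y / (A * u) \<in> V\<^sub>0" "\<theta>\<^sub>0 (y / (A * u)) = 0" unfolding yA by (rule Y1)+
  have yuV: "y / (A * u) / u \<in> V\<^sub>0" "\<theta>\<^sub>0 (y / (A * u) / u) = 0"
    using yAV w(1,2) unfolding field_class.field_divide_inverse[of _ u] w_def[symmetric]
    by (simp_all only: P\<^sub>0.mult P\<^sub>0.\<theta>_mult mult_zero_right)
  have Ay: "A / y / (B * u) = inverse (y * w ^ m) * w ^ n' * w"
    unfolding w_pow by (simp add: A_def B_def w_def field_class.field_divide_inverse)
  have AyV: "A / y / (B * u) \<in> V\<^sub>0" "\<theta>\<^sub>0 (A / y / (B * u)) = 0"
    unfolding Ay using Y2 w(1,2) by (simp_all only: P\<^sub>0.mult P\<^sub>0.power P\<^sub>0.\<theta>_mult mult_zero_right)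
  have RyV: "R / (B * K) * (y / (A * u) / u) \<in> V\<^sub>0" "\<theta>\<^sub>0 (R / (B * K) * (y / (A * u) / u)) = 0"
    using RB yuV by (simp_all only: P\<^sub>0.mult P\<^sub>0.\<theta>_mult mult_zero_right)
  have D: "R / (B * K) * (y / (A * u) / u) - A / y / (B * u) \<in> V\<^sub>0"
      "\<theta>\<^sub>0 (R / (B * K) * (y / (A * u) / u) - A / y / (B * u)) = 0"
    using RyV AyV by (simp_all only: P\<^sub>0.diff P\<^sub>0.\<theta>_diff diff_self)
  have QeV: "Q / A * inverse e \<in> V\<^sub>0" by (rule P\<^sub>0.mult[OF QA ie])
  have zV: "P * y - Q * x \<in> V\<^sub>0" "\<theta>\<^sub>0 (P * y - Q * x) = 0"
    unfolding id using QeV D SA yAV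
    by (simp_all only: P\<^sub>0.mult P\<^sub>0.diff P\<^sub>0.\<theta>_diff P\<^sub>0.\<theta>_mult mult_zero_right diff_self)
  have "P * y - Q * x = \<phi> ([:[:p:]:] * var_y - [:[:q:]:] * var_x)"
    by (simp only: rhom_diff[OF rhom_\<phi>] rhom_mult[OF rhom_\<phi>] \<phi>_u x_def y_def P_def Q_def)
  \<comment> \<open>A regular function with value 0 at infinity is algebraic, hence zero.\<close>
  hence "algebraic (P * y - Q * x)" using regular_at_infinity_imp_algebraic zV(1) by simp
  hence "P * y - Q * x = 0" using kplace_algebraic_nonzero[OF kplace_0] zV(2) by blast
  hence "P * y = Q * x" by simp
  thus thesis using that pq(1) by (simp add: P_def Q_def)
qed

lemma affine_line_pole: "affine_line D"
proof -
  obtain p q a b where ab: "a * p + b * q = 1" and rel: "ev \<iota> u p * y = ev \<iota> u q * x"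
    by (rule coprime_relation)
  define P Q A B where "P = ev \<iota> u p" and "Q = ev \<iota> u q" and "A = ev \<iota> u a" and "B = ev \<iota> u b"
  have AB: "A * P + B * Q = 1"
    using arg_cong[OF ab, of "ev \<iota> u"] by (simp only: rhom_simps[OF rhom_u] A_def B_def P_def Q_def)
  have rel': "P * y = Q * x" using rel by (simp only: P_def Q_def)
  \<comment> \<open>By the Bezout relation this is the common factor of \<open>x\<close> and
    \<open>y\<close>, whose ratio is that of the coprime \<open>P\<close> and
    \<open>Q\<close>.\<close>
  define c where "c = A * x + B * y"
  have "P * c = A * P * x + B * (P * y)" by (simp add: c_def algebra_simps)
  also have "\<dots> = (A * P + B * Q) * x" unfolding rel' by (simp add: algebra_simps)
  finally have x: "x = P * c" by (simp only: AB mult_1_left)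
  have "Q * c = A * (Q * x) + B * Q * y" by (simp add: c_def algebra_simps)
  also have "\<dots> = (A * P + B * Q) * y" unfolding rel'[symmetric] by (simp add: algebra_simps)
  finally have y: "y = Q * c" by (simp only: AB mult_1_left)
  \<comment> \<open>The Pell equation makes \<open>c\<close> a unit of the coordinate ring. Either
    \<open>c\<close> or its inverse is regular at infinity, so \<open>c\<close> is
    algebraic.\<close>
  have "c * (c * (P ^ 2 - G * Q ^ 2)) = (P * c) ^ 2 - G * (Q * c) ^ 2"
    by (simp add: power2_eq_square algebra_simps)
  also have "\<dots> = x ^ 2 - G * y ^ 2" by (simp only: x[symmetric] y[symmetric])
  finally have unit: "c * (c * (P ^ 2 - G * Q ^ 2)) = 1" using pell by simp
  note R = range_add[OF rhom_\<phi>] range_mult[OF rhom_\<phi>]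
  have cr: "c \<in> range \<phi>" unfolding c_def A_def B_def by (intro R in_range)
  have "P ^ 2 - G * Q ^ 2 = ev \<iota> u (p ^ 2 - g * q ^ 2)"
    by (simp only: rhom_simps[OF rhom_u] P_def Q_def G_def)
  hence ir: "c * (P ^ 2 - G * Q ^ 2) \<in> range \<phi>" by (simp only: R cr in_range)
  have ic: "c * (P ^ 2 - G * Q ^ 2) = inverse c" using unit by (rule inverse_unique[symmetric])
  have reg: "algebraic z" if "z \<in> range \<phi>" "z \<in> V\<^sub>0" for z
    using that regular_at_infinity_imp_algebraic by blast
  have c: "algebraic c"
  proof (cases "c \<in> V\<^sub>0")
    case False
    hence "inverse c \<in> V\<^sub>0" using P\<^sub>0.total by blast
    hence "algebraic (inverse c)" using ir unfolding ic by (rule reg[rotated])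
    thus ?thesis by (rule algebraic_inverse_imp)
  qed (rule reg[OF cr])
  let ?R = "range (ev (ev \<iota> c) u)"
  note m = generated_members[where c = c and t = u]
  have r: "rhom (ev (ev \<iota> c) u)" by (intro rhom_ev \<iota>)
  note R' = range_add[OF r] range_mult[OF r]
  have "ev \<iota> u f \<in> ?R" for f by (rule ev_closed[OF m(3,2) R' \<iota>])
  hence "P * c \<in> ?R" "Q * c \<in> ?R" unfolding P_def Q_def by (intro R' m(1); assumption)+
  hence "x \<in> ?R" "y \<in> ?R" by (simp_all only: x[symmetric] y[symmetric])
  thus ?thesis by (intro affine_line_if[OF c nu cr in_range(3)] m(2))
qed

end
end

lemma affine_line: "affine_line D"
proof (cases "algebraic u")
  case True
  thus ?thesis by (rule affine_line_vertical)
next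
  case nu: False
  obtain n where n: "Polynomial.degree g = 2 * n" using g_even by (elim evenE)
  show ?thesis
  proof (cases "x \<in> V\<^sub>0")
    case True
    thus ?thesis by (rule affine_line_horizontal[OF nu])
  next
    case False
    thus ?thesis by (rule affine_line_pole[OF nu _ n])
  qed
qed

end

theorem theorem4:
  fixes g :: "'k::field poly"
    and D :: "'k poly3 set"
    and \<phi> :: "'k poly3 \<Rightarrow> 'F::field"
  assumes char: "CHAR('k) \<noteq> 2"
    and g_nonzero: "g \<noteq> 0"
    and g_even: "even (Polynomial.degree g)"
    and curve: "curve_on_pell_surface g D"
    and function_field: "is_function_field D \<phi>"
    and one_place: "only_one_place_at_infinity \<phi>"
  shows "affine_line D"
proof -
  interpret pell_curve D \<phi> g
    by unfold_locales (fact assms)+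
  show ?thesis by (rule affine_line)
qed

end
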